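(* Let $\mathcal{H}$ be a separable infinite-dimensional Hilbert space and $I$ a non-empty countable index set. Let $X$ be the space of strongly continuous contractive semigroups over $\mathbb{R}_{\ge 0}^{\circledast I}$ on $\mathcal{H}$, endowed with the topology $k_{\mathrm{WOT}}$ of uniform weak convergence on compact subsets of $\mathbb{R}_{\ge 0}^{\circledast I}$. Then the subspace $X_u\subseteq X$ of unitary semigroups (those $\mathcal{T}\in X$ with $\mathcal{T}(x)$ unitary for every $x$) is a dense $G_\delta$ subset of $(X,k_{\mathrm{WOT}})$.
   Context: Free topological product: $\mathbb{R}^{\circledast I}$ is the free topological product of copies $G_i=\mathbb{R}$ ($i\in I$) of the additive topological group $\mathbb{R}$, i.e. the (unique up to algebraic and topological isomorphism) topological group $G$ together with continuous homomorphisms $\iota_i:\mathbb{R}\to G$ such that $G$ is algebraically generated by $\bigcup_{i\in I}\iota_i(\mathbb{R})$, and for every topological group $\Gamma$ and continuous homomorphisms $\theta_i:\mathbb{R}\to\Gamma$ ($i\in I$) there is a continuous homomorphism $\theta:G\to\Gamma$ with $\theta\circ\iota_i=\theta_i$ for all $i$. $\mathbb{R}_{\ge0}^{\circledast I}\subseteq\mathbb{R}^{\circledast I}$ is the submonoid of all finite products $\prod_{k=1}^N\iota_{i_k}(t_k)$ with $N\in\mathbb{N}_0$, $i_k\in I$, $t_k\in\mathbb{R}_{\ge 0}$, with the relative topology. A strongly continuous contractive semigroup over a topological monoid $M$ on $\mathcal{H}$ is a map $\mathcal{T}$ from $M$ to the contractions on $\mathcal{H}$ with $\mathcal{T}(e)=\mathbf{1}$,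 $\mathcal{T}(xy)=\mathcal{T}(x)\mathcal{T}(y)$, continuous in the strong operator topology. The topology $k_{\mathrm{WOT}}$ is given by: $\mathcal{T}^{(\alpha)}\to\mathcal{T}$ iff $\sup_{x\in K}|\langle(\mathcal{T}^{(\alpha)}(x)-\mathcal{T}(x))\xi,\eta\rangle|\to 0$ for all compact $K\subseteq\mathbb{R}_{\ge0}^{\circledast I}$ and all $\xi,\eta\in\mathcal{H}$. *)

theory Defs
  imports "HOL-Analysis.Analysis" "HOL-Algebra.Product_Groups"
begin

section \<open>Complex Hilbert spaces and operators\<close>

text \<open>Norm, metric and completeness come from the real Banach space class; the last axiom says
  that the norm is the one induced by the inner product (hence \<open>cinner\<close> is positive definite).
  The inner product is linear in its first argument.\<close>

class complex_hilbert_space = banach +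
  fixes scaleC :: "complex \<Rightarrow> 'a \<Rightarrow> 'a" (infixr \<open>*\<^sub>C\<close> 75)
    and cinner :: "'a \<Rightarrow> 'a \<Rightarrow> complex"
  assumes scaleC_add_right: "a *\<^sub>C (x + y) = a *\<^sub>C x + a *\<^sub>C y"
    and scaleC_add_left: "(a + b) *\<^sub>C x = a *\<^sub>C x + b *\<^sub>C x"
    and scaleC_scaleC: "a *\<^sub>C (b *\<^sub>C x) = (a * b) *\<^sub>C x"
    and scaleC_of_real: "complex_of_real r *\<^sub>C x = r *\<^sub>R x"
    and cinner_commute: "cinner x y = cnj (cinner y x)"
    and cinner_add_left: "cinner (x + y) z = cinner x z + cinner y z"
    and cinner_scaleC_left: "cinner (a *\<^sub>C x) y = a * cinner x y"
    and cinner_self: "cinner x x = complex_of_real ((norm x)\<^sup>2)"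

global_interpretation complex_vector: vector_space "scaleC :: complex \<Rightarrow> 'a::complex_hilbert_space \<Rightarrow> 'a"
proof
  fix x :: 'a
  show "1 *\<^sub>C x = x"
    using scaleC_of_real[of 1 x] by simp
qed (simp_all add: scaleC_add_right scaleC_add_left scaleC_scaleC)

lemma cinner_add_right: "cinner x (y + z) = cinner x y + cinner x z"
  by (metis cinner_add_left cinner_commute complex_cnj_add)

lemma cinner_scaleC_right: "cinner x (a *\<^sub>C y) = cnj a * cinner x y"
  by (metis cinner_scaleC_left cinner_commute complex_cnj_mult)

lemma cinner_diff_left: "cinner (x - y) z = cinner x z - cinner y z"
  by (metis cinner_add_left diff_add_cancel eq_diff_eq)

lemma cinner_zero_left [simp]: "cinner 0 y = 0"
  using cinner_add_left[of 0 0 y] by simp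

lemma norm_cinner_le: "cmod (cinner x y) \<le> norm x * norm y"
proof (cases "y = 0")
  case True
  then show ?thesis
    by (subst cinner_commute) simp
next
  case False
  define n where "n = complex_of_real ((norm y)\<^sup>2)"
  define a where "a = cinner x y / n"
  have n0: "n \<noteq> 0"
    using False by (simp add: n_def)
  have yx: "cinner y x = cnj (cinner x y)"
    by (rule cinner_commute)
  have nn: "cnj n = n"
    by (simp add: n_def)
  have mul: "cinner x y * cnj (cinner x y) = complex_of_real ((cmod (cinner x y))\<^sup>2)"
    by (metis complex_norm_square)
  have "cinner (x + b *\<^sub>C y) (x + b *\<^sub>C y)
      = cinner x x + cnj b * cinner x y + b * cinner y x + b * cnj b * n" for b
    by (simp only: cinner_add_left cinner_add_right cinner_scaleC_left cinner_scaleC_right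
        cinner_self[of y] n_def) (simp only: algebra_simps)
  from this[of "- a"] have "cinner (x + (- a) *\<^sub>C y) (x + (- a) *\<^sub>C y)
      = cinner x x - cnj a * cinner x y - a * cinner y x + a * cnj a * n"
    by (simp only: complex_cnj_minus minus_mult_left[symmetric] mult_minus_left mult_minus_right
        minus_minus add_uminus_conv_diff)
  also have "\<dots> = cinner x x - cinner x y * cnj (cinner x y) / n"
    using n0 by (simp add: a_def yx nn field_simps)
  finally have "complex_of_real ((norm (x + (- a) *\<^sub>C y))\<^sup>2)
      = complex_of_real ((norm x)\<^sup>2 - (cmod (cinner x y))\<^sup>2 / (norm y)\<^sup>2)"
    unfolding cinner_self mul n_def by simp
  then have "(norm (x + (- a) *\<^sub>C y))\<^sup>2 = (norm x)\<^sup>2 - (cmod (cinner x y))\<^sup>2 / (norm y)\<^sup>2"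
    using of_real_eq_iff by blast
  then have "(cmod (cinner x y))\<^sup>2 / (norm y)\<^sup>2 \<le> (norm x)\<^sup>2"
    by (metis diff_ge_0_iff_ge zero_le_power2)
  then have "(cmod (cinner x y))\<^sup>2 \<le> (norm x * norm y)\<^sup>2"
    using False by (simp add: power_mult_distrib divide_le_eq)
  then show ?thesis
    by (rule power2_le_imp_le) simp
qed

text \<open>The type \<open>'h \<Rightarrow>\<^sub>L 'h\<close> consists of the bounded \<^emph>\<open>real\<close>-linear operators, hence the explicit
  complex homogeneity.\<close>

definition contraction :: "('h::complex_hilbert_space \<Rightarrow>\<^sub>L 'h) \<Rightarrow> bool" where
  "contraction A \<longleftrightarrow> (\<forall>c x. blinfun_apply A (c *\<^sub>C x) = c *\<^sub>C blinfun_apply A x) \<and> norm A \<le> 1"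

definition is_adjoint ::
  "('h::complex_hilbert_space \<Rightarrow>\<^sub>L 'h) \<Rightarrow> ('h \<Rightarrow>\<^sub>L 'h) \<Rightarrow> bool" where
  "is_adjoint A B \<longleftrightarrow> (\<forall>x y. cinner (blinfun_apply A x) y = cinner x (blinfun_apply B y))"

text \<open>Complex linearity need not be demanded: it follows from the existence of an adjoint.\<close>

definition unitary :: "('h::complex_hilbert_space \<Rightarrow>\<^sub>L 'h) \<Rightarrow> bool" where
  "unitary U \<longleftrightarrow> (\<exists>V. is_adjoint U V \<and> V o\<^sub>L U = id_blinfun \<and> U o\<^sub>L V = id_blinfun)"

lemma is_adjoint_scaleC:
  assumes "is_adjoint A B"
  shows "blinfun_apply A (c *\<^sub>C x) = c *\<^sub>C blinfun_apply A x"
proof -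
  let ?d = "blinfun_apply A (c *\<^sub>C x) - c *\<^sub>C blinfun_apply A x"
  have "cinner ?d y = 0" for y
    using assms by (simp add: is_adjoint_def cinner_diff_left cinner_scaleC_left)
  then have "complex_of_real ((norm ?d)\<^sup>2) = 0"
    by (metis cinner_self)
  then show ?thesis
    by simp
qed


section \<open>Free topological products\<close>

definition topological_group :: "'g monoid \<Rightarrow> 'g topology \<Rightarrow> bool" where
  "topological_group G \<tau> \<longleftrightarrow> group G \<and> topspace \<tau> = carrier G \<and>
     continuous_map (prod_topology \<tau> \<tau>) \<tau> (\<lambda>(x, y). x \<otimes>\<^bsub>G\<^esub> y) \<and>
     continuous_map \<tau> \<tau> (\<lambda>x. inv\<^bsub>G\<^esub> x)"

definition real_group :: "real monoid" where
  "real_group = \<lparr>carrier = UNIV, monoid.mult = (+), one = 0\<rparr>"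

definition continuous_one_param :: "'g monoid \<Rightarrow> 'g topology \<Rightarrow> (real \<Rightarrow> 'g) \<Rightarrow> bool" where
  "continuous_one_param G \<tau> \<theta> \<longleftrightarrow> \<theta> \<in> hom real_group G \<and> continuous_map euclideanreal \<tau> \<theta>"

text \<open>The free topological product of copies of \<open>\<real>\<close> indexed by \<open>I\<close>, characterised up to isomorphism
  by its universal property. A HOL formula cannot quantify over types, so the test groups \<open>\<Gamma>\<close> range
  over all topological groups whose carrier is a set of words \<open>(i\<^sub>1, t\<^sub>1) \<dots> (i\<^sub>N, t\<^sub>N)\<close>. This is no
  restriction, since only the subgroup of \<open>\<Gamma>\<close> generated by the images of the \<open>\<theta> i\<close> matters and
  this subgroup is an image of the set of words: \<open>free_topological_product_universal\<close> below gives
  the universal property for topological groups over arbitrary types, and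
  \<open>free_topological_product_exists\<close> shows existence.\<close>

definition free_topological_product ::
  "'i set \<Rightarrow> 'g monoid \<Rightarrow> 'g topology \<Rightarrow> ('i \<Rightarrow> real \<Rightarrow> 'g) \<Rightarrow> bool" where
  "free_topological_product I G \<tau> \<iota> \<longleftrightarrow>
     topological_group G \<tau> \<and>
     (\<forall>i\<in>I. continuous_one_param G \<tau> (\<iota> i)) \<and>
     carrier G = generate G (\<Union>i\<in>I. range (\<iota> i)) \<and>
     (\<forall>(\<Gamma> :: ('i \<times> real) list monoid) \<sigma> \<theta>.
        topological_group \<Gamma> \<sigma> \<longrightarrow> (\<forall>i\<in>I. continuous_one_param \<Gamma> \<sigma> (\<theta> i)) \<longrightarrow>
        (\<exists>h \<in> hom G \<Gamma>. continuous_map \<tau> \<sigma> h \<and> (\<forall>i\<in>I. \<forall>t. h (\<iota> i t) = \<theta> i t)))"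

definition word_prod :: "'g monoid \<Rightarrow> ('i \<Rightarrow> real \<Rightarrow> 'g) \<Rightarrow> ('i \<times> real) list \<Rightarrow> 'g" where
  "word_prod G \<iota> w = foldr (\<lambda>(i, t) x. \<iota> i t \<otimes>\<^bsub>G\<^esub> x) w \<one>\<^bsub>G\<^esub>"

definition nonneg_submonoid :: "'i set \<Rightarrow> 'g monoid \<Rightarrow> ('i \<Rightarrow> real \<Rightarrow> 'g) \<Rightarrow> 'g monoid" where
  "nonneg_submonoid I G \<iota> = G\<lparr>carrier := {word_prod G \<iota> w | w. set w \<subseteq> I \<times> {0..}}\<rparr>"

lemma carrier_real_group [simp]: "carrier real_group = UNIV"
  and one_real_group [simp]: "\<one>\<^bsub>real_group\<^esub> = 0"
  and mult_real_group [simp]: "x \<otimes>\<^bsub>real_group\<^esub> y = x + y"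
  by (simp_all add: real_group_def)

lemma group_real_group [simp]: "group real_group"
  by (rule groupI) (auto simp: add.assoc intro: exI[of _ "- x" for x])

lemma inv_real_group [simp]: "inv\<^bsub>real_group\<^esub> x = - x"
  by (rule group.inv_equality) auto

lemma topological_group_subgroup:
  assumes G: "topological_group G \<tau>" and H: "subgroup H G"
  shows "topological_group (G\<lparr>carrier := H\<rparr>) (subtopology \<tau> H)"
proof -
  interpret group G
    using G by (simp add: topological_group_def)
  have sub: "H \<subseteq> carrier G" and top: "topspace \<tau> = carrier G"
    using H G subgroup.subset by (auto simp: topological_group_def)
  have inv: "inv\<^bsub>G\<lparr>carrier := H\<rparr>\<^esub> x = inv\<^bsub>G\<^esub> x" if "x \<in> H" for x
    using m_inv_consistent[OF H that] .
  have "continuous_map (prod_topology \<tau> \<tau>) \<tau> (\<lambda>(x, y). x \<otimes>\<^bsub>G\<^esub> y)" "continuous_map \<tau> \<tau> (\<lambda>x. inv\<^bsub>G\<^esub> x)"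
    using G by (auto simp: topological_group_def)
  then have "continuous_map (prod_topology (subtopology \<tau> H) (subtopology \<tau> H)) (subtopology \<tau> H) (\<lambda>(x, y). x \<otimes>\<^bsub>G\<^esub> y)"
    and "continuous_map (subtopology \<tau> H) (subtopology \<tau> H) (\<lambda>x. inv\<^bsub>G\<^esub> x)"
    using H by (auto simp: continuous_map_in_subtopology prod_topology_subtopology
        continuous_map_from_subtopology subgroup.m_closed subgroup.m_inv_closed)
  moreover from this(2)
  have "continuous_map (subtopology \<tau> H) (subtopology \<tau> H) (\<lambda>x. inv\<^bsub>G\<lparr>carrier := H\<rparr>\<^esub> x)"
    by (rule continuous_map_eq) (simp add: inv)
  ultimately show ?thesis
    using sub top subgroup_imp_group[OF H]
    by (auto simp: topological_group_def)
qed

lemma topological_group_product: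
  assumes "\<And>j. j \<in> J \<Longrightarrow> topological_group (G j) (\<tau> j)"
  shows "topological_group (product_group J G) (product_topology \<tau> J)"
proof -
  have gr: "\<And>j. j \<in> J \<Longrightarrow> group (G j)" and top: "\<And>j. j \<in> J \<Longrightarrow> topspace (\<tau> j) = carrier (G j)"
    and mul: "\<And>j. j \<in> J \<Longrightarrow> continuous_map (prod_topology (\<tau> j) (\<tau> j)) (\<tau> j) (\<lambda>(x, y). x \<otimes>\<^bsub>G j\<^esub> y)"
    and inv: "\<And>j. j \<in> J \<Longrightarrow> continuous_map (\<tau> j) (\<tau> j) (\<lambda>x. inv\<^bsub>G j\<^esub> x)"
    using assms by (auto simp: topological_group_def)
  let ?P = "product_topology \<tau> J"
  have tops: "topspace ?P = carrier (product_group J G)"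
    by (auto simp: top PiE_iff)
  have "continuous_map (prod_topology ?P ?P) ?P (\<lambda>(x, y). \<lambda>j\<in>J. x j \<otimes>\<^bsub>G j\<^esub> y j)"
    unfolding continuous_map_componentwise
  proof (intro conjI ballI)
    fix j assume j: "j \<in> J"
    have "continuous_map (prod_topology ?P ?P) (prod_topology (\<tau> j) (\<tau> j)) (\<lambda>p. (fst p j, snd p j))"
      using continuous_map_compose[OF continuous_map_fst continuous_map_product_projection[OF j], of \<tau> ?P]
        continuous_map_compose[OF continuous_map_snd continuous_map_product_projection[OF j], of ?P \<tau>]
      by (simp add: continuous_map_pairwise o_def)
    from continuous_map_compose[OF this mul[OF j]]
    show "continuous_map (prod_topology ?P ?P) (\<tau> j)
        (\<lambda>p. (case p of (x, y) \<Rightarrow> \<lambda>j\<in>J. x j \<otimes>\<^bsub>G j\<^esub> y j) j)"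
      by (simp add: o_def case_prod_unfold j)
  qed auto
  moreover have "continuous_map ?P ?P (\<lambda>x. inv\<^bsub>product_group J G\<^esub> x)"
  proof (rule continuous_map_eq)
    show "continuous_map ?P ?P (\<lambda>x. \<lambda>j\<in>J. inv\<^bsub>G j\<^esub> x j)"
      unfolding continuous_map_componentwise
    proof (intro conjI ballI)
      fix j assume j: "j \<in> J"
      show "continuous_map ?P (\<tau> j) (\<lambda>x. (\<lambda>j\<in>J. inv\<^bsub>G j\<^esub> x j) j)"
        using continuous_map_compose[OF continuous_map_product_projection[OF j, of \<tau>] inv[OF j]] j
        by (simp add: o_def)
    qed auto
    show "(\<lambda>j\<in>J. inv\<^bsub>G j\<^esub> x j) = inv\<^bsub>product_group J G\<^esub> x" if "x \<in> topspace ?P" for x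
      using that gr unfolding tops by simp
  qed
  ultimately show ?thesis
    using gr tops by (simp add: topological_group_def)
qed

lemma free_topological_product_exists:
  fixes I :: "'i set"
  obtains G :: "(('i \<times> real) list monoid \<times> ('i \<times> real) list topology \<times> ('i \<Rightarrow> real \<Rightarrow> ('i \<times> real) list)
      \<Rightarrow> ('i \<times> real) list) monoid" and \<tau> \<iota>
  where "free_topological_product I G \<tau> \<iota>"
proof -
  define J :: "(('i \<times> real) list monoid \<times> ('i \<times> real) list topology \<times> ('i \<Rightarrow> real \<Rightarrow> ('i \<times> real) list)) set"
    where "J = {(\<Gamma>, \<sigma>, \<theta>). topological_group \<Gamma> \<sigma> \<and> (\<forall>i\<in>I. continuous_one_param \<Gamma> \<sigma> (\<theta> i))}"
  define P where "P = product_group J fst"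
  define T where "T = product_topology (\<lambda>j. fst (snd j)) J"
  define \<iota> where "\<iota> i t = (\<lambda>j\<in>J. snd (snd j) i t)" for i t
  define S where "S = generate P (\<Union>i\<in>I. range (\<iota> i))"
  have J1: "topological_group (fst j) (fst (snd j))" if "j \<in> J" for j
    using that by (auto simp: J_def)
  have J2: "continuous_one_param (fst j) (fst (snd j)) (snd (snd j) i)" if "j \<in> J" "i \<in> I" for i j
    using that by (auto simp: J_def)
  have TP: "topological_group P T"
    unfolding P_def T_def using J1 by (rule topological_group_product)
  then interpret P: group P
    by (simp add: topological_group_def)
  have hom\<iota>: "\<iota> i \<in> hom real_group P" if i: "i \<in> I" for i
  proof (rule homI)
    have h: "snd (snd j) i \<in> hom real_group (fst j)" if "j \<in> J" for j
      using J2[OF that i] by (simp add: continuous_one_param_def)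
    show "\<iota> i t \<in> carrier P" for t
      unfolding P_def \<iota>_def carrier_product_group
      by (rule restrict_PiE_iff[THEN iffD2]) (use h[THEN hom_in_carrier] in simp)
    show "\<iota> i (s \<otimes>\<^bsub>real_group\<^esub> t) = \<iota> i s \<otimes>\<^bsub>P\<^esub> \<iota> i t" for s t
      unfolding P_def \<iota>_def mult_product_group
      by (rule restrict_ext) (use h in \<open>simp add: hom_def\<close>)
  qed
  have cont\<iota>: "continuous_map euclideanreal T (\<iota> i)" if i: "i \<in> I" for i
    using J2[OF _ i] unfolding continuous_one_param_def T_def \<iota>_def
    by (auto simp: continuous_map_componentwise)
  have gen: "(\<Union>i\<in>I. range (\<iota> i)) \<subseteq> carrier P"
    using hom\<iota> by (auto simp: hom_def)
  have S: "subgroup S P"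
    unfolding S_def using gen by (rule P.generate_is_subgroup)
  have inS: "\<iota> i t \<in> S" if "i \<in> I" for i t
    unfolding S_def using that by (auto intro: generate.incl)
  have "free_topological_product I (P\<lparr>carrier := S\<rparr>) (subtopology T S) \<iota>"
    unfolding free_topological_product_def
  proof (intro conjI ballI allI impI)
    show "topological_group (P\<lparr>carrier := S\<rparr>) (subtopology T S)"
      using TP S by (rule topological_group_subgroup)
    show "continuous_one_param (P\<lparr>carrier := S\<rparr>) (subtopology T S) (\<iota> i)" if "i \<in> I" for i
      using hom\<iota>[OF that] cont\<iota>[OF that] inS[OF that]
      by (auto simp: continuous_one_param_def hom_def continuous_map_in_subtopology)
    have "generate (P\<lparr>carrier := S\<rparr>) (\<Union>i\<in>I. range (\<iota> i)) = generate P (\<Union>i\<in>I. range (\<iota> i))"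
      by (rule P.generate_consistent) (use inS S in auto)
    then show "carrier (P\<lparr>carrier := S\<rparr>) = generate (P\<lparr>carrier := S\<rparr>) (\<Union>i\<in>I. range (\<iota> i))"
      by (simp add: S_def)
    fix \<Gamma> :: "('i \<times> real) list monoid" and \<sigma> \<theta>
    assume "topological_group \<Gamma> \<sigma>" and "\<forall>i\<in>I. continuous_one_param \<Gamma> \<sigma> (\<theta> i)"
    then have j: "(\<Gamma>, \<sigma>, \<theta>) \<in> J"
      by (simp add: J_def)
    show "\<exists>h \<in> hom (P\<lparr>carrier := S\<rparr>) \<Gamma>. continuous_map (subtopology T S) \<sigma> h \<and> (\<forall>i\<in>I. \<forall>t. h (\<iota> i t) = \<theta> i t)"
    proof (intro bexI conjI)
      show "(\<lambda>x. x (\<Gamma>, \<sigma>, \<theta>)) \<in> hom (P\<lparr>carrier := S\<rparr>) \<Gamma>"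
      proof (rule homI)
        show "x (\<Gamma>, \<sigma>, \<theta>) \<in> carrier \<Gamma>" if "x \<in> carrier (P\<lparr>carrier := S\<rparr>)" for x
        proof -
          have "x \<in> carrier P"
            using that subgroup.subset[OF S] by auto
          then have "x \<in> (\<Pi>\<^sub>E j\<in>J. carrier (fst j))"
            by (simp add: P_def)
          from PiE_mem[OF this j] show ?thesis
            by simp
        qed
        show "(x \<otimes>\<^bsub>P\<lparr>carrier := S\<rparr>\<^esub> y) (\<Gamma>, \<sigma>, \<theta>) = x (\<Gamma>, \<sigma>, \<theta>) \<otimes>\<^bsub>\<Gamma>\<^esub> y (\<Gamma>, \<sigma>, \<theta>)" for x y
          using j by (simp add: P_def)
      qed
      show "continuous_map (subtopology T S) \<sigma> (\<lambda>x. x (\<Gamma>, \<sigma>, \<theta>))"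
        using continuous_map_product_projection[OF j, of "\<lambda>j. fst (snd j)"]
        by (simp add: T_def continuous_map_from_subtopology)
      show "\<forall>i\<in>I. \<forall>t. \<iota> i t (\<Gamma>, \<sigma>, \<theta>) = \<theta> i t"
        using j by (simp add: \<iota>_def)
    qed
  qed
  then show ?thesis
    by (rule that)
qed

lemma free_topological_product_universal:
  fixes \<Gamma> :: "'c monoid" and \<theta> :: "'i \<Rightarrow> real \<Rightarrow> 'c"
  assumes free: "free_topological_product I G \<tau> \<iota>"
    and \<Gamma>: "topological_group \<Gamma> \<sigma>"
    and \<theta>: "\<forall>i\<in>I. continuous_one_param \<Gamma> \<sigma> (\<theta> i)"
  shows "\<exists>h \<in> hom G \<Gamma>. continuous_map \<tau> \<sigma> h \<and> (\<forall>i\<in>I. \<forall>t. h (\<iota> i t) = \<theta> i t)"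
proof -
  interpret \<Gamma>: group \<Gamma>
    using \<Gamma> by (simp add: topological_group_def)
  have top: "topspace \<sigma> = carrier \<Gamma>"
    and mul: "continuous_map (prod_topology \<sigma> \<sigma>) \<sigma> (\<lambda>(x, y). x \<otimes>\<^bsub>\<Gamma>\<^esub> y)"
    and invc: "continuous_map \<sigma> \<sigma> (\<lambda>x. inv\<^bsub>\<Gamma>\<^esub> x)"
    using \<Gamma> by (auto simp: topological_group_def)
  let ?ev = "word_prod \<Gamma> \<theta>"
  define S where "S = generate \<Gamma> (\<Union>i\<in>I. range (\<theta> i))"
  have hom: "\<theta> i \<in> hom real_group \<Gamma>" if "i \<in> I" for i
    using \<theta> that by (simp add: continuous_one_param_def)
  have cl: "\<theta> i t \<in> carrier \<Gamma>" if "i \<in> I" for i t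
    using hom[OF that] by (auto simp: hom_def)
  have S: "subgroup S \<Gamma>"
    unfolding S_def by (rule \<Gamma>.generate_is_subgroup) (use cl in auto)
  note SC = subgroup.mem_carrier[OF S]
  have ev_carrier: "?ev w \<in> carrier \<Gamma>" if "set w \<subseteq> I \<times> UNIV" for w
    using that by (induction w) (auto simp: word_prod_def cl)
  have ev_append: "?ev (v @ w) = ?ev v \<otimes>\<^bsub>\<Gamma>\<^esub> ?ev w" if "set v \<subseteq> I \<times> UNIV" "set w \<subseteq> I \<times> UNIV" for v w
    using that
  proof (induction v)
    case Nil
    then show ?case using ev_carrier[of w] by (simp add: word_prod_def)
  next
    case (Cons p v)
    then show ?case
      using ev_carrier[of v] ev_carrier[of w]
      by (cases p) (simp add: word_prod_def \<Gamma>.m_assoc cl)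
  qed
  have surj: "\<exists>w. set w \<subseteq> I \<times> UNIV \<and> ?ev w = s" if "s \<in> S" for s
    using that unfolding S_def
  proof (induction rule: generate.induct)
    case one
    show ?case by (rule exI[of _ "[]"]) (simp add: word_prod_def)
  next
    case (incl s)
    then obtain i t where "i \<in> I" "s = \<theta> i t" by auto
    then show ?case
      by (intro exI[of _ "[(i, t)]"]) (simp add: word_prod_def cl)
  next
    case (inv s)
    then obtain i t where it: "i \<in> I" "s = \<theta> i t" by auto
    interpret gh: group_hom real_group \<Gamma> "\<theta> i"
      using hom[OF it(1)] by (simp add: group_hom_def group_hom_axioms_def)
    have "\<theta> i (- t) = inv\<^bsub>\<Gamma>\<^esub> s"
      using gh.hom_inv[of t] it by simp
    then show ?case
      using it cl[of i "- t"]
      by (intro exI[of _ "[(i, - t)]"]) (simp add: word_prod_def)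
  next
    case (eng s t)
    then show ?case
      using ev_append by (metis le_sup_iff set_append)
  qed
  define c where "c s = (SOME w. set w \<subseteq> I \<times> UNIV \<and> ?ev w = s)" for s
  have ev_c [simp]: "?ev (c s) = s" if "s \<in> S" for s
    using someI_ex[OF surj[OF that]] by (simp add: c_def)
  define \<Gamma>' where "\<Gamma>' = \<lparr>carrier = c ` S, monoid.mult = (\<lambda>v w. c (?ev v \<otimes>\<^bsub>\<Gamma>\<^esub> ?ev w)), one = c \<one>\<^bsub>\<Gamma>\<^esub>\<rparr>"
  define \<sigma>' where "\<sigma>' = pullback_topology (c ` S) ?ev \<sigma>"
  have [simp]: "carrier \<Gamma>' = c ` S" "\<one>\<^bsub>\<Gamma>'\<^esub> = c \<one>\<^bsub>\<Gamma>\<^esub>"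
    and mult': "v \<otimes>\<^bsub>\<Gamma>'\<^esub> w = c (?ev v \<otimes>\<^bsub>\<Gamma>\<^esub> ?ev w)" for v w
    by (simp_all add: \<Gamma>'_def)
  have Scl: "x \<otimes>\<^bsub>\<Gamma>\<^esub> y \<in> S" "\<one>\<^bsub>\<Gamma>\<^esub> \<in> S" "inv\<^bsub>\<Gamma>\<^esub> x \<in> S" if "x \<in> S" "y \<in> S" for x y
    using S that by (auto simp: subgroup.m_closed subgroup.one_closed subgroup.m_inv_closed)
  have oneS: "\<one>\<^bsub>\<Gamma>\<^esub> \<in> S"
    using S by (rule subgroup.one_closed)
  have gr': "group \<Gamma>'"
  proof (rule groupI)
    fix x assume "x \<in> carrier \<Gamma>'"
    then obtain s where s: "s \<in> S" "x = c s" by auto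
    show "\<exists>y\<in>carrier \<Gamma>'. y \<otimes>\<^bsub>\<Gamma>'\<^esub> x = \<one>\<^bsub>\<Gamma>'\<^esub>"
      by (rule bexI[of _ "c (inv\<^bsub>\<Gamma>\<^esub> s)"]) (use s Scl SC in \<open>simp_all add: mult'\<close>)
  qed (use Scl oneS SC in \<open>auto simp: mult' \<Gamma>.m_assoc\<close>)
  then interpret \<Gamma>': group \<Gamma>' .
  have evhom: "?ev \<in> hom \<Gamma>' \<Gamma>"
    using Scl SC by (auto simp: hom_def mult')
  then interpret gh: group_hom \<Gamma>' \<Gamma> ?ev
    by unfold_locales
  have top': "topspace \<sigma>' = c ` S"
    using SC by (auto simp: \<sigma>'_def topspace_pullback_topology top)
  have evc: "continuous_map \<sigma>' \<sigma> ?ev"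
    using continuous_map_pullback[OF continuous_map_id, of "c ` S" ?ev \<sigma>]
    by (simp add: \<sigma>'_def o_def)
  have ev_hom_id: "c (?ev v) = v" if "v \<in> c ` S" for v
    using that by auto
  have into': "continuous_map X \<sigma>' f" if "continuous_map X \<sigma> (\<lambda>x. ?ev (f x))"
      "\<And>x. x \<in> topspace X \<Longrightarrow> f x \<in> c ` S" for f and X :: "'z topology"
    unfolding \<sigma>'_def by (rule continuous_map_pullback') (use that in \<open>auto simp: o_def\<close>)
  have tg': "topological_group \<Gamma>' \<sigma>'"
    unfolding topological_group_def
  proof (intro conjI)
    show "continuous_map (prod_topology \<sigma>' \<sigma>') \<sigma>' (\<lambda>(x, y). x \<otimes>\<^bsub>\<Gamma>'\<^esub> y)"
    proof (rule into')
      have "continuous_map (prod_topology \<sigma>' \<sigma>') (prod_topology \<sigma> \<sigma>) (\<lambda>p. (?ev (fst p), ?ev (snd p)))"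
        using continuous_map_compose[OF continuous_map_fst evc, of \<sigma>']
          continuous_map_compose[OF continuous_map_snd evc, of \<sigma>']
        by (simp add: continuous_map_pairwise o_def)
      from continuous_map_compose[OF this mul]
      have *: "continuous_map (prod_topology \<sigma>' \<sigma>') \<sigma> (\<lambda>p. ?ev (fst p) \<otimes>\<^bsub>\<Gamma>\<^esub> ?ev (snd p))"
        by (simp add: o_def)
      show "continuous_map (prod_topology \<sigma>' \<sigma>') \<sigma> (\<lambda>p. ?ev (case p of (x, y) \<Rightarrow> x \<otimes>\<^bsub>\<Gamma>'\<^esub> y))"
        by (rule continuous_map_eq[OF *]) (use Scl in \<open>auto simp: top' mult'\<close>)
    qed (use Scl in \<open>auto simp: top' mult'\<close>)
    show "continuous_map \<sigma>' \<sigma>' (\<lambda>x. inv\<^bsub>\<Gamma>'\<^esub> x)"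
    proof (rule into')
      have *: "continuous_map \<sigma>' \<sigma> (\<lambda>x. inv\<^bsub>\<Gamma>\<^esub> ?ev x)"
        using continuous_map_compose[OF evc invc] by (simp add: o_def)
      show "continuous_map \<sigma>' \<sigma> (\<lambda>x. ?ev (inv\<^bsub>\<Gamma>'\<^esub> x))"
        by (rule continuous_map_eq[OF *]) (use gh.hom_inv in \<open>auto simp: top'\<close>)
    qed (use \<Gamma>'.inv_closed in \<open>auto simp: top'\<close>)
  qed (use gr' top' in auto)
  have \<theta>S: "\<theta> i t \<in> S" if "i \<in> I" for i t
    unfolding S_def using that by (auto intro: generate.incl)
  have "continuous_one_param \<Gamma>' \<sigma>' (\<lambda>t. c (\<theta> i t))" if i: "i \<in> I" for i
    unfolding continuous_one_param_def
  proof
    show "(\<lambda>t. c (\<theta> i t)) \<in> hom real_group \<Gamma>'"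
      using hom[OF i] \<theta>S[OF i] by (auto simp: hom_def mult')
    have "continuous_map euclideanreal \<sigma> (\<theta> i)"
      using \<theta> i by (auto simp: continuous_one_param_def)
    then show "continuous_map euclideanreal \<sigma>' (\<lambda>t. c (\<theta> i t))"
      by (intro into') (use \<theta>S[OF i] in auto)
  qed
  then have one': "\<forall>i\<in>I. continuous_one_param \<Gamma>' \<sigma>' (\<lambda>t. c (\<theta> i t))"
    by blast
  have "\<exists>h \<in> hom G \<Gamma>'. continuous_map \<tau> \<sigma>' h \<and> (\<forall>i\<in>I. \<forall>t. h (\<iota> i t) = c (\<theta> i t))"
    using free[unfolded free_topological_product_def, THEN conjunct2, THEN conjunct2, THEN conjunct2,
      rule_format, OF tg', of "\<lambda>i t. c (\<theta> i t)"] one' by blast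
  then obtain h where h: "h \<in> hom G \<Gamma>'" "continuous_map \<tau> \<sigma>' h" "\<forall>i\<in>I. \<forall>t. h (\<iota> i t) = c (\<theta> i t)"
    by blast
  show ?thesis
  proof (intro bexI conjI)
    show "?ev \<circ> h \<in> hom G \<Gamma>"
      using h(1) evhom by (rule hom_compose)
    show "continuous_map \<tau> \<sigma> (?ev \<circ> h)"
      using h(2) evc by (rule continuous_map_compose)
    show "\<forall>i\<in>I. \<forall>t. (?ev \<circ> h) (\<iota> i t) = \<theta> i t"
      using h(3) \<theta>S by simp
  qed
qed


section \<open>Semigroups over a topological monoid\<close>

text \<open>Semigroups over \<open>M\<close> are functions on \<open>carrier M\<close>; \<open>extensional\<close> normalises their irrelevant
  values elsewhere.\<close>

definition contractive_semigroups ::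
  "'g monoid \<Rightarrow> 'g topology \<Rightarrow> ('g \<Rightarrow> ('h::complex_hilbert_space \<Rightarrow>\<^sub>L 'h)) set" where
  "contractive_semigroups M \<sigma> = {T \<in> extensional (carrier M).
     (\<forall>x\<in>carrier M. contraction (T x)) \<and>
     T \<one>\<^bsub>M\<^esub> = id_blinfun \<and>
     (\<forall>x\<in>carrier M. \<forall>y\<in>carrier M. T (x \<otimes>\<^bsub>M\<^esub> y) = T x o\<^sub>L T y) \<and>
     continuous_map \<sigma> strong_operator_topology T}"

definition unitary_semigroups ::
  "'g monoid \<Rightarrow> 'g topology \<Rightarrow> ('g \<Rightarrow> ('h::complex_hilbert_space \<Rightarrow>\<^sub>L 'h)) set" where
  "unitary_semigroups M \<sigma> = {T \<in> contractive_semigroups M \<sigma>. \<forall>x\<in>carrier M. unitary (T x)}"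

definition weak_dist ::
  "'g set \<Rightarrow> 'h::complex_hilbert_space \<Rightarrow> 'h \<Rightarrow> ('g \<Rightarrow> 'h \<Rightarrow>\<^sub>L 'h) \<Rightarrow> ('g \<Rightarrow> 'h \<Rightarrow>\<^sub>L 'h) \<Rightarrow> real" where
  "weak_dist K \<xi> \<eta> S T = (SUP x\<in>K. cmod (cinner (blinfun_apply (S x - T x) \<xi>) \<eta>))"

text \<open>The topology generated by the balls of the pseudometrics \<open>weak_dist K \<xi> \<eta>\<close>; its convergence is
  described by \<open>limitin_k_WOT\<close>. The empty set is excluded as \<open>SUP\<close> over it is unspecified on the
  reals.\<close>

definition k_WOT ::
  "'g monoid \<Rightarrow> 'g topology \<Rightarrow> ('g \<Rightarrow> ('h::complex_hilbert_space \<Rightarrow>\<^sub>L 'h)) topology" where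
  "k_WOT M \<sigma> = topology_generated_by
     {{S \<in> contractive_semigroups M \<sigma>. weak_dist K \<xi> \<eta> S T < \<epsilon>} | T K \<xi> \<eta> \<epsilon>.
        T \<in> contractive_semigroups M \<sigma> \<and> compactin \<sigma> K \<and> K \<noteq> {} \<and> 0 < \<epsilon>}"

lemma weak_dist_bdd:
  assumes "S \<in> contractive_semigroups M \<sigma>" "T \<in> contractive_semigroups M \<sigma>" "K \<subseteq> carrier M"
  shows "bdd_above ((\<lambda>x. cmod (cinner (blinfun_apply (S x - T x) \<xi>) \<eta>)) ` K)"
proof (rule bdd_aboveI2)
  fix x assume "x \<in> K"
  then have "norm (S x) \<le> 1" "norm (T x) \<le> 1"
    using assms by (auto simp: contractive_semigroups_def contraction_def)
  then have "norm (S x - T x) \<le> 2"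
    using norm_triangle_ineq4[of "S x" "T x"] by linarith
  then have "norm (blinfun_apply (S x - T x) \<xi>) \<le> 2 * norm \<xi>"
    by (meson mult_right_mono norm_blinfun norm_ge_zero order_trans)
  then show "cmod (cinner (blinfun_apply (S x - T x) \<xi>) \<eta>) \<le> 2 * norm \<xi> * norm \<eta>"
    by (meson mult_right_mono norm_cinner_le norm_ge_zero order_trans)
qed

lemma weak_dist_triangle:
  assumes "R \<in> contractive_semigroups M \<sigma>" "S \<in> contractive_semigroups M \<sigma>"
    "T \<in> contractive_semigroups M \<sigma>" "K \<subseteq> carrier M" "K \<noteq> {}"
  shows "weak_dist K \<xi> \<eta> R T \<le> weak_dist K \<xi> \<eta> R S + weak_dist K \<xi> \<eta> S T"
  unfolding weak_dist_def
proof (rule cSUP_least[OF assms(5)])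
  fix x assume x: "x \<in> K"
  have "cinner (blinfun_apply (R x - T x) \<xi>) \<eta>
      = cinner (blinfun_apply (R x - S x) \<xi>) \<eta> + cinner (blinfun_apply (S x - T x) \<xi>) \<eta>"
    by (simp add: blinfun.diff_left flip: cinner_add_left)
  then have "cmod (cinner (blinfun_apply (R x - T x) \<xi>) \<eta>)
      \<le> cmod (cinner (blinfun_apply (R x - S x) \<xi>) \<eta>) + cmod (cinner (blinfun_apply (S x - T x) \<xi>) \<eta>)"
    by (metis norm_triangle_ineq)
  also have "\<dots> \<le> (SUP x\<in>K. cmod (cinner (blinfun_apply (R x - S x) \<xi>) \<eta>))
      + (SUP x\<in>K. cmod (cinner (blinfun_apply (S x - T x) \<xi>) \<eta>))"
    using x assms by (intro add_mono cSUP_upper weak_dist_bdd)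
  finally show "cmod (cinner (blinfun_apply (R x - T x) \<xi>) \<eta>) \<le> \<dots>" .
qed

lemma weak_dist_refl: "K \<noteq> {} \<Longrightarrow> weak_dist K \<xi> \<eta> T T = 0"
  by (simp add: weak_dist_def)

lemma topspace_k_WOT:
  assumes "topspace \<sigma> \<noteq> {}"
  shows "topspace (k_WOT M \<sigma>) = contractive_semigroups M \<sigma>"
proof -
  obtain x where "x \<in> topspace \<sigma>"
    using assms by blast
  then have x: "compactin \<sigma> {x}"
    by simp
  show ?thesis
    unfolding k_WOT_def topology_generated_by_topspace
  proof (rule equalityI; rule subsetI)
    fix T :: "'a \<Rightarrow> 'b \<Rightarrow>\<^sub>L 'b" assume "T \<in> contractive_semigroups M \<sigma>"
    moreover from this have "T \<in> {S \<in> contractive_semigroups M \<sigma>. weak_dist {x} 0 0 S T < 1}"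
      by (simp add: weak_dist_refl)
    ultimately show "T \<in> \<Union> {{S \<in> contractive_semigroups M \<sigma>. weak_dist K \<xi> \<eta> S T < \<epsilon>} | T K \<xi> \<eta> \<epsilon>.
        T \<in> contractive_semigroups M \<sigma> \<and> compactin \<sigma> K \<and> K \<noteq> {} \<and> 0 < \<epsilon>}"
      using x by - (rule UnionI[rotated], assumption, intro CollectI exI conjI, auto)
  qed auto
qed

lemma limitin_k_WOT:
  assumes top: "topspace \<sigma> = carrier M" "carrier M \<noteq> {}"
    and T: "T \<in> contractive_semigroups M \<sigma>" and TT: "\<And>\<alpha>. \<T> \<alpha> \<in> contractive_semigroups M \<sigma>"
  shows "limitin (k_WOT M \<sigma>) \<T> T F \<longleftrightarrow>
    (\<forall>K \<xi> \<eta>. compactin \<sigma> K \<longrightarrow> K \<noteq> {} \<longrightarrow> ((\<lambda>\<alpha>. weak_dist K \<xi> \<eta> (\<T> \<alpha>) T) \<longlongrightarrow> 0) F)"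
    (is "?lhs \<longleftrightarrow> ?rhs")
proof -
  have sub: "K \<subseteq> carrier M" if "compactin \<sigma> K" for K
    using compactin_subset_topspace[OF that] top by simp
  have nonneg: "0 \<le> weak_dist K \<xi> \<eta> (\<T> \<alpha>) T" if K: "compactin \<sigma> K" "K \<noteq> {}" for K \<xi> \<eta> \<alpha>
  proof -
    obtain x where x: "x \<in> K" using K by auto
    show ?thesis
      unfolding weak_dist_def
      by (rule cSUP_upper2[OF weak_dist_bdd[OF TT T sub[OF K(1)]] x]) simp
  qed
  show ?thesis
  proof
    assume lim: ?lhs
    show ?rhs
    proof (intro allI impI)
      fix K :: "'a set" and \<xi> \<eta> :: 'b
      assume K: "compactin \<sigma> K" "K \<noteq> {}"
      show "((\<lambda>\<alpha>. weak_dist K \<xi> \<eta> (\<T> \<alpha>) T) \<longlongrightarrow> 0) F"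
      proof (rule tendstoI)
        fix \<epsilon> :: real assume \<epsilon>: "\<epsilon> > 0"
        let ?U = "{S \<in> contractive_semigroups M \<sigma>. weak_dist K \<xi> \<eta> S T < \<epsilon>}"
        have "openin (k_WOT M \<sigma>) ?U"
          unfolding k_WOT_def by (rule topology_generated_by_Basis) (use T K \<epsilon> in blast)
        moreover have "T \<in> ?U"
          using T K \<epsilon> by (simp add: weak_dist_refl)
        ultimately have "\<forall>\<^sub>F \<alpha> in F. \<T> \<alpha> \<in> ?U"
          using lim unfolding limitin_def by blast
        then show "\<forall>\<^sub>F \<alpha> in F. dist (weak_dist K \<xi> \<eta> (\<T> \<alpha>) T) 0 < \<epsilon>"
          by (rule eventually_mono) (use nonneg[OF K] in \<open>auto simp: dist_real_def\<close>)
      qed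
    qed
  next
    assume R: ?rhs
    have *: "\<forall>\<^sub>F \<alpha> in F. \<T> \<alpha> \<in> U"
      if "generate_topology_on {{S \<in> contractive_semigroups M \<sigma>. weak_dist K \<xi> \<eta> S T < \<epsilon>} | T K \<xi> \<eta> \<epsilon>.
        T \<in> contractive_semigroups M \<sigma> \<and> compactin \<sigma> K \<and> K \<noteq> {} \<and> 0 < \<epsilon>} U" "T \<in> U" for U
      using that
    proof (induction rule: generate_topology_on.induct)
      case (Int A B)
      then show ?case by (simp add: eventually_conj)
    next
      case (UN \<A>)
      then obtain A where "A \<in> \<A>" "T \<in> A" by auto
      then have "\<forall>\<^sub>F \<alpha> in F. \<T> \<alpha> \<in> A" using UN by auto
      then show ?case by (rule eventually_mono) (use \<open>A \<in> \<A>\<close> in auto)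
    next
      case (Basis U)
      then obtain T' K \<xi> \<eta> \<epsilon> where U: "U = {S \<in> contractive_semigroups M \<sigma>. weak_dist K \<xi> \<eta> S T' < \<epsilon>}"
        and T': "T' \<in> contractive_semigroups M \<sigma>" and K: "compactin \<sigma> K" "K \<noteq> {}"
        by blast
      have "weak_dist K \<xi> \<eta> T T' < \<epsilon>"
        using Basis U by simp
      then have "\<forall>\<^sub>F \<alpha> in F. weak_dist K \<xi> \<eta> (\<T> \<alpha>) T < \<epsilon> - weak_dist K \<xi> \<eta> T T'"
        by (intro order_tendstoD(2)[of _ 0]) (use R K in auto)
      then show ?case
      proof (rule eventually_mono)
        fix \<alpha> assume "weak_dist K \<xi> \<eta> (\<T> \<alpha>) T < \<epsilon> - weak_dist K \<xi> \<eta> T T'"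
        with weak_dist_triangle[OF TT T T' sub[OF K(1)] K(2), of \<xi> \<eta> \<alpha>]
        show "\<T> \<alpha> \<in> U"
          using TT by (simp add: U)
      qed
    qed simp
    show ?lhs
      unfolding limitin_def
    proof (intro conjI allI impI)
      show "T \<in> topspace (k_WOT M \<sigma>)"
        using T by (subst topspace_k_WOT) (use top in auto)
      show "\<forall>\<^sub>F \<alpha> in F. \<T> \<alpha> \<in> U" if "openin (k_WOT M \<sigma>) U \<and> T \<in> U" for U
        by (rule *) (use that in \<open>simp_all add: k_WOT_def openin_topology_generated_by_iff\<close>)
    qed
  qed
qed

end

theory Submission
  imports Defs "HOL-Library.Poly_Mapping" "HOL-Combinatorics.Transposition"
begin

text \<open>
  Density. Restricting a contractive semigroup \<open>T\<close> over the monoid to the \<open>i\<close>-th copy of \<open>[0, \<infinity>)\<close>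
  gives a one-parameter contraction semigroup \<open>S\<^sub>i\<close>, and \<open>S\<^sub>i\<close> has a unitary dilation: the function
  that is \<open>S\<^sub>i(t)\<close> for \<open>t \<ge> 0\<close> and \<open>S\<^sub>i(-t)\<^sup>*\<close> for \<open>t < 0\<close> is positive definite on \<open>\<real>\<close>, and
  translation acts unitarily on the Hilbert space that it generates (\<open>unitary_dilation\<close>). The
  dilation spaces can be glued along the common copy \<open>C H\<close> of \<open>H\<close>, with their remaining parts mutually
  orthogonal; then words in the dilations with nonnegative times compress to the corresponding
  words in the \<open>S\<^sub>i\<close> (\<open>joint_dilation\<close>). The universal property of the free product, applied to the
  unitary group with the strong operator topology, turns the glued unitary groups into one
  continuous unitary representation \<open>h\<close> of \<open>G\<close>, and \<open>T(x) = C\<^sup>* h(x) C\<close> for all \<open>x\<close> in the monoid.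

  All of this happens inside the given space: \<open>H\<close> has an orthonormal basis indexed by \<open>\<nat>\<close>, the
  isometry \<open>C\<close> maps basis vectors to basis vectors, and hence \<open>C\<close> is a strong limit of unitaries
  \<open>W\<^sub>N\<close> that permute the basis. The semigroups \<open>x \<mapsto> W\<^sub>N\<^sup>* h(x) W\<^sub>N\<close> are unitary. Their matrix
  coefficients converge to those of \<open>T\<close> uniformly on the whole monoid, hence on its compact subsets:
  the operators \<open>h(x)\<close> are contractions, so the error is controlled by \<open>W\<^sub>N \<xi> - C \<xi>\<close> and
  \<open>W\<^sub>N \<eta> - C \<eta>\<close> alone (\<open>approximation_by_unitary_semigroups\<close>).

  The \<open>G\<^sub>\<delta>\<close> property. If \<open>T(\<iota>\<^sub>i(n)) = T(\<iota>\<^sub>i(t)) T(\<iota>\<^sub>i(n - t))\<close> is unitary, then both factors, which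
  are commuting contractions, are unitary; so \<open>T\<close> is unitary as soon as the countably many operators
  \<open>T(\<iota>\<^sub>i(1))\<close> are. A contraction is unitary iff it and its adjoint do not shrink the vectors of a
  countable dense set, and \<open>\<parallel>A \<xi>\<parallel> > r\<close> says that some matrix coefficient \<open>\<bar>\<langle>A \<xi>, \<eta>\<rangle>\<bar>\<close> with
  \<open>\<parallel>\<eta>\<parallel> \<le> 1\<close> exceeds \<open>r\<close>, which is an open condition (\<open>gdelta_unitary_semigroups\<close>).
\<close>

section \<open>Semi-inner products and Gram-Schmidt\<close>

text \<open>Null vectors are allowed, so that Gram-Schmidt applies both to the Hilbert space itself and
  directly to the space of formal combinations on which the dilation is built.\<close>

locale semi_inner_product = vector_space scale
  for scale :: "complex \<Rightarrow> 'v::ab_group_add \<Rightarrow> 'v" (infixr \<open>\<cdot>\<close> 75) +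
  fixes B :: "'v \<Rightarrow> 'v \<Rightarrow> complex"
  assumes add_left: "B (x + y) z = B x z + B y z"
    and scale_left: "B (c \<cdot> x) y = c * B x y"
    and commute: "B x y = cnj (B y x)"
    and nonneg: "0 \<le> Re (B x x)"
begin

lemma add_right: "B x (y + z) = B x y + B x z"
  by (metis add_left commute complex_cnj_add)

lemma scale_right: "B x (c \<cdot> y) = cnj c * B x y"
  by (metis scale_left commute complex_cnj_mult)

lemma zero_left [simp]: "B 0 x = 0"
  using add_left[of 0 0 x] by simp

lemma zero_right [simp]: "B x 0 = 0"
  using add_right[of x 0 0] by simp

lemma diff_left: "B (x - y) z = B x z - B y z"
  by (metis add_left diff_add_cancel eq_diff_eq)

lemma diff_right: "B x (y - z) = B x y - B x z"
  by (metis add_right diff_add_cancel eq_diff_eq)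

lemma sum_left: "B (\<Sum>k\<in>F. f k) z = (\<Sum>k\<in>F. B (f k) z)"
  by (induction F rule: infinite_finite_induct) (auto simp: add_left)

lemma sum_right: "B z (\<Sum>k\<in>F. f k) = (\<Sum>k\<in>F. B z (f k))"
  by (induction F rule: infinite_finite_induct) (auto simp: add_right)

definition sqnorm :: "'v \<Rightarrow> real" where "sqnorm x = Re (B x x)"

lemma self: "B x x = complex_of_real (sqnorm x)"
proof -
  have "Im (B x x) = 0"
    using arg_cong[OF commute[of x x], of Im] by simp
  then show ?thesis by (simp add: sqnorm_def complex_eq_iff)
qed

lemma sqnorm_nonneg [simp]: "0 \<le> sqnorm x"
  by (simp add: sqnorm_def nonneg)

lemma sqnorm_scale: "sqnorm (c \<cdot> x) = (cmod c)\<^sup>2 * sqnorm x"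
proof -
  have "complex_of_real (sqnorm (c \<cdot> x)) = complex_of_real ((cmod c)\<^sup>2 * sqnorm x)"
    unfolding self[symmetric] scale_left scale_right
    by (simp add: self complex_norm_square mult.commute del: of_real_power)
  then show ?thesis using of_real_eq_iff by blast
qed

lemma sqnorm_add: "sqnorm (x + y) = sqnorm x + sqnorm y + 2 * Re (B x y)"
  using arg_cong[OF commute[of y x], of Re] by (simp add: sqnorm_def add_left add_right)

lemma sqnorm_diff: "sqnorm (x - y) = sqnorm x + sqnorm y - 2 * Re (B x y)"
  using arg_cong[OF commute[of y x], of Re] by (simp add: sqnorm_def diff_left diff_right)

lemma sqnorm_add_le: "sqnorm (x + y) \<le> 2 * sqnorm x + 2 * sqnorm y"
  using sqnorm_add[of x y] sqnorm_diff[of x y] sqnorm_nonneg[of "x - y"] by linarith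

text \<open>Polarisation: both forms are determined by their diagonals.\<close>

lemma linear_isometry_preserves:
  fixes f :: "'v \<Rightarrow> 'h::complex_hilbert_space"
  assumes add: "\<And>x y. f (x + y) = f x + f y" and scale: "\<And>c x. f (c \<cdot> x) = c *\<^sub>C f x"
    and iso: "\<And>x. (norm (f x))\<^sup>2 = sqnorm x"
  shows "cinner (f x) (f y) = B x y"
proof -
  have *: "Re (cinner (f x) (f y)) = Re (B x y)" for x y
  proof -
    have "complex_of_real (sqnorm (x + y)) = cinner (f (x + y)) (f (x + y))"
      by (simp add: cinner_self iso del: of_real_power)
    also have "\<dots> = cinner (f x) (f x) + cinner (f y) (f y) + (cinner (f x) (f y) + cinner (f y) (f x))"
      by (simp only: add cinner_add_left cinner_add_right) (simp add: algebra_simps)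
    also have "\<dots> = complex_of_real (sqnorm x) + complex_of_real (sqnorm y) + (cinner (f x) (f y) + cnj (cinner (f x) (f y)))"
      by (simp only: cinner_self iso cinner_commute[of "f y" "f x"])
    also have "\<dots> = complex_of_real (sqnorm x + sqnorm y + 2 * Re (cinner (f x) (f y)))"
      by (simp add: complex_add_cnj)
    finally show ?thesis
      using sqnorm_add[of x y] of_real_eq_iff by auto
  qed
  have "Re (cinner (f x) (f (\<i> \<cdot> y))) = Re (B x (\<i> \<cdot> y))"
    by (rule *)
  then have "Im (cinner (f x) (f y)) = Im (B x y)"
    by (simp add: scale cinner_scaleC_right scale_right)
  with * show ?thesis by (simp add: complex_eq_iff)
qed

text \<open>Gram-Schmidt produces the vector \<open>0\<close> wherever the input is dependent, modulo null vectors, on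
  its predecessors. Such a zero contributes nothing to an expansion, so it is kept in the sequence.\<close>

definition orthonormal_or_zero :: "(nat \<Rightarrow> 'v) \<Rightarrow> bool" where
  "orthonormal_or_zero g \<longleftrightarrow> (\<forall>m n. B (g m) (g n) = (if m = n \<and> g n \<noteq> 0 then 1 else 0))"

definition residual :: "(nat \<Rightarrow> 'v) \<Rightarrow> nat \<Rightarrow> 'v \<Rightarrow> 'v" where
  "residual g n x = x - (\<Sum>k<n. B x (g k) \<cdot> g k)"

text \<open>Division by \<open>0\<close> yields \<open>0\<close>, so null vectors are normalised to the vector \<open>0\<close> itself.\<close>

definition normalise :: "'v \<Rightarrow> 'v" where
  "normalise x = complex_of_real (1 / sqrt (sqnorm x)) \<cdot> x"

fun gram_schmidt :: "(nat \<Rightarrow> 'v) \<Rightarrow> nat \<Rightarrow> 'v" where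
  "gram_schmidt x n =
     normalise (x n - (\<Sum>k<n. B (x n) (gram_schmidt x k) \<cdot> gram_schmidt x k))"

declare gram_schmidt.simps [simp del]

lemma gram_schmidt_eq: "gram_schmidt x n = normalise (residual (gram_schmidt x) n (x n))"
  by (subst gram_schmidt.simps) (simp add: residual_def)

lemma residual_add: "residual g n (x + y) = residual g n x + residual g n y"
  by (simp add: residual_def add_left scale_left_distrib sum.distrib)

lemma residual_orthogonal:
  assumes "\<And>i j. i < n \<Longrightarrow> j < n \<Longrightarrow> B (g i) (g j) = (if i = j \<and> g j \<noteq> 0 then 1 else 0)" "m < n"
  shows "B (residual g n x) (g m) = 0"
proof -
  have "B (residual g n x) (g m) = B x (g m) - (\<Sum>k<n. B x (g k) * (if k = m \<and> g m \<noteq> 0 then 1 else 0))"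
    using assms by (simp add: residual_def diff_left sum_left scale_left)
  also have "(\<Sum>k<n. B x (g k) * (if k = m \<and> g m \<noteq> 0 then 1 else 0))
      = (\<Sum>k<n. if k = m then B x (g m) else 0)"
    by (rule sum.cong) auto
  finally show ?thesis using assms(2) by simp
qed

lemma normalise_sqnorm: "normalise r \<noteq> 0 \<Longrightarrow> B (normalise r) (normalise r) = 1"
proof -
  assume "normalise r \<noteq> 0"
  then have "sqnorm r \<noteq> 0" by (auto simp: normalise_def)
  then have "sqnorm (normalise r) = 1"
    using sqnorm_nonneg[of r]
    by (simp add: normalise_def sqnorm_scale norm_divide power_divide real_sqrt_pow2)
  then show ?thesis by (simp add: self)
qed

lemma orthonormal_gram_schmidt: "orthonormal_or_zero (gram_schmidt x)"
proof -
  let ?g = "gram_schmidt x"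
  have *: "\<forall>i<n. \<forall>j<n. B (?g i) (?g j) = (if i = j \<and> ?g j \<noteq> 0 then 1 else 0)" for n
  proof (induction n)
    case (Suc n)
    let ?r = "residual ?g n (x n)"
    have *: "B (?g n) (?g j) = 0" if "j < n" for j
    proof -
      have "B ?r (?g j) = 0"
        by (rule residual_orthogonal[OF _ that]) (use Suc in blast)
      then show ?thesis
        by (subst gram_schmidt_eq) (simp add: normalise_def scale_left)
    qed
    then have **: "B (?g j) (?g n) = 0" if "j < n" for j
      using that commute[of "?g j" "?g n"] by simp
    have ***: "?g n \<noteq> 0 \<Longrightarrow> B (?g n) (?g n) = 1"
      using normalise_sqnorm[of ?r] by (simp only: gram_schmidt_eq[of x n] simp_thms)
    show ?case
    proof (intro allI impI)
      fix i j assume "i < Suc n" "j < Suc n"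
      then consider "i < n" "j < n" | "i < n" "j = n" | "i = n" "j < n" | "i = n" "j = n"
        by (auto simp: less_Suc_eq)
      then show "B (?g i) (?g j) = (if i = j \<and> ?g j \<noteq> 0 then 1 else 0)"
        by cases (use Suc * ** *** in auto)
    qed
  qed simp
  have "B (?g m) (?g n) = (if m = n \<and> ?g n \<noteq> 0 then 1 else 0)" for m n
    using *[rule_format, of m "Suc (max m n)" n] by (simp add: less_Suc_eq_le)
  then show ?thesis
    by (simp add: orthonormal_or_zero_def)
qed

context
  fixes g assumes g: "orthonormal_or_zero g"
begin

lemma sqnorm_residual: "sqnorm (residual g n x) = sqnorm x - (\<Sum>k<n. (cmod (B x (g k)))\<^sup>2)"
proof -
  have o: "B (residual g n x) (g m) = 0" if "m < n" for m
    using that g by (intro residual_orthogonal) (auto simp: orthonormal_or_zero_def)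
  have "B (residual g n x) (\<Sum>k<n. B x (g k) \<cdot> g k) = 0"
    unfolding sum_right scale_right by (rule sum.neutral) (use o in auto)
  then have "B (residual g n x) (x - (\<Sum>k<n. B x (g k) \<cdot> g k)) = B (residual g n x) x"
    by (simp add: diff_right)
  then have "B (residual g n x) (residual g n x) = B (residual g n x) x"
    by (simp flip: residual_def)
  also have "\<dots> = B x x - (\<Sum>k<n. B x (g k) * B (g k) x)"
    by (simp add: residual_def diff_left sum_left scale_left)
  also have "(\<Sum>k<n. B x (g k) * B (g k) x) = complex_of_real (\<Sum>k<n. (cmod (B x (g k)))\<^sup>2)"
    by (simp add: commute[of "g _" x] complex_norm_square del: of_real_power)
  finally have "complex_of_real (sqnorm (residual g n x)) = complex_of_real (sqnorm x - (\<Sum>k<n. (cmod (B x (g k)))\<^sup>2))"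
    by (simp add: self)
  then show ?thesis using of_real_eq_iff by blast
qed

lemma sqnorm_residual_le: "sqnorm (residual g n x) \<le> sqnorm x"
  by (simp add: sqnorm_residual sum_nonneg)

end

text \<open>The closed span of \<open>g\<close> with respect to the seminorm, for orthonormal \<open>g\<close>.\<close>

definition spanned :: "(nat \<Rightarrow> 'v) \<Rightarrow> 'v set" where
  "spanned g = {x. (\<lambda>n. sqnorm (residual g n x)) \<longlonglongrightarrow> 0}"

lemma spanned_add:
  assumes "x \<in> spanned g" "y \<in> spanned g" shows "x + y \<in> spanned g"
proof -
  have lim: "(\<lambda>n. 2 * sqnorm (residual g n x) + 2 * sqnorm (residual g n y)) \<longlonglongrightarrow> 2 * 0 + 2 * 0"
    using assms by (intro tendsto_add tendsto_mult_left) (auto simp: spanned_def)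
  have "(\<lambda>n. sqnorm (residual g n (x + y))) \<longlonglongrightarrow> 0"
    by (rule tendsto_sandwich[OF _ _ tendsto_const lim[simplified]]) (auto simp: residual_add sqnorm_add_le)
  then show ?thesis by (simp add: spanned_def)
qed

lemma spanned_zero: "0 \<in> spanned g"
  by (simp add: spanned_def residual_def sqnorm_def)

text \<open>The residual map is a contraction for the seminorm, so small errors stay small.\<close>

lemma spanned_closed:
  assumes g: "orthonormal_or_zero g" and ap: "\<And>\<epsilon>. \<epsilon> > 0 \<Longrightarrow> \<exists>y\<in>spanned g. sqnorm (x - y) < \<epsilon>"
  shows "x \<in> spanned g"
  unfolding spanned_def
proof (intro CollectI LIMSEQ_I)
  fix r :: real assume r: "r > 0"
  then obtain y where y: "y \<in> spanned g" "sqnorm (x - y) < r / 4"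
    using ap[of "r / 4"] by auto
  then obtain N where N: "\<And>n. n \<ge> N \<Longrightarrow> sqnorm (residual g n y) < r / 4"
    using LIMSEQ_D[of "\<lambda>n. sqnorm (residual g n y)" 0 "r / 4"] r by (auto simp: spanned_def)
  have "sqnorm (residual g n x) < r" if "n \<ge> N" for n
  proof -
    have "sqnorm (residual g n x) = sqnorm (residual g n (x - y) + residual g n y)"
      using residual_add[of g n "x - y" y] by simp
    also have "\<dots> \<le> 2 * sqnorm (residual g n (x - y)) + 2 * sqnorm (residual g n y)"
      by (rule sqnorm_add_le)
    also have "\<dots> < r"
      using sqnorm_residual_le[OF g, of n "x - y"] N[OF that] y(2) by linarith
    finally show ?thesis .
  qed
  then show "\<exists>N. \<forall>n\<ge>N. norm (sqnorm (residual g n x) - 0) < r"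
    by auto
qed

lemma spanned_parseval:
  assumes g: "orthonormal_or_zero g" and x: "x \<in> spanned g"
  shows "(\<lambda>k. (cmod (B x (g k)))\<^sup>2) sums sqnorm x"
proof -
  have "(\<lambda>n. sqnorm x - sqnorm (residual g n x)) \<longlonglongrightarrow> sqnorm x - 0"
    using x by (intro tendsto_diff tendsto_const) (simp add: spanned_def)
  then show ?thesis
    by (simp add: sums_def sqnorm_residual[OF g])
qed

text \<open>Subtracting the component along the normalised residual of \<open>x n\<close> leaves a null vector, also when
  that residual is null already.\<close>

lemma gram_schmidt_spans: "x n \<in> spanned (gram_schmidt x)"
proof -
  let ?g = "gram_schmidt x"
  note g = orthonormal_gram_schmidt[of x]
  let ?r = "residual ?g n (x n)"
  have "sqnorm (residual ?g (Suc n) (x n)) = 0"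
  proof -
    have 1: "sqnorm (residual ?g (Suc n) (x n)) = sqnorm ?r - (cmod (B (x n) (?g n)))\<^sup>2"
      by (simp add: sqnorm_residual[OF g])
    have "B (\<Sum>k<n. B (x n) (?g k) \<cdot> ?g k) (?g n) = 0"
      unfolding sum_left scale_left
      by (rule sum.neutral) (use g in \<open>auto simp: orthonormal_or_zero_def\<close>)
    then have "B (x n) (?g n) = B ?r (?g n)"
      by (simp add: residual_def diff_left)
    also have "\<dots> = complex_of_real (1 / sqrt (sqnorm ?r) * sqnorm ?r)"
      by (subst gram_schmidt_eq) (simp add: normalise_def scale_right self)
    finally have "(cmod (B (x n) (?g n)))\<^sup>2 = (1 / sqrt (sqnorm ?r) * sqnorm ?r)\<^sup>2"
      by (simp only: norm_of_real power2_abs)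
    also have "\<dots> = sqnorm ?r"
      by (simp add: real_div_sqrt)
    finally show ?thesis using 1 by simp
  qed
  moreover have "sqnorm (residual ?g m (x n)) \<le> sqnorm (residual ?g (Suc n) (x n))" if "m \<ge> Suc n" for m
    unfolding sqnorm_residual[OF g] using that
    by (intro diff_left_mono sum_mono2) auto
  ultimately have "sqnorm (residual ?g m (x n)) = 0" if "m \<ge> Suc n" for m
    using that sqnorm_nonneg[of "residual ?g m (x n)"] by (metis order_antisym)
  then have "eventually (\<lambda>m. sqnorm (residual ?g m (x n)) = 0) sequentially"
    unfolding eventually_sequentially by blast
  then show ?thesis
    unfolding spanned_def by (simp add: tendsto_eventually)
qed

end

section \<open>Separable Hilbert spaces\<close>

lemma norm_scaleC: "norm (c *\<^sub>C x) = cmod c * norm (x :: 'h::complex_hilbert_space)"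
proof -
  have "complex_of_real ((norm (c *\<^sub>C x))\<^sup>2) = complex_of_real ((cmod c * norm x)\<^sup>2)"
    unfolding cinner_self[symmetric] cinner_scaleC_left cinner_scaleC_right
    by (simp add: cinner_self power_mult_distrib complex_norm_square mult.commute del: of_real_power)
  then show ?thesis
    by (simp add: power2_eq_iff_nonneg flip: of_real_power)
qed

global_interpretation cinner: bounded_bilinear "cinner :: 'h::complex_hilbert_space \<Rightarrow> 'h \<Rightarrow> complex"
proof
  fix x y :: 'h and r :: real
  show "cinner (r *\<^sub>R x) y = r *\<^sub>R cinner x y"
    by (simp add: cinner_scaleC_left scaleR_conv_of_real flip: scaleC_of_real)
  show "cinner x (r *\<^sub>R y) = r *\<^sub>R cinner x y"
    by (simp add: cinner_scaleC_right scaleR_conv_of_real flip: scaleC_of_real)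
  show "\<exists>K. \<forall>x y :: 'h. norm (cinner x y) \<le> norm x * norm y * K"
    by (intro exI[of _ 1]) (simp add: norm_cinner_le)
qed (simp_all add: cinner_add_left cinner_add_right)

global_interpretation scaleC: bounded_bilinear "scaleC :: complex \<Rightarrow> 'h \<Rightarrow> 'h::complex_hilbert_space"
proof
  fix a b :: complex and x y :: 'h and r :: real
  show "(r *\<^sub>R a) *\<^sub>C x = r *\<^sub>R a *\<^sub>C x"
    by (simp add: scaleC_scaleC scaleR_conv_of_real flip: scaleC_of_real)
  show "a *\<^sub>C r *\<^sub>R x = r *\<^sub>R a *\<^sub>C x"
    by (simp add: scaleC_scaleC mult.commute flip: scaleC_of_real)
  show "\<exists>K. \<forall>a (x :: 'h). norm (a *\<^sub>C x) \<le> norm a * norm x * K"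
    by (intro exI[of _ 1]) (simp add: norm_scaleC)
qed (simp_all add: scaleC_add_left scaleC_add_right)

global_interpretation hilbert: semi_inner_product "scaleC :: complex \<Rightarrow> 'h \<Rightarrow> 'h::complex_hilbert_space" cinner
  by standard (simp_all add: cinner_add_left cinner_scaleC_left cinner_self flip: cinner_commute)

lemma hilbert_sqnorm: "hilbert.sqnorm x = (norm (x :: 'h::complex_hilbert_space))\<^sup>2"
  by (simp add: hilbert.sqnorm_def cinner_self)

lemma cinner_eqI: "(\<And>y. cinner x y = cinner x' y) \<Longrightarrow> x = (x' :: 'h::complex_hilbert_space)"
proof -
  assume "\<And>y. cinner x y = cinner x' y"
  then have "cinner (x - x') (x - x') = 0"
    by (simp add: cinner_diff_left)
  then show ?thesis by (simp add: cinner_self)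
qed

definition orthonormal_seq :: "(nat \<Rightarrow> 'h::complex_hilbert_space) \<Rightarrow> bool" where
  "orthonormal_seq u \<longleftrightarrow> (\<forall>m n. cinner (u m) (u n) = (if m = n then 1 else 0))"

lemma norm_sum_orthonormal:
  assumes "orthonormal_seq u" "finite F"
  shows "(norm (\<Sum>n\<in>F. c n *\<^sub>C u n))\<^sup>2 = (\<Sum>n\<in>F. (cmod (c n))\<^sup>2)"
proof -
  have "cinner (\<Sum>n\<in>F. c n *\<^sub>C u n) (\<Sum>n\<in>F. c n *\<^sub>C u n)
      = (\<Sum>n\<in>F. \<Sum>m\<in>F. c m * cnj (c n) * cinner (u m) (u n))"
    by (simp add: hilbert.sum_left hilbert.sum_right cinner_scaleC_left cinner_scaleC_right
        sum_distrib_left mult_ac)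
  also have "\<dots> = (\<Sum>n\<in>F. \<Sum>m\<in>F. if m = n then c n * cnj (c n) else 0)"
    using assms by (intro sum.cong refl) (simp add: orthonormal_seq_def)
  also have "\<dots> = complex_of_real (\<Sum>n\<in>F. (cmod (c n))\<^sup>2)"
    using assms by (simp add: complex_norm_square del: of_real_power)
  finally show ?thesis
    unfolding cinner_self using of_real_eq_iff by blast
qed

lemma
  assumes u: "orthonormal_seq (u :: nat \<Rightarrow> 'h::complex_hilbert_space)"
    and c: "summable (\<lambda>n. (cmod (c n))\<^sup>2)"
  shows summable_orthonormal: "summable (\<lambda>n. c n *\<^sub>C u n)"
    and norm_suminf_orthonormal: "(norm (suminf (\<lambda>n. c n *\<^sub>C u n)))\<^sup>2 = suminf (\<lambda>n. (cmod (c n))\<^sup>2)"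
proof -
  show s: "summable (\<lambda>n. c n *\<^sub>C u n)"
    unfolding summable_Cauchy
  proof (intro allI impI)
    fix \<epsilon> :: real assume \<epsilon>: "\<epsilon> > 0"
    then obtain N where N: "\<And>m n. m \<ge> N \<Longrightarrow> norm (\<Sum>n\<in>{m..<n}. (cmod (c n))\<^sup>2) < \<epsilon>\<^sup>2"
      using c[unfolded summable_Cauchy] zero_less_power[OF \<epsilon>] by metis
    have "norm (\<Sum>n\<in>{m..<n}. c n *\<^sub>C u n) < \<epsilon>" if "m \<ge> N" for m n
    proof -
      have "(norm (\<Sum>n\<in>{m..<n}. c n *\<^sub>C u n))\<^sup>2 < \<epsilon>\<^sup>2"
        using N[OF that, of n] by (simp add: norm_sum_orthonormal[OF u])
      then show ?thesis
        using \<epsilon> by (simp add: power_less_imp_less_base)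
    qed
    then show "\<exists>N. \<forall>m\<ge>N. \<forall>n. norm (\<Sum>n\<in>{m..<n}. c n *\<^sub>C u n) < \<epsilon>"
      by blast
  qed
  have "(\<lambda>N. (norm (\<Sum>n<N. c n *\<^sub>C u n))\<^sup>2) \<longlonglongrightarrow> (norm (suminf (\<lambda>n. c n *\<^sub>C u n)))\<^sup>2"
    by (intro tendsto_power tendsto_norm summable_LIMSEQ s)
  moreover have "(\<lambda>N. (norm (\<Sum>n<N. c n *\<^sub>C u n))\<^sup>2) \<longlonglongrightarrow> suminf (\<lambda>n. (cmod (c n))\<^sup>2)"
    unfolding norm_sum_orthonormal[OF u finite_lessThan] by (rule summable_LIMSEQ[OF c])
  ultimately show "(norm (suminf (\<lambda>n. c n *\<^sub>C u n)))\<^sup>2 = suminf (\<lambda>n. (cmod (c n))\<^sup>2)"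
    by (rule LIMSEQ_unique)
qed

lemma separable_dense_sequence:
  assumes "separable_space (euclidean :: 'h::metric_space topology)"
  obtains d :: "nat \<Rightarrow> 'h::metric_space" where "\<And>x \<epsilon>. \<epsilon> > 0 \<Longrightarrow> \<exists>n. dist x (d n) < \<epsilon>"
proof -
  obtain C :: "'h set" where C: "countable C" "closure C = UNIV"
    using assms by (auto simp: separable_space_def)
  then have ne: "C \<noteq> {}" by auto
  have "\<exists>n. dist x (from_nat_into C n) < \<epsilon>" if \<epsilon>: "\<epsilon> > 0" for x \<epsilon>
  proof -
    have "x \<in> closure C" using C by simp
    then obtain y where "y \<in> C" "dist y x < \<epsilon>"
      using \<epsilon> unfolding closure_approachable by blast
    then show ?thesis
      using from_nat_into_surj[OF C(1)] by (metis dist_commute)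
  qed
  then show ?thesis by (rule that)
qed

definition hilbert_basis :: "(nat \<Rightarrow> 'h::complex_hilbert_space) \<Rightarrow> bool" where
  "hilbert_basis e \<longleftrightarrow> orthonormal_seq e \<and> (\<forall>x. (\<lambda>n. cinner x (e n) *\<^sub>C e n) sums x)"

text \<open>Apply Gram-Schmidt to a dense sequence and drop the zeros. Infinitely many vectors are left,
  since a finite number of them would span the space.\<close>

lemma hilbert_basis_exists:
  assumes sep: "separable_space (euclidean :: 'h::complex_hilbert_space topology)"
    and inf: "\<not> (\<exists>B :: 'h::complex_hilbert_space set. finite B \<and> complex_vector.span B = UNIV)"
  obtains e :: "nat \<Rightarrow> 'h::complex_hilbert_space" where "hilbert_basis e"
proof -
  obtain d :: "nat \<Rightarrow> 'h" where d: "\<And>x \<epsilon>. \<epsilon> > 0 \<Longrightarrow> \<exists>n. dist x (d n) < \<epsilon>"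
    using separable_dense_sequence[OF sep] by blast
  define g where "g = hilbert.gram_schmidt d"
  have g: "hilbert.orthonormal_or_zero g"
    unfolding g_def by (rule hilbert.orthonormal_gram_schmidt)
  have all: "x \<in> hilbert.spanned g" for x
  proof (rule hilbert.spanned_closed[OF g])
    fix \<epsilon> :: real assume \<epsilon>: "\<epsilon> > 0"
    then obtain n where "dist x (d n) < sqrt \<epsilon>"
      using d[of "sqrt \<epsilon>" x] by auto
    then have "(norm (x - d n))\<^sup>2 < (sqrt \<epsilon>)\<^sup>2"
      unfolding dist_norm by (intro power_strict_mono) auto
    then show "\<exists>y\<in>hilbert.spanned g. hilbert.sqnorm (x - y) < \<epsilon>"
      using hilbert.gram_schmidt_spans[of d n] \<epsilon> unfolding g_def hilbert_sqnorm by auto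
  qed
  have sums: "(\<lambda>n. cinner x (g n) *\<^sub>C g n) sums x" for x
  proof -
    have "(\<lambda>n. (norm (hilbert.residual g n x))\<^sup>2) \<longlonglongrightarrow> 0"
      using all[of x] by (simp add: hilbert.spanned_def hilbert_sqnorm)
    then have "(\<lambda>n. hilbert.residual g n x) \<longlonglongrightarrow> 0"
      by (simp add: tendsto_norm_zero_iff)
    then have "(\<lambda>n. x - hilbert.residual g n x) \<longlonglongrightarrow> x - 0"
      by (intro tendsto_diff tendsto_const)
    then show ?thesis
      by (simp add: sums_def hilbert.residual_def)
  qed
  define A where "A = {n. g n \<noteq> 0}"
  have "infinite A"
  proof
    assume "finite A"
    have "x \<in> complex_vector.span (g ` A)" for x
    proof -
      have "(\<lambda>n. cinner x (g n) *\<^sub>C g n) sums (\<Sum>n\<in>A. cinner x (g n) *\<^sub>C g n)"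
        by (rule sums_finite) (use \<open>finite A\<close> in \<open>auto simp: A_def\<close>)
      then have "x = (\<Sum>n\<in>A. cinner x (g n) *\<^sub>C g n)"
        using sums[of x] by (simp add: sums_iff)
      also have "\<dots> \<in> complex_vector.span (g ` A)"
        by (intro complex_vector.span_sum complex_vector.span_scale complex_vector.span_base imageI)
      finally show ?thesis .
    qed
    then have "complex_vector.span (g ` A) = UNIV" by blast
    then show False using inf \<open>finite A\<close> by blast
  qed
  note A = strict_mono_enumerate[OF this] enumerate_in_set[OF this] range_enumerate[OF this]
  have "orthonormal_seq (g \<circ> enumerate A)"
    using g A(2) strict_mono_eq[OF A(1)]
    by (auto simp: orthonormal_seq_def hilbert.orthonormal_or_zero_def A_def)
  moreover have "(\<lambda>n. cinner x ((g \<circ> enumerate A) n) *\<^sub>C (g \<circ> enumerate A) n) sums x" for x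
    using sums[of x] sums_mono_reindex[OF A(1), of "\<lambda>n. cinner x (g n) *\<^sub>C g n" x]
    unfolding A(3) by (auto simp: A_def)
  ultimately show ?thesis
    by (intro that[of "g \<circ> enumerate A"]) (simp add: hilbert_basis_def)
qed

definition complex_linear :: "('h::complex_hilbert_space \<Rightarrow>\<^sub>L 'h) \<Rightarrow> bool" where
  "complex_linear A \<longleftrightarrow> (\<forall>c x. A (c *\<^sub>C x) = c *\<^sub>C A x)"

lemma complex_linear_compose: "complex_linear A \<Longrightarrow> complex_linear B \<Longrightarrow> complex_linear (A o\<^sub>L B)"
  by (simp add: complex_linear_def)

lemma is_adjoint_sym: "is_adjoint A B \<Longrightarrow> is_adjoint B A"
  unfolding is_adjoint_def by (metis cinner_commute)

lemma is_adjoint_complex_linear: "is_adjoint A B \<Longrightarrow> complex_linear A"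
  by (auto simp: complex_linear_def is_adjoint_scaleC)

lemma is_adjoint_compose: "is_adjoint A A' \<Longrightarrow> is_adjoint B B' \<Longrightarrow> is_adjoint (A o\<^sub>L B) (B' o\<^sub>L A')"
  by (simp add: is_adjoint_def)

text \<open>Polarisation for operators.\<close>

lemma isometry_cinner:
  assumes "complex_linear A" "\<And>x. norm (A x) = norm x"
  shows "cinner (A x) (A y) = cinner x y"
  by (rule hilbert.linear_isometry_preserves)
    (use assms in \<open>simp_all add: blinfun.add_right complex_linear_def hilbert_sqnorm\<close>)

text \<open>An isometry is injective, so a right inverse is two-sided, and then it is the adjoint by
  polarisation.\<close>

lemma unitary_if_isometric_inverse:
  assumes A: "complex_linear A" "\<And>x. norm (A x) = norm x" and AB: "A o\<^sub>L B = id_blinfun"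
  shows "is_adjoint A B" "B o\<^sub>L A = id_blinfun" "unitary A"
proof -
  have ABx: "A (B x) = x" for x
    using arg_cong[OF AB, of "\<lambda>C. blinfun_apply C x"] by simp
  show adj: "is_adjoint A B"
    unfolding is_adjoint_def using isometry_cinner[OF A] ABx by metis
  show BA: "B o\<^sub>L A = id_blinfun"
  proof (rule blinfun_eqI)
    fix x
    have "norm (B (A x) - x) = norm (A (B (A x) - x))"
      by (simp only: A(2))
    then show "(B o\<^sub>L A) x = id_blinfun x"
      by (simp add: ABx blinfun.diff_right)
  qed
  show "unitary A"
    using adj BA AB by (auto simp: unitary_def)
qed

lemma blinfun_isometry:
  fixes f :: "'h::complex_hilbert_space \<Rightarrow> 'h"
  assumes "\<And>x y. f (x + y) = f x + f y" "\<And>c x. f (c *\<^sub>C x) = c *\<^sub>C f x" "\<And>x. norm (f x) \<le> norm x"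
  obtains A :: "'h::complex_hilbert_space \<Rightarrow>\<^sub>L 'h" where "\<And>x. A x = f x" "complex_linear A"
proof -
  have "bounded_linear f"
    by (rule bounded_linear_intro[where K = 1])
      (use assms in \<open>simp_all flip: scaleC_of_real\<close>)
  then have "blinfun_apply (Blinfun f) x = f x" for x
    by (simp add: bounded_linear_Blinfun_apply)
  then show ?thesis
    using that[of "Blinfun f"] assms(2) by (simp add: complex_linear_def)
qed

lemma complex_linear_sums:
  assumes "hilbert_basis e" "complex_linear A"
  shows "(\<lambda>n. cinner x (e n) *\<^sub>C A (e n)) sums A x"
proof -
  have "(\<lambda>n. A (cinner x (e n) *\<^sub>C e n)) sums A x"
    using assms(1) by (intro bounded_linear.sums[OF blinfun.bounded_linear_right]) (simp add: hilbert_basis_def)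
  then show ?thesis
    using assms(2) by (simp add: complex_linear_def)
qed

lemma complex_linear_eqI:
  assumes "hilbert_basis e" "complex_linear A" "complex_linear B" "\<And>n. A (e n) = B (e n)"
  shows "A = B"
proof (rule blinfun_eqI)
  fix x
  show "A x = B x"
    using complex_linear_sums[OF assms(1,2), of x] complex_linear_sums[OF assms(1,3), of x] assms(4)
    by (simp add: sums_unique2)
qed

lemma hilbert_basis_parseval:
  assumes "hilbert_basis e"
  shows "(\<lambda>n. (cmod (cinner x (e n)))\<^sup>2) sums (norm x)\<^sup>2"
proof -
  have o: "orthonormal_seq e" and s: "(\<lambda>n. cinner x (e n) *\<^sub>C e n) sums x"
    using assms by (auto simp: hilbert_basis_def)
  have "(\<lambda>N. (norm (\<Sum>n<N. cinner x (e n) *\<^sub>C e n))\<^sup>2) \<longlonglongrightarrow> (norm x)\<^sup>2"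
    using s unfolding sums_def by (intro tendsto_power tendsto_norm)
  then show ?thesis
    by (simp add: sums_def norm_sum_orthonormal[OF o])
qed

text \<open>\<open>A x\<close> is the sum of \<open>\<langle>x, e n\<rangle> u n\<close>; it converges and has the right norm by Parseval.\<close>

lemma isometry_on_basis:
  assumes e: "hilbert_basis (e :: nat \<Rightarrow> 'h::complex_hilbert_space)" and u: "orthonormal_seq u"
  obtains A :: "'h::complex_hilbert_space \<Rightarrow>\<^sub>L 'h" where "complex_linear A" "\<And>x. norm (A x) = norm x" "\<And>n. A (e n) = u n"
proof -
  note p = hilbert_basis_parseval[OF e]
  define f where "f x = suminf (\<lambda>n. cinner x (e n) *\<^sub>C u n)" for x
  have s: "summable (\<lambda>n. cinner x (e n) *\<^sub>C u n)" for x
    by (rule summable_orthonormal[OF u sums_summable[OF p]])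
  have norm: "norm (f x) = norm x" for x
  proof -
    have "(norm (f x))\<^sup>2 = (norm x)\<^sup>2"
      unfolding f_def norm_suminf_orthonormal[OF u sums_summable[OF p]]
      using p by (simp add: sums_iff)
    then show ?thesis by simp
  qed
  obtain A :: "'h \<Rightarrow>\<^sub>L 'h" where A: "\<And>x. A x = f x" "complex_linear A"
  proof (rule blinfun_isometry[of f])
    show "f (x + y) = f x + f y" for x y
      unfolding f_def cinner_add_left scaleC_add_left by (rule suminf_add[symmetric]) (rule s)+
    show "f (c *\<^sub>C x) = c *\<^sub>C f x" for c x
      unfolding f_def cinner_scaleC_left scaleC_scaleC[symmetric]
      by (rule bounded_linear.suminf[OF scaleC.bounded_linear_right s, symmetric])
  qed (auto simp: norm)
  have "f (e n) = u n" for n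
  proof -
    have "cinner (e n) (e m) *\<^sub>C u m = (if m = n then u m else 0)" for m
      using e by (auto simp: hilbert_basis_def orthonormal_seq_def)
    then have "f (e n) = suminf (\<lambda>m. if m = n then u m else 0)"
      by (simp add: f_def)
    then show ?thesis
      using sums_single[of n u] by (simp add: sums_iff)
  qed
  then show ?thesis using that[of A] A norm by simp
qed

text \<open>The adjoint is given by \<open>A\<^sup>* y = \<Sum>\<^sub>n \<langle>y, A e\<^sub>n\<rangle> e\<^sub>n\<close>. The coefficients are square summable: with
  \<open>z\<close> a partial sum, \<open>\<parallel>z\<parallel>\<^sup>2 = \<langle>y, A z\<rangle> \<le> \<parallel>y\<parallel> \<parallel>z\<parallel>\<close>.\<close>

lemma adjoint_exists:
  assumes e: "hilbert_basis (e :: nat \<Rightarrow> 'h::complex_hilbert_space)"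
    and A: "complex_linear A" "\<And>x. norm (A x) \<le> norm x"
  obtains B :: "'h::complex_hilbert_space \<Rightarrow>\<^sub>L 'h" where "is_adjoint A B" "\<And>x. norm (B x) \<le> norm x"
proof -
  have o: "orthonormal_seq e" using e by (simp add: hilbert_basis_def)
  define c where "c y n = cinner y (A (e n))" for y n
  have part: "(\<Sum>n<N. (cmod (c y n))\<^sup>2) \<le> (norm y)\<^sup>2" for y N
  proof -
    define z where "z = (\<Sum>n<N. c y n *\<^sub>C e n)"
    have z: "(norm z)\<^sup>2 = (\<Sum>n<N. (cmod (c y n))\<^sup>2)"
      unfolding z_def by (rule norm_sum_orthonormal[OF o]) simp
    have "A z = (\<Sum>n<N. c y n *\<^sub>C A (e n))"
      using A(1) by (simp add: z_def blinfun.sum_right complex_linear_def)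
    then have "cinner y (A z) = complex_of_real ((norm z)\<^sup>2)"
      unfolding z by (simp add: hilbert.sum_right cinner_scaleC_right
          complex_norm_square mult.commute del: of_real_power flip: c_def)
    then have "(norm z)\<^sup>2 \<le> norm y * norm (A z)"
      using norm_cinner_le[of y "A z"] by (simp del: of_real_power)
    also have "\<dots> \<le> norm y * norm z"
      by (intro mult_left_mono A) simp
    finally have "norm z \<le> norm y"
      by (cases "norm z = 0") (auto simp: power2_eq_square)
    then show ?thesis
      unfolding z[symmetric] by simp
  qed
  then have sc: "summable (\<lambda>n. (cmod (c y n))\<^sup>2)" for y
    by (intro summableI_nonneg_bounded) auto
  note s = summable_orthonormal[OF o sc]
  define f where "f y = suminf (\<lambda>n. c y n *\<^sub>C e n)" for y
  have nf: "norm (f y) \<le> norm y" for y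
  proof -
    have "(norm (f y))\<^sup>2 \<le> (norm y)\<^sup>2"
      unfolding f_def norm_suminf_orthonormal[OF o sc] by (rule suminf_le_const[OF sc part])
    then show ?thesis by simp
  qed
  obtain B :: "'h \<Rightarrow>\<^sub>L 'h" where B: "\<And>x. B x = f x" "complex_linear B"
  proof (rule blinfun_isometry[of f])
    show "f (x + y) = f x + f y" for x y
      unfolding f_def by (subst suminf_add[OF s s]) (simp add: c_def cinner_add_left scaleC_add_left)
    show "f (a *\<^sub>C x) = a *\<^sub>C f x" for a x
      unfolding f_def using bounded_linear.suminf[OF scaleC.bounded_linear_right s, of a x]
      by (simp add: c_def cinner_scaleC_left scaleC_scaleC)
  qed (auto simp: nf)
  have "cinner (B y) x = cinner y (A x)" for x y
  proof -
    have "(\<lambda>n. cinner (B y) (cinner x (e n) *\<^sub>C e n)) sums cinner (B y) x"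
      using e by (intro bounded_linear.sums[OF cinner.bounded_linear_right]) (simp add: hilbert_basis_def)
    moreover have "(\<lambda>n. cinner y (cinner x (e n) *\<^sub>C A (e n))) sums cinner y (A x)"
      by (intro bounded_linear.sums[OF cinner.bounded_linear_right] complex_linear_sums[OF e A(1)])
    moreover have "cinner (B y) (e n) = cinner y (A (e n))" for n
    proof -
      have "(\<lambda>m. cinner (c y m *\<^sub>C e m) (e n)) sums cinner (f y) (e n)"
        unfolding f_def by (intro bounded_linear.sums[OF cinner.bounded_linear_left] summable_sums s)
      moreover have "cinner (c y m *\<^sub>C e m) (e n) = (if m = n then c y m else 0)" for m
        using o by (simp add: cinner_scaleC_left orthonormal_seq_def)
      ultimately have "(\<lambda>m. if m = n then c y m else 0) sums cinner (f y) (e n)"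
        by simp
      then have "cinner (f y) (e n) = c y n"
        by (rule sums_unique2) (rule sums_single)
      then show ?thesis by (simp add: B c_def)
    qed
    ultimately show ?thesis
      by (simp add: cinner_scaleC_right sums_unique2)
  qed
  then have "is_adjoint B A" by (simp add: is_adjoint_def)
  then show ?thesis
    using that[OF is_adjoint_sym] nf B by simp
qed

section \<open>Unitary dilation of a contraction semigroup\<close>

abbreviation lookup :: "('a \<Rightarrow>\<^sub>0 'b::zero) \<Rightarrow> 'a \<Rightarrow> 'b" where "lookup \<equiv> Poly_Mapping.lookup"
abbreviation keys :: "('a \<Rightarrow>\<^sub>0 'b::zero) \<Rightarrow> 'a set" where "keys \<equiv> Poly_Mapping.keys"
abbreviation single :: "'a \<Rightarrow> 'b::zero \<Rightarrow> 'a \<Rightarrow>\<^sub>0 'b" where "single \<equiv> Poly_Mapping.single"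

definition contraction_semigroup :: "(real \<Rightarrow> 'h::complex_hilbert_space \<Rightarrow>\<^sub>L 'h) \<Rightarrow> bool" where
  "contraction_semigroup S \<longleftrightarrow> (\<forall>t\<ge>0. contraction (S t)) \<and> S 0 = id_blinfun \<and>
     (\<forall>s\<ge>0. \<forall>t\<ge>0. S (s + t) = S s o\<^sub>L S t) \<and> (\<forall>x. continuous_on {0..} (\<lambda>t. S t x))"

definition unitary_group :: "(real \<Rightarrow> 'h::complex_hilbert_space \<Rightarrow>\<^sub>L 'h) \<Rightarrow> bool" where
  "unitary_group U \<longleftrightarrow> (\<forall>t. is_adjoint (U t) (U (- t))) \<and> U 0 = id_blinfun \<and>
     (\<forall>s t. U (s + t) = U s o\<^sub>L U t) \<and> (\<forall>x. continuous_on UNIV (\<lambda>t. U t x))"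

definition pscale :: "complex \<Rightarrow> (real \<Rightarrow>\<^sub>0 'h) \<Rightarrow> (real \<Rightarrow>\<^sub>0 'h::complex_hilbert_space)" where
  "pscale c f = Poly_Mapping.map (\<lambda>x. c *\<^sub>C x) f"

lemma lookup_pscale [simp]: "lookup (pscale c f) t = c *\<^sub>C lookup f t"
  by (simp add: pscale_def Poly_Mapping.map.rep_eq when_def)

lemma vector_space_pscale: "vector_space (pscale :: complex \<Rightarrow> (real \<Rightarrow>\<^sub>0 'h::complex_hilbert_space) \<Rightarrow> _)"
  by standard (auto intro!: poly_mapping_eqI simp: lookup_add scaleC_add_left scaleC_add_right scaleC_scaleC)

lemma poly_mapping_sum_single: "f = (\<Sum>t\<in>keys f. single t (lookup f t))"
  by (rule poly_mapping_eqI)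
    (simp add: lookup_sum lookup_single when_def sum.delta' in_keys_iff)

definition shift :: "real \<Rightarrow> (real \<Rightarrow>\<^sub>0 'a) \<Rightarrow> (real \<Rightarrow>\<^sub>0 'a::zero)" where
  "shift r f = Poly_Mapping.map_key (\<lambda>t. t - r) f"

lemma lookup_shift [simp]: "lookup (shift r f) t = lookup f (t - r)"
  by (simp add: shift_def map_key.rep_eq inj_on_def)

lemma shift_shift: "shift r (shift s f) = shift (r + s) f"
  by (rule poly_mapping_eqI) (simp add: algebra_simps)

lemma shift_single: "shift r (single t x) = single (t + r) x"
  by (rule poly_mapping_eqI) (simp add: lookup_single when_def algebra_simps)

lemma shift_add: "shift r (f + g) = shift r f + shift r g"
  by (rule poly_mapping_eqI) (simp add: lookup_add)

lemma shift_zero_left: "shift 0 f = f"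
  by (rule poly_mapping_eqI) simp

lemma shift_zero: "shift r 0 = 0"
  by (rule poly_mapping_eqI) simp

lemma shift_pscale: "shift r (pscale c f) = pscale c (shift r f)"
  by (rule poly_mapping_eqI) simp

lemma keys_shift: "keys (shift r f) = (\<lambda>t. t + r) ` keys f"
  by (force simp: in_keys_iff image_iff)

text \<open>A formal combination \<open>f\<close> stands for the vector \<open>\<Sum>\<^sub>t U(t) f(t)\<close> of the dilation space, where \<open>U\<close> is the
  unitary group to be constructed; \<open>U(r)\<close> then acts as \<open>shift r\<close>. The inner product of \<open>U(s) x\<close> and
  \<open>U(t) y\<close> is forced to be \<open>ker s x t y\<close> below.\<close>

locale one_parameter_semigroup =
  fixes S :: "real \<Rightarrow> 'h::complex_hilbert_space \<Rightarrow>\<^sub>L 'h"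
  assumes S: "contraction_semigroup S"
begin

lemma
  shows S_linear: "t \<ge> 0 \<Longrightarrow> S t (c *\<^sub>C x) = c *\<^sub>C S t x"
    and S_norm: "t \<ge> 0 \<Longrightarrow> norm (S t x) \<le> norm x"
    and S_0: "S 0 = id_blinfun"
    and S_add: "s \<ge> 0 \<Longrightarrow> t \<ge> 0 \<Longrightarrow> S (s + t) x = S s (S t x)"
    and S_cont: "continuous_on {0..} (\<lambda>t. S t x)"
proof -
  show "t \<ge> 0 \<Longrightarrow> norm (S t x) \<le> norm x"
    using S norm_blinfun[of "S t" x] mult_right_mono[of "norm (S t)" 1 "norm x"]
    by (force simp: contraction_semigroup_def contraction_def)
qed (use S in \<open>auto simp: contraction_semigroup_def contraction_def\<close>)

definition ker :: "real \<Rightarrow> 'h \<Rightarrow> real \<Rightarrow> 'h \<Rightarrow> complex" where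
  "ker s x t y = (if t \<le> s then cinner (S (s - t) x) y else cinner x (S (t - s) y))"

definition form :: "(real \<Rightarrow>\<^sub>0 'h) \<Rightarrow> (real \<Rightarrow>\<^sub>0 'h) \<Rightarrow> complex" where
  "form f g = (\<Sum>s\<in>keys f. \<Sum>t\<in>keys g. ker s (lookup f s) t (lookup g t))"

lemma ker_zero [simp]: "ker s 0 t y = 0" "ker s x t 0 = 0"
  by (simp_all add: ker_def)

lemma ker_commute: "ker s x t y = cnj (ker t y s x)"
  by (cases "s = t") (auto simp: ker_def S_0 simp flip: cinner_commute)

lemma ker_add: "ker s (x + x') t y = ker s x t y + ker s x' t y"
  by (simp add: ker_def blinfun.add_right cinner_add_left)

lemma ker_scale: "ker s (c *\<^sub>C x) t y = c * ker s x t y"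
  by (simp add: ker_def S_linear cinner_scaleC_left)

lemma form_superset:
  assumes "finite F" "keys f \<subseteq> F" "finite F'" "keys g \<subseteq> F'"
  shows "form f g = (\<Sum>s\<in>F. \<Sum>t\<in>F'. ker s (lookup f s) t (lookup g t))"
proof -
  have "form f g = (\<Sum>s\<in>keys f. \<Sum>t\<in>F'. ker s (lookup f s) t (lookup g t))"
    unfolding form_def using assms
    by (intro sum.cong refl sum.mono_neutral_left) (auto simp: in_keys_iff)
  also have "\<dots> = (\<Sum>s\<in>F. \<Sum>t\<in>F'. ker s (lookup f s) t (lookup g t))"
    using assms by (intro sum.mono_neutral_left) (auto simp: in_keys_iff)
  finally show ?thesis .
qed

lemma form_single: "form (single s x) (single t y) = ker s x t y"
  using form_superset[of "{s}" "single s x" "{t}" "single t y"]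
  by (simp split: if_splits)

lemma form_add_left: "form (f + f') g = form f g + form f' g"
proof -
  let ?F = "keys f \<union> keys f'"
  have "form f'' g = (\<Sum>s\<in>?F. \<Sum>t\<in>keys g. ker s (lookup f'' s) t (lookup g t))" if "keys f'' \<subseteq> ?F" for f''
    using that by (intro form_superset) auto
  then show ?thesis
    using keys_add[of f f'] by (simp add: lookup_add ker_add sum.distrib)
qed

lemma form_pscale_left: "form (pscale c f) g = c * form f g"
proof -
  have "keys (pscale c f) \<subseteq> keys f"
    by (auto simp: in_keys_iff)
  then have "form (pscale c f) g = (\<Sum>s\<in>keys f. \<Sum>t\<in>keys g. ker s (lookup (pscale c f) s) t (lookup g t))"
    by (intro form_superset) auto
  then show ?thesis
    by (simp add: form_def ker_scale sum_distrib_left)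
qed

lemma form_commute: "form f g = cnj (form g f)"
  unfolding form_def cnj_sum
  by (subst sum.swap) (intro sum.cong refl ker_commute)

lemma form_add_right: "form g (f + f') = form g f + form g f'"
  by (metis form_add_left form_commute complex_cnj_add)

lemma form_shift: "form (shift r f) (shift r g) = form f g"
proof -
  have inj: "inj_on (\<lambda>t. t + r) A" for A :: "real set"
    by (simp add: inj_on_def)
  show ?thesis
    unfolding form_def keys_shift sum.reindex[OF inj] o_def lookup_shift
    by (intro sum.cong refl) (simp add: ker_def)
qed

text \<open>In a pairing with vectors supported at times at most \<open>m\<close>, the time \<open>b \<ge> m\<close> may be moved to
  \<open>m\<close> at the price of applying \<open>S (b - m)\<close>, by the semigroup law.\<close>

lemma form_merge:
  assumes "m \<le> b" "\<And>t. t \<in> keys f \<Longrightarrow> t \<le> m"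
  shows "form (single b x) f = form (single m (S (b - m) x)) f"
proof -
  have *: "form (single s y) f = (\<Sum>t\<in>keys f. ker s y t (lookup f t))" for s y
    using form_superset[of "{s}" "single s y" "keys f" f] by (simp split: if_splits)
  have "ker b x t y = ker m (S (b - m) x) t y" if "t \<le> m" for t y
    using S_add[of "m - t" "b - m" x] that assms(1) by (simp add: ker_def)
  then show ?thesis
    unfolding * using assms(2) by (intro sum.cong) auto
qed

text \<open>Induction on the number of time points: moving the vector \<open>x\<close> at the latest time \<open>b\<close> to the
  latest but one time \<open>m\<close> changes the square \<open>form f f\<close> only in the term \<open>\<parallel>x\<parallel>\<^sup>2\<close>, which becomes
  \<open>\<parallel>S (b - m) x\<parallel>\<^sup>2 \<le> \<parallel>x\<parallel>\<^sup>2\<close>.\<close>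

lemma form_nonneg: "0 \<le> Re (form f f)"
proof -
  have "finite F \<Longrightarrow> keys f \<subseteq> F \<Longrightarrow> 0 \<le> Re (form f f)" for F f
  proof (induction F arbitrary: f rule: finite_linorder_max_induct)
    case empty
    then show ?case by (simp add: form_def)
  next
    case (insert b A)
    define x where "x = lookup f b"
    define f0 where "f0 = f - single b x"
    have f: "f = f0 + single b x"
      by (simp add: f0_def)
    have k0: "keys f0 \<subseteq> A"
      using insert.prems by (auto simp: in_keys_iff f0_def lookup_minus lookup_single x_def when_def split: if_splits)
    have split: "Re (form (f0 + g) (f0 + g)) = Re (form f0 f0) + 2 * Re (form g f0) + Re (form g g)" for g
      using arg_cong[OF form_commute[of f0 g], of Re] by (simp add: form_add_left form_add_right)
    show ?case
    proof (cases "A = {}")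
      case True
      then have "f0 = 0" using k0 by simp
      then show ?thesis by (simp add: f form_single ker_def S_0 cinner_self)
    next
      case False
      define m where "m = Max A"
      have m: "m \<in> A" "\<And>t. t \<in> A \<Longrightarrow> t \<le> m" "m < b"
        using False insert.hyps by (auto simp: m_def)
      let ?g = "single m (S (b - m) x)"
      have "keys (f0 + ?g) \<subseteq> A"
        using keys_add[of f0 ?g] k0 m(1) by (auto split: if_splits)
      then have "0 \<le> Re (form (f0 + ?g) (f0 + ?g))"
        by (rule insert.IH)
      also have "\<dots> = Re (form f0 f0) + 2 * Re (form (single b x) f0) + (norm (S (b - m) x))\<^sup>2"
        unfolding split using form_merge[of m b f0 x] m k0
        by (simp add: form_single ker_def S_0 cinner_self subset_iff del: of_real_power)
      also have "\<dots> \<le> Re (form f0 f0) + 2 * Re (form (single b x) f0) + (norm x)\<^sup>2"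
        using m(3) by (intro add_left_mono power_mono S_norm) auto
      also have "\<dots> = Re (form f f)"
        unfolding f split by (simp add: form_single ker_def S_0 cinner_self del: of_real_power)
      finally show ?thesis .
    qed
  qed
  then show ?thesis using finite_keys by blast
qed

sublocale E: semi_inner_product pscale form
  using vector_space_pscale
  by (simp add: semi_inner_product_def semi_inner_product_axioms_def form_add_left
      form_pscale_left form_nonneg flip: form_commute)

lemma S_cont_0:
  assumes "\<epsilon> > 0"
  obtains \<delta> where "\<delta> > 0" "\<And>h. 0 \<le> h \<Longrightarrow> h < \<delta> \<Longrightarrow> norm (S h x - x) < \<epsilon>"
proof -
  obtain \<delta> where "\<delta> > 0" "\<And>h. 0 \<le> h \<Longrightarrow> dist h 0 < \<delta> \<Longrightarrow> dist (S h x) (S 0 x) < \<epsilon>"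
    using S_cont[of x] assms unfolding continuous_on_iff by (metis atLeast_iff order_refl)
  then show ?thesis
    using that[of \<delta>] by (simp add: dist_norm S_0)
qed

lemma sqnorm_single: "E.sqnorm (single t x) = (norm x)\<^sup>2"
  by (simp add: E.sqnorm_def form_single ker_def S_0 cinner_self del: of_real_power)

lemma sqnorm_single_diff_le:
  "E.sqnorm (single s x - single t x) \<le> 2 * norm x * norm (S \<bar>s - t\<bar> x - x)"
proof -
  have "Re (ker s x t x) = Re (cinner (S \<bar>s - t\<bar> x) x)"
    using arg_cong[OF cinner_commute[of x "S (t - s) x"], of Re] by (simp add: ker_def)
  then have "E.sqnorm (single s x - single t x) = 2 * Re (cinner x x - cinner (S \<bar>s - t\<bar> x) x)"
    by (simp add: E.sqnorm_diff sqnorm_single form_single cinner_self del: of_real_power)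
  also have "\<dots> = 2 * Re (cinner (x - S \<bar>s - t\<bar> x) x)"
    by (simp add: cinner_diff_left)
  also have "\<dots> \<le> 2 * (norm (x - S \<bar>s - t\<bar> x) * norm x)"
    by (intro mult_left_mono order_trans[OF complex_Re_le_cmod norm_cinner_le]) simp
  finally show ?thesis
    by (simp add: norm_minus_commute mult_ac)
qed

lemma sqnorm_single_tendsto:
  "((\<lambda>s. E.sqnorm (single s x - single t x)) \<longlongrightarrow> 0) (at t)"
proof (rule tendsto_sandwich[OF _ _ tendsto_const])
  show "((\<lambda>s. 2 * norm x * norm (S \<bar>s - t\<bar> x - x)) \<longlongrightarrow> 0) (at t)"
  proof -
    have "((\<lambda>s. norm (S \<bar>s - t\<bar> x - x)) \<longlongrightarrow> 0) (at t)"
    proof (rule tendstoI)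
      fix \<epsilon> :: real assume "\<epsilon> > 0"
      then obtain \<delta> where \<delta>: "\<delta> > 0" "\<And>h. 0 \<le> h \<Longrightarrow> h < \<delta> \<Longrightarrow> norm (S h x - x) < \<epsilon>"
        by (rule S_cont_0) blast
      show "\<forall>\<^sub>F s in at t. dist (norm (S \<bar>s - t\<bar> x - x)) 0 < \<epsilon>"
        unfolding eventually_at using \<delta> by (intro exI[of _ \<delta>]) (auto simp: dist_real_def)
    qed
    then show ?thesis
      using tendsto_mult_left[of _ 0 _ "2 * norm x"] by fastforce
  qed
qed (auto simp: sqnorm_single_diff_le)

lemma single_approx:
  fixes d :: "nat \<Rightarrow> 'h"
  assumes d: "\<And>x \<epsilon>. \<epsilon> > 0 \<Longrightarrow> \<exists>n. dist x (d n) < \<epsilon>" and \<epsilon>: "\<epsilon> > 0"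
  shows "\<exists>r\<in>\<rat>. \<exists>n. E.sqnorm (single t x - single r (d n)) < \<epsilon>"
proof -
  obtain \<delta> where \<delta>: "\<delta> > 0" "\<And>s. s \<noteq> t \<Longrightarrow> dist s t < \<delta> \<Longrightarrow> E.sqnorm (single s x - single t x) < \<epsilon> / 4"
    using tendstoD[OF sqnorm_single_tendsto[of x t], of "\<epsilon> / 4"] \<epsilon> by (auto simp: eventually_at)
  obtain r where r: "r \<in> \<rat>" "t < r" "r < t + \<delta>"
    using Rats_dense_in_real[of t "t + \<delta>"] \<delta>(1) by auto
  have 1: "E.sqnorm (single r x - single t x) < \<epsilon> / 4"
    by (rule \<delta>(2)) (use r in \<open>auto simp: dist_real_def\<close>)
  obtain n where "dist x (d n) < sqrt (\<epsilon> / 4)"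
    using d[of "sqrt (\<epsilon> / 4)" x] \<epsilon> by auto
  then have "(norm (d n - x))\<^sup>2 < (sqrt (\<epsilon> / 4))\<^sup>2"
    unfolding dist_norm by (intro power_strict_mono) (auto simp: norm_minus_commute)
  then have 2: "E.sqnorm (single r (d n - x)) < \<epsilon> / 4"
    using \<epsilon> by (simp add: sqnorm_single)
  have "E.sqnorm (single t x - single r (d n)) = E.sqnorm (single r (d n) - single t x)"
    using E.sqnorm_scale[of "-1" "single t x - single r (d n)"] by simp
  also have "single r (d n) - single t x = single r (d n - x) + (single r x - single t x)"
    by (simp add: single_diff)
  also have "E.sqnorm \<dots> \<le> 2 * E.sqnorm (single r (d n - x)) + 2 * E.sqnorm (single r x - single t x)"
    by (rule E.sqnorm_add_le)
  also have "\<dots> < \<epsilon>" using 1 2 by linarith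
  finally show ?thesis using r(1) by blast
qed

text \<open>The vectors at rational times with values in a countable dense set suffice, because
  \<open>single t x\<close> depends continuously on \<open>t\<close> in the seminorm.\<close>

lemma dense_gram_schmidt:
  assumes sep: "separable_space (euclidean :: 'h topology)"
  obtains g where "E.orthonormal_or_zero g" "\<And>f. f \<in> E.spanned g"
proof -
  obtain d :: "nat \<Rightarrow> 'h" where d: "\<And>x \<epsilon>. \<epsilon> > 0 \<Longrightarrow> \<exists>n. dist x (d n) < \<epsilon>"
    using separable_dense_sequence[OF sep] by blast
  define f where "f k = (case prod_decode k of (i, j) \<Rightarrow> single (from_nat_into (\<rat> :: real set) i) (d j))" for k
  define g where "g = E.gram_schmidt f"
  have g: "E.orthonormal_or_zero g"
    unfolding g_def by (rule E.orthonormal_gram_schmidt)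
  have 1: "single r (d j) \<in> E.spanned g" if r: "r \<in> \<rat>" for r j
  proof -
    obtain i where "from_nat_into \<rat> i = r"
      using from_nat_into_surj[OF countable_rat r] by blast
    then have "f (prod_encode (i, j)) = single r (d j)"
      by (simp add: f_def)
    then show ?thesis
      using E.gram_schmidt_spans[of f "prod_encode (i, j)"] by (simp add: g_def)
  qed
  have 2: "single t x \<in> E.spanned g" for t x
    by (rule E.spanned_closed[OF g]) (use single_approx[OF d] 1 in blast)
  have "(\<Sum>t\<in>F. single t (lookup f t)) \<in> E.spanned g" for F f
    by (induction F rule: infinite_finite_induct) (auto intro: E.spanned_zero E.spanned_add 2)
  then have "f \<in> E.spanned g" for f
    by (subst poly_mapping_sum_single)
  with g show ?thesis by (rule that)
qed

end

text \<open>Finite partial sums of basis expansions approximate uniformly in the parameter, as the operators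
  are contractions.\<close>

lemma strongly_continuous_if_on_basis:
  assumes e: "hilbert_basis e" and lin: "\<And>r. r \<in> A \<Longrightarrow> complex_linear (U r)"
    and norm: "\<And>r x. r \<in> A \<Longrightarrow> norm (U r x) \<le> norm x"
    and cont: "\<And>n. continuous_on A (\<lambda>r. U r (e n))"
  shows "continuous_on A (\<lambda>r. U r x)"
proof (rule uniform_limit_theorem)
  let ?P = "\<lambda>N. \<Sum>n<N. cinner x (e n) *\<^sub>C e n"
  show "\<forall>\<^sub>F N in sequentially. continuous_on A (\<lambda>r. \<Sum>n<N. cinner x (e n) *\<^sub>C U r (e n))"
    by (intro always_eventually allI continuous_on_sum
        bounded_linear.continuous_on[OF scaleC.bounded_linear_right] cont)
  have P: "U r (?P N) = (\<Sum>n<N. cinner x (e n) *\<^sub>C U r (e n))" if "r \<in> A" for r N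
    using lin[OF that] by (simp add: blinfun.sum_right complex_linear_def)
  show "uniform_limit A (\<lambda>N r. \<Sum>n<N. cinner x (e n) *\<^sub>C U r (e n)) (\<lambda>r. U r x) sequentially"
  proof (rule uniform_limitI)
    fix \<epsilon> :: real assume "\<epsilon> > 0"
    moreover have "?P \<longlonglongrightarrow> x"
      using e by (simp add: hilbert_basis_def sums_def)
    ultimately have "\<forall>\<^sub>F N in sequentially. dist (?P N) x < \<epsilon>"
      by (rule tendstoD[rotated])
    then show "\<forall>\<^sub>F N in sequentially. \<forall>r\<in>A. dist (\<Sum>n<N. cinner x (e n) *\<^sub>C U r (e n)) (U r x) < \<epsilon>"
    proof (eventually_elim, intro ballI)
      fix N r assume *: "dist (?P N) x < \<epsilon>" "r \<in> A"
      then have "dist (U r (?P N)) (U r x) \<le> dist (?P N) x"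
        using norm[of r "?P N - x"] by (simp add: dist_norm blinfun.diff_right)
      with * show "dist (\<Sum>n<N. cinner x (e n) *\<^sub>C U r (e n)) (U r x) < \<epsilon>"
        by (simp add: P)
    qed
  qed
qed simp

text \<open>The orthonormal family \<open>g\<close> from Gram-Schmidt in the space of formal combinations gives an
  isometric linear map \<open>\<Psi> f = \<Sum>\<^sub>n form f (g n) e\<^sub>n\<close> into the Hilbert space. The shift is
  transported along \<open>\<Psi>\<close>, and \<open>x\<close> is embedded as \<open>\<Psi>\<close> of \<open>x\<close> placed at time \<open>0\<close>.\<close>

lemma unitary_dilation:
  fixes e :: "nat \<Rightarrow> 'h::complex_hilbert_space"
  assumes sep: "separable_space (euclidean :: 'h topology)"
    and e: "hilbert_basis e" and S: "contraction_semigroup S"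
  obtains U :: "real \<Rightarrow> 'h::complex_hilbert_space \<Rightarrow>\<^sub>L 'h" and J J'
  where "unitary_group U" "is_adjoint J J'" "J' o\<^sub>L J = id_blinfun"
    "\<And>t. t \<ge> 0 \<Longrightarrow> J' o\<^sub>L U t o\<^sub>L J = S t"
proof -
  interpret one_parameter_semigroup S using S by unfold_locales
  obtain g where g: "E.orthonormal_or_zero g" and all: "\<And>f. f \<in> E.spanned g"
    using dense_gram_schmidt[OF sep] by blast
  note p = E.spanned_parseval[OF g all]
  have o: "orthonormal_seq e" using e by (simp add: hilbert_basis_def)
  define \<Psi> where "\<Psi> f = suminf (\<lambda>n. form f (g n) *\<^sub>C e n)" for f
  note s = summable_orthonormal[OF o sums_summable[OF p]]
  have \<Psi>_add: "\<Psi> (f + f') = \<Psi> f + \<Psi> f'" for f f'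
    unfolding \<Psi>_def by (subst suminf_add[OF s s]) (simp add: form_add_left scaleC_add_left)
  have \<Psi>_scale: "\<Psi> (pscale c f) = c *\<^sub>C \<Psi> f" for c f
    unfolding \<Psi>_def using bounded_linear.suminf[OF scaleC.bounded_linear_right s, of c f]
    by (simp add: form_pscale_left scaleC_scaleC)
  have \<Psi>_norm: "(norm (\<Psi> f))\<^sup>2 = E.sqnorm f" for f
    unfolding \<Psi>_def norm_suminf_orthonormal[OF o sums_summable[OF p]] using p by (simp add: sums_iff)
  note \<Psi>_inner = E.linear_isometry_preserves[OF \<Psi>_add \<Psi>_scale \<Psi>_norm]
  have \<Psi>_0: "\<Psi> 0 = 0"
    using \<Psi>_add[of 0 0] by simp
  have \<Psi>_diff: "\<Psi> (f - f') = \<Psi> f - \<Psi> f'" for f f'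
    using \<Psi>_add[of "f - f'" f'] by simp
  have \<Psi>_sum: "\<Psi> (\<Sum>k\<in>F. h k) = (\<Sum>k\<in>F. \<Psi> (h k))" for F and h :: "'b \<Rightarrow> _"
    by (induction F rule: infinite_finite_induct) (auto simp: \<Psi>_0 \<Psi>_add)
  have \<Psi>_e: "cinner (\<Psi> f) (e n) = form f (g n)" for f n
  proof -
    have "(\<lambda>m. cinner (form f (g m) *\<^sub>C e m) (e n)) sums cinner (\<Psi> f) (e n)"
      unfolding \<Psi>_def by (intro bounded_linear.sums[OF cinner.bounded_linear_left] summable_sums s)
    moreover have "cinner (form f (g m) *\<^sub>C e m) (e n) = (if m = n then form f (g m) else 0)" for m
      using o by (simp add: cinner_scaleC_left orthonormal_seq_def)
    ultimately have "(\<lambda>m. if m = n then form f (g m) else 0) sums cinner (\<Psi> f) (e n)"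
      by simp
    then show ?thesis
      by (rule sums_unique2) (rule sums_single)
  qed
  \<comment> \<open>The range of \<open>\<Psi>\<close> is dense in the closed span of those \<open>e n\<close> with \<open>g n \<noteq> 0\<close>. On the
    orthogonal complement the group acts trivially.\<close>
  define u where "u r n = (if g n = 0 then e n else \<Psi> (shift r (g n)))" for r n
  have u: "orthonormal_seq (u r)" for r
  proof -
    have "cinner (\<Psi> f) (e n) = 0" "cinner (e n) (\<Psi> f) = 0" if "g n = 0" for n f
      using \<Psi>_e[of f n] that cinner_commute[of "e n" "\<Psi> f"] by simp_all
    then show ?thesis
      using o g by (auto simp: orthonormal_seq_def u_def \<Psi>_inner form_shift E.orthonormal_or_zero_def)
  qed
  have "\<exists>A. complex_linear A \<and> (\<forall>x. norm (A x) = norm x) \<and> (\<forall>n. A (e n) = u r n)" for r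
    using isometry_on_basis[OF e u[of r]] by metis
  then obtain U where U: "\<And>r. complex_linear (U r)" "\<And>r x. norm (U r x) = norm x" "\<And>r n. U r (e n) = u r n"
    by metis
  have shift_0: "shift r 0 = (0 :: real \<Rightarrow>\<^sub>0 'h)" for r
    by (rule shift_zero)
  have shift_diff: "shift r (f - f') = shift r f - shift r f'" for r and f f' :: "real \<Rightarrow>\<^sub>0 'h"
    by (rule poly_mapping_eqI) (simp add: lookup_minus)
  have shift_sum: "shift r (\<Sum>k\<in>F. h k) = (\<Sum>k\<in>F. shift r (h k))" for r F and h :: "'b \<Rightarrow> real \<Rightarrow>\<^sub>0 'h"
    by (induction F rule: infinite_finite_induct) (auto simp: shift_0 shift_add)
  have sqnorm_shift: "E.sqnorm (shift r f) = E.sqnorm f" for r f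
    by (simp add: E.sqnorm_def form_shift)
  have U\<Psi>: "U r (\<Psi> f) = \<Psi> (shift r f)" for r f
  proof -
    have part: "(\<Sum>n<N. form f (g n) *\<^sub>C u r n) = \<Psi> (shift r f) - \<Psi> (shift r (E.residual g N f))" for N
    proof -
      have "form f (g n) *\<^sub>C u r n = \<Psi> (shift r (pscale (form f (g n)) (g n)))" for n
        by (simp add: u_def shift_pscale \<Psi>_scale)
      then have "(\<Sum>n<N. form f (g n) *\<^sub>C u r n) = \<Psi> (shift r (\<Sum>n<N. pscale (form f (g n)) (g n)))"
        by (simp add: shift_sum \<Psi>_sum)
      also have "(\<Sum>n<N. pscale (form f (g n)) (g n)) = f - E.residual g N f"
        by (simp add: E.residual_def)
      finally show ?thesis by (simp add: shift_diff \<Psi>_diff)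
    qed
    have "(\<lambda>N. (norm (\<Psi> (shift r (E.residual g N f))))\<^sup>2) \<longlonglongrightarrow> 0"
      using all[of f] by (simp add: \<Psi>_norm sqnorm_shift E.spanned_def)
    then have "(\<lambda>N. \<Psi> (shift r (E.residual g N f))) \<longlonglongrightarrow> 0"
      by (simp add: tendsto_norm_zero_iff)
    then have "(\<lambda>N. \<Psi> (shift r f) - \<Psi> (shift r (E.residual g N f))) \<longlonglongrightarrow> \<Psi> (shift r f) - 0"
      by (intro tendsto_diff tendsto_const)
    then have "(\<lambda>n. form f (g n) *\<^sub>C u r n) sums \<Psi> (shift r f)"
      by (simp add: sums_def part)
    moreover have "(\<lambda>n. form f (g n) *\<^sub>C u r n) sums U r (\<Psi> f)"
      using complex_linear_sums[OF e U(1), of "\<Psi> f" r] by (simp add: \<Psi>_e U(3))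
    ultimately show ?thesis by (rule sums_unique2[symmetric])
  qed
  have U_add: "U (r + s) = U r o\<^sub>L U s" for r s
    by (rule complex_linear_eqI[OF e U(1) complex_linear_compose[OF U(1) U(1)]])
      (simp add: U(3) u_def U\<Psi> shift_shift)
  have \<Psi>g: "\<Psi> (g n) = e n" if "g n \<noteq> 0" for n
  proof -
    have "form (g n) (g m) *\<^sub>C e m = (if m = n then e m else 0)" for m
      using g that by (simp add: E.orthonormal_or_zero_def)
    then have "\<Psi> (g n) = suminf (\<lambda>m. if m = n then e m else 0)"
      by (simp add: \<Psi>_def)
    then show ?thesis
      using sums_single[of n e] by (simp add: sums_iff)
  qed
  have U_0: "U 0 = id_blinfun"
    by (rule complex_linear_eqI[OF e U(1)])
      (simp_all add: complex_linear_def U(3) u_def shift_zero_left \<Psi>g)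
  have adj: "is_adjoint (U t) (U (- t))" for t
    by (rule unitary_if_isometric_inverse[OF U(1,2)]) (simp flip: U_add add: U_0)
  have cont1: "continuous_on UNIV (\<lambda>r. \<Psi> (single (t + r) x))" for t x
    unfolding continuous_on_def
  proof
    fix r :: real
    have "((\<lambda>s. E.sqnorm (single s x - single (t + r) x)) \<longlongrightarrow> 0) (at (t + r))"
      by (rule sqnorm_single_tendsto)
    then have "((\<lambda>s. (norm (\<Psi> (single s x) - \<Psi> (single (t + r) x)))\<^sup>2) \<longlongrightarrow> 0) (at (t + r))"
      by (simp add: \<Psi>_norm flip: \<Psi>_diff)
    then have "((\<lambda>s. \<Psi> (single s x) - \<Psi> (single (t + r) x)) \<longlongrightarrow> 0) (at (t + r))"
      by (simp add: tendsto_norm_zero_iff)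
    then have "((\<lambda>s. \<Psi> (single s x)) \<longlongrightarrow> \<Psi> (single (t + r) x)) (at (t + r))"
      by (rule LIM_zero_cancel)
    then show "((\<lambda>s. \<Psi> (single (t + s) x)) \<longlongrightarrow> \<Psi> (single (t + r) x)) (at r within UNIV)"
      using LIM_offset[of _ _ "t + r" t] by (simp add: add.commute)
  qed
  have cont2: "continuous_on UNIV (\<lambda>r. \<Psi> (shift r f))" for f
  proof -
    have "shift r f = (\<Sum>t\<in>keys f. single (t + r) (lookup f t))" for r
    proof -
      have "shift r f = shift r (\<Sum>t\<in>keys f. single t (lookup f t))"
        by (simp flip: poly_mapping_sum_single)
      also have "\<dots> = (\<Sum>t\<in>keys f. shift r (single t (lookup f t)))"
        by (rule shift_sum)
      finally show ?thesis by (simp add: shift_single)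
    qed
    then show ?thesis
      by (simp add: \<Psi>_sum) (intro continuous_on_sum cont1)
  qed
  have cont: "continuous_on UNIV (\<lambda>r. U r x)" for x
  proof (rule strongly_continuous_if_on_basis[OF e])
    show "continuous_on UNIV (\<lambda>r. U r (e n))" for n
      by (cases "g n = 0") (simp_all add: U(3) u_def cont2)
  qed (simp_all add: U)
  have grp: "unitary_group U"
    using adj U_0 U_add cont by (auto simp: unitary_group_def)
  obtain J :: "'h \<Rightarrow>\<^sub>L 'h" where J: "\<And>x. J x = \<Psi> (single 0 x)" "complex_linear J"
  proof (rule blinfun_isometry[of "\<lambda>x. \<Psi> (single 0 x)"])
    show "\<Psi> (single 0 (x + y)) = \<Psi> (single 0 x) + \<Psi> (single 0 y)" for x y
      by (simp add: single_add \<Psi>_add)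
    have "single 0 (c *\<^sub>C x) = pscale c (single 0 x)" for c and x :: 'h
      by (rule poly_mapping_eqI) (simp add: lookup_single when_def)
    then show "\<Psi> (single 0 (c *\<^sub>C x)) = c *\<^sub>C \<Psi> (single 0 x)" for c x
      by (simp add: \<Psi>_scale)
    show "norm (\<Psi> (single 0 x)) \<le> norm x" for x
      using \<Psi>_norm[of "single 0 x"] by (simp add: sqnorm_single)
  qed blast
  have "norm (J x) = norm x" for x
    using \<Psi>_norm[of "single 0 x"] by (simp add: sqnorm_single J)
  then obtain J' where J': "is_adjoint J J'"
    using adjoint_exists[OF e J(2)] by (metis order_refl)
  have dil: "J' o\<^sub>L U t o\<^sub>L J = S t" if "t \<ge> 0" for t
  proof (rule blinfun_eqI, rule cinner_eqI)
    fix x y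
    have "cinner ((J' o\<^sub>L U t o\<^sub>L J) x) y = cinner (U t (J x)) (J y)"
      using is_adjoint_sym[OF J'] by (simp add: is_adjoint_def)
    also have "\<dots> = form (single t x) (single 0 y)"
      by (simp add: J U\<Psi> \<Psi>_inner shift_single)
    also have "\<dots> = cinner (S t x) y"
      using that by (simp add: form_single ker_def)
    finally show "cinner ((J' o\<^sub>L U t o\<^sub>L J) x) y = cinner (S t x) y" .
  qed
  moreover have "J' o\<^sub>L J = id_blinfun"
  proof (rule blinfun_eqI)
    show "(J' o\<^sub>L J) x = id_blinfun x" for x
      using arg_cong[OF dil[of 0], of "\<lambda>A. blinfun_apply A x"] by (simp add: U_0 S_0)
  qed
  ultimately show ?thesis
    using that grp J' by blast
qed

section \<open>Joint dilation of several semigroups\<close>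

lemma is_adjoint_id: "is_adjoint id_blinfun id_blinfun"
  by (simp add: is_adjoint_def)

lemma is_adjoint_add: "is_adjoint A A' \<Longrightarrow> is_adjoint B B' \<Longrightarrow> is_adjoint (A + B) (A' + B')"
  by (simp add: is_adjoint_def blinfun.add_left cinner_add_left cinner_add_right)

lemma is_adjoint_diff: "is_adjoint A A' \<Longrightarrow> is_adjoint B B' \<Longrightarrow> is_adjoint (A - B) (A' - B')"
  by (simp add: is_adjoint_def blinfun.diff_left cinner.diff_left cinner.diff_right)

definition word_op :: "('i \<Rightarrow> real \<Rightarrow> 'h::complex_hilbert_space \<Rightarrow>\<^sub>L 'h) \<Rightarrow> ('i \<times> real) list \<Rightarrow> 'h \<Rightarrow>\<^sub>L 'h" where
  "word_op U w = foldr (\<lambda>(i, t) A. U i t o\<^sub>L A) w id_blinfun"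

text \<open>A bijection between \<open>\<nat>\<close> and \<open>\<nat> \<times> \<nat>\<close> decomposes the space into countably many mutually
  orthogonal copies \<open>C k H\<close> of itself.\<close>

lemma orthogonal_isometries:
  fixes e :: "nat \<Rightarrow> 'h::complex_hilbert_space"
  assumes e: "hilbert_basis e"
  obtains C C' :: "nat \<Rightarrow> 'h::complex_hilbert_space \<Rightarrow>\<^sub>L 'h"
  where "\<And>k. is_adjoint (C k) (C' k)" "\<And>k l x. C' k (C l x) = (if k = l then x else 0)"
    "\<And>k n. C k (e n) = e (prod_encode (k, n))" "\<And>k x. norm (C k x) = norm x"
proof -
  have o: "orthonormal_seq e"
    using e by (simp add: hilbert_basis_def)
  then have "orthonormal_seq (\<lambda>n. e (prod_encode (k, n)))" for k
    by (auto simp: orthonormal_seq_def prod_encode_eq)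
  then have "\<exists>A. complex_linear A \<and> (\<forall>x. norm (A x) = norm x) \<and> (\<forall>n. A (e n) = e (prod_encode (k, n)))" for k
    using isometry_on_basis[OF e] by metis
  then obtain C where C: "\<And>k. complex_linear (C k)" "\<And>k x. norm (C k x) = norm x"
      "\<And>k n. C k (e n) = e (prod_encode (k, n))"
    by metis
  have "\<exists>B. is_adjoint (C k) B" for k
    using adjoint_exists[OF e C(1)[of k]] C(2) by (metis order_refl)
  then obtain C' where C': "\<And>k. is_adjoint (C k) (C' k)"
    by metis
  have lin': "complex_linear (C' k)" for k
    by (rule is_adjoint_complex_linear[OF is_adjoint_sym[OF C']])
  have inner: "cinner (C' k (C l (e m))) (e n) = (if k = l \<and> m = n then 1 else 0)" for k l m n
    using is_adjoint_sym[OF C'[of k]] o by (simp add: is_adjoint_def C(3) orthonormal_seq_def)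
  have basis: "C' k (C l (e m)) = (if k = l then e m else 0)" for k l m
  proof -
    have "(\<lambda>n. cinner (C' k (C l (e m))) (e n) *\<^sub>C e n) sums C' k (C l (e m))"
      using e by (simp add: hilbert_basis_def)
    moreover have "(\<lambda>n. cinner (C' k (C l (e m))) (e n) *\<^sub>C e n) = (\<lambda>n. if n = m then if k = l then e n else 0 else 0)"
      by (auto simp: inner)
    ultimately show ?thesis
      using sums_unique2[OF _ sums_single[of m "\<lambda>n. if k = l then e n else 0"]] by simp
  qed
  have "C' k o\<^sub>L C l = (if k = l then id_blinfun else 0)" for k l
    by (rule complex_linear_eqI[OF e complex_linear_compose[OF lin' C(1)]])
      (auto simp: complex_linear_def basis)
  then have "C' k (C l x) = (if k = l then x else 0)" for k l x
    using blinfun_apply_blinfun_compose[of "C' k" "C l" x] by (simp split: if_splits)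
  then show ?thesis by (rule that[OF C' _ C(3,2)])
qed

text \<open>Let \<open>U\<^sub>i\<close> be a dilation of \<open>S\<^sub>i\<close> with embedding \<open>J\<^sub>i\<close>. The isometry \<open>L\<^sub>i\<close> places the \<open>i\<close>-th
  dilation space into \<open>H\<close> such that \<open>J\<^sub>i H\<close> goes to \<open>C\<^sub>0 H\<close>, in the same way for all \<open>i\<close>, and the
  complement of \<open>J\<^sub>i H\<close> goes to a copy \<open>C\<^sub>k H\<close> reserved for \<open>i\<close>. The group \<open>V\<^sub>i\<close> acts as \<open>U\<^sub>i\<close> on
  \<open>L\<^sub>i H\<close> and trivially on its complement.

  A vector \<open>y\<close> of the \<open>i\<close>-th dilation space lies in \<open>\<G> i\<close> if compression intertwines \<open>U\<^sub>i(t)\<close>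
  with \<open>S\<^sub>i(t)\<close> on \<open>y\<close> for all \<open>t \<ge> 0\<close>; in particular \<open>J\<^sub>i H \<subseteq> \<G> i\<close>. The vectors \<open>z\<close> all of whose
  components \<open>L\<^sub>i\<^sup>* z\<close> lie in \<open>\<G> i\<close> include \<open>C\<^sub>0 H\<close>, and every \<open>V\<^sub>j(t)\<close> with \<open>t \<ge> 0\<close> preserves them:
  for \<open>i \<noteq> j\<close> the \<open>i\<close>-th component changes by an element of \<open>J\<^sub>i H\<close> only, as the reserved copies are
  orthogonal. On such vectors the compression to \<open>C\<^sub>0 H\<close> intertwines \<open>V\<^sub>j(t)\<close> with \<open>S\<^sub>j(t)\<close>, which gives
  the claim by induction on the word.\<close>

lemma joint_dilation:
  fixes e :: "nat \<Rightarrow> 'h::complex_hilbert_space" and S :: "'i \<Rightarrow> real \<Rightarrow> 'h::complex_hilbert_space \<Rightarrow>\<^sub>L 'h"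
  assumes sep: "separable_space (euclidean :: 'h topology)" and e: "hilbert_basis e"
    and I: "countable I" and S: "\<And>i. i \<in> I \<Longrightarrow> contraction_semigroup (S i)"
  obtains V :: "'i \<Rightarrow> real \<Rightarrow> 'h::complex_hilbert_space \<Rightarrow>\<^sub>L 'h" and C C' and \<phi> :: "nat \<Rightarrow> nat"
  where "\<And>i. i \<in> I \<Longrightarrow> unitary_group (V i)" "is_adjoint C C'" "\<And>x. norm (C x) = norm x"
    "inj \<phi>" "\<And>n. C (e n) = e (\<phi> n)"
    "\<And>w x. set w \<subseteq> I \<times> {0..} \<Longrightarrow> C' (word_op V w (C x)) = word_op S w x"
proof -
  have "\<exists>U J J'. unitary_group U \<and> is_adjoint J J' \<and> J' o\<^sub>L J = id_blinfun \<and> (\<forall>t\<ge>0. J' o\<^sub>L U t o\<^sub>L J = S i t)" if "i \<in> I" for i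
    by (rule unitary_dilation[OF sep e S[OF that]]) blast
  then obtain U J J' where U: "\<And>i. i \<in> I \<Longrightarrow> unitary_group (U i)" and J: "\<And>i. i \<in> I \<Longrightarrow> is_adjoint (J i) (J' i)"
    and JJ: "\<And>i. i \<in> I \<Longrightarrow> J' i o\<^sub>L J i = id_blinfun"
    and dil: "\<And>i t. i \<in> I \<Longrightarrow> t \<ge> 0 \<Longrightarrow> J' i o\<^sub>L U i t o\<^sub>L J i = S i t"
    by metis
  have J'J: "J' i (J i x) = x" if "i \<in> I" for i x
    using arg_cong[OF JJ[OF that], of "\<lambda>A. blinfun_apply A x"] by simp
  have J'UJ: "J' i (U i t (J i x)) = S i t x" if "i \<in> I" "t \<ge> 0" for i t x
    using arg_cong[OF dil[OF that], of "\<lambda>A. blinfun_apply A x"] by simp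
  obtain C C' :: "nat \<Rightarrow> 'h \<Rightarrow>\<^sub>L 'h" where C: "\<And>k. is_adjoint (C k) (C' k)"
    "\<And>k l x. C' k (C l x) = (if k = l then x else 0)" "\<And>k n. C k (e n) = e (prod_encode (k, n))"
    "\<And>k x. norm (C k x) = norm x"
    using orthogonal_isometries[OF e] by blast
  \<comment> \<open>The copy with index \<open>0\<close> is the common one.\<close>
  define k where "k i = Suc (to_nat_on I i)" for i
  have k: "k i \<noteq> 0" "i \<in> I \<Longrightarrow> j \<in> I \<Longrightarrow> k i = k j \<longleftrightarrow> i = j" for i j
    using inj_on_to_nat_on[OF I] by (auto simp: k_def inj_on_def)
  \<comment> \<open>\<open>P i\<close> projects onto the orthogonal complement of \<open>J i H\<close>, and \<open>L' i\<close> is the adjoint of \<open>L i\<close>.\<close>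
  define P where "P i = id_blinfun - (J i o\<^sub>L J' i)" for i
  define L where "L i = (C 0 o\<^sub>L J' i) + (C (k i) o\<^sub>L P i)" for i
  define L' where "L' i = (J i o\<^sub>L C' 0) + (P i o\<^sub>L C' (k i))" for i
  define V where "V i t = id_blinfun + (L i o\<^sub>L (U i t - id_blinfun) o\<^sub>L L' i)" for i t
  have P_apply: "P i y = y - J i (J' i y)" for i y
    by (simp add: P_def blinfun.diff_left)
  have L_apply: "L i y = C 0 (J' i y) + C (k i) (P i y)"
    and L'_apply: "L' i z = J i (C' 0 z) + P i (C' (k i) z)" for i y z
    by (simp_all add: L_def L'_def blinfun.add_left)
  have V_apply: "V i t z = z + L i (U i t (L' i z) - L' i z)" for i t z
    by (simp add: V_def blinfun.add_left blinfun.diff_left)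
  have L_adj: "is_adjoint (L i) (L' i)" if i: "i \<in> I" for i
  proof -
    have "is_adjoint (P i) (P i)"
      unfolding P_def by (intro is_adjoint_diff is_adjoint_id is_adjoint_compose J[OF i] is_adjoint_sym[OF J[OF i]])
    then show ?thesis
      unfolding L_def L'_def
      by (intro is_adjoint_add is_adjoint_compose C(1) is_adjoint_sym[OF J[OF i]])
  qed
  have L'L: "L' i (L i y) = y" if "i \<in> I" for i y
    using k(1)[of i] by (simp add: L_apply L'_apply blinfun.add_right C(2) P_apply blinfun.diff_right J'J[OF that])
  have L'L_cross: "L' i (L j y) = J i (J' j y)" if "i \<in> I" "j \<in> I" "i \<noteq> j" for i j y
    using k(1)[of i] k(1)[of j] k(2)[OF that(1,2)] that
    by (simp add: L_apply L'_apply blinfun.add_right C(2) P_apply blinfun.diff_right)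
  have J'L': "J' i (L' i z) = C' 0 z" if "i \<in> I" for i z
    by (simp add: L'_apply P_apply blinfun.add_right blinfun.diff_right J'J[OF that])
  have C'L: "C' 0 (L i y) = J' i y" for i y
    using k(1)[of i] by (simp add: L_apply blinfun.add_right C(2))
  have L'C: "L' i (C 0 x) = J i x" for i x
    using k(1)[of i] by (simp add: L'_apply C(2))
  have L'V: "L' i (V i t z) = U i t (L' i z)" if "i \<in> I" for i t z
    by (simp add: V_apply blinfun.add_right L'L[OF that])
  have U_add: "U i (s + t) y = U i s (U i t y)" and U_0: "U i 0 = id_blinfun"
    and U_adj: "is_adjoint (U i t) (U i (- t))"
    and U_cont: "continuous_on UNIV (\<lambda>t. U i t y)" if "i \<in> I" for i s t y
    using U[OF that] by (auto simp: unitary_group_def)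
  have V: "unitary_group (V i)" if i: "i \<in> I" for i
    unfolding unitary_group_def
  proof (intro conjI allI)
    fix s t :: real and x :: 'h
    have "is_adjoint (L i o\<^sub>L (U i t - id_blinfun) o\<^sub>L L' i) (L i o\<^sub>L ((U i (- t) - id_blinfun) o\<^sub>L L' i))"
      by (intro is_adjoint_compose is_adjoint_diff is_adjoint_id U_adj L_adj i is_adjoint_sym[OF L_adj[OF i]])
    then show "is_adjoint (V i t) (V i (- t))"
      by (simp add: is_adjoint_def V_def blinfun.add_left cinner_add_left cinner_add_right)
    show "V i 0 = id_blinfun"
      by (rule blinfun_eqI) (simp add: V_apply U_0[OF i])
    show "V i (s + t) = V i s o\<^sub>L V i t"
    proof (rule blinfun_eqI)
      fix z
      have "V i s (V i t z) = V i t z + L i (U i s (U i t (L' i z)) - U i t (L' i z))"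
        by (simp add: V_apply[of i s] L'V[OF i])
      then show "V i (s + t) z = (V i s o\<^sub>L V i t) z"
        by (simp add: V_apply U_add[OF i] blinfun.diff_right)
    qed
    show "continuous_on UNIV (\<lambda>t. V i t x)"
      unfolding V_apply
      by (intro continuous_intros bounded_linear.continuous_on[OF blinfun.bounded_linear_right] U_cont i)
  qed
  define \<G> where "\<G> i = {y. \<forall>t\<ge>0. J' i (U i t y) = S i t (J' i y)}" for i
  have \<G>_add: "y + z \<in> \<G> i" if "y \<in> \<G> i" "z \<in> \<G> i" for y z i
    using that by (simp add: \<G>_def blinfun.add_right)
  have \<G>_J: "J i x \<in> \<G> i" if "i \<in> I" for i x
    using that by (simp add: \<G>_def J'UJ J'J)
  have \<G>_U: "U i s y \<in> \<G> i" if i: "i \<in> I" and "s \<ge> 0" "y \<in> \<G> i" for i s y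
    unfolding \<G>_def
  proof (intro CollectI allI impI)
    fix t :: real assume t: "t \<ge> 0"
    have "S i (t + s) = S i t o\<^sub>L S i s"
      using S[OF i] t that(2) by (simp add: contraction_semigroup_def)
    moreover have "J' i (U i (t + s) y) = S i (t + s) (J' i y)" "J' i (U i s y) = S i s (J' i y)"
      using that t by (simp_all add: \<G>_def)
    ultimately show "J' i (U i t (U i s y)) = S i t (J' i (U i s y))"
      using U_add[OF i, of t s y] by simp
  qed
  have step: "C' 0 (V i t z) = S i t (C' 0 z)" if "i \<in> I" "t \<ge> 0" "L' i z \<in> \<G> i" for i t z
    using that by (simp add: V_apply blinfun.add_right C'L blinfun.diff_right J'L' \<G>_def)
  have main: "(\<forall>i\<in>I. L' i (word_op V w (C 0 x)) \<in> \<G> i) \<and> C' 0 (word_op V w (C 0 x)) = word_op S w x"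
    if "set w \<subseteq> I \<times> {0..}" for w x
    using that
  proof (induction w)
    case Nil
    then show ?case by (simp add: word_op_def L'C \<G>_J C(2))
  next
    case (Cons p w)
    obtain j t where p: "p = (j, t)" "j \<in> I" "t \<ge> 0"
      using Cons.prems by (cases p) auto
    define z where "z = word_op V w (C 0 x)"
    have IH: "\<And>i. i \<in> I \<Longrightarrow> L' i z \<in> \<G> i" "C' 0 z = word_op S w x"
      using Cons by (auto simp: z_def)
    have z': "word_op V (p # w) (C 0 x) = V j t z" "word_op S (p # w) x = S j t (word_op S w x)"
      by (simp_all add: word_op_def z_def p(1))
    have "L' i (V j t z) \<in> \<G> i" if i: "i \<in> I" for i
    proof (cases "i = j")
      case True
      then show ?thesis using p i IH(1) by (simp add: L'V \<G>_U)
    next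
      case False
      then have "L' i (V j t z) = L' i z + J i (J' j (U j t (L' j z) - L' j z))"
        using i p(2) by (simp add: V_apply blinfun.add_right L'L_cross)
      then show ?thesis
        using \<G>_add[OF IH(1)[OF i] \<G>_J[OF i]] by simp
    qed
    then show ?case
      using step[OF p(2,3) IH(1)[OF p(2)]] by (simp add: z' IH(2))
  qed
  show ?thesis
  proof (rule that[of V "C 0" "C' 0" "\<lambda>n. prod_encode (0, n)"])
    show "inj (\<lambda>n. prod_encode (0, n))"
      by (simp add: inj_on_def prod_encode_eq)
  qed (use V C main in auto)
qed

section \<open>Unitaries close to an isometry\<close>

text \<open>In the step, the transposition of \<open>\<pi> N\<close> and \<open>\<phi> N\<close> leaves the earlier values alone: they avoid
  both points by injectivity.\<close>

lemma injection_agrees_with_bijection: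
  assumes "inj (\<phi> :: nat \<Rightarrow> nat)"
  shows "\<exists>\<pi>. bij \<pi> \<and> (\<forall>n<N. \<pi> n = \<phi> n)"
proof (induction N)
  case 0
  then show ?case by (intro exI[of _ id]) (simp add: bij_id del: id_apply)
next
  case (Suc N)
  then obtain \<pi> where \<pi>: "bij \<pi>" "\<And>n. n < N \<Longrightarrow> \<pi> n = \<phi> n" by blast
  let ?\<pi> = "Transposition.transpose (\<pi> N) (\<phi> N) \<circ> \<pi>"
  have "?\<pi> n = \<phi> n" if "n < Suc N" for n
  proof (cases "n = N")
    case False
    then have "n < N" using that by simp
    moreover from this have "\<pi> n \<noteq> \<pi> N" "\<phi> n \<noteq> \<phi> N"
      using \<pi>(1) assms by (auto simp: bij_def inj_eq)
    ultimately show ?thesis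
      using \<pi>(2) by (simp add: Transposition.transpose_def)
  qed simp
  moreover have "bij ?\<pi>"
    using \<pi>(1) by (intro bij_comp) auto
  ultimately show ?case by blast
qed

text \<open>The error on the \<open>N\<close>-th partial sum of the basis expansion is zero, and both operators are
  contractions on the rest.\<close>

lemma isometry_approximation:
  fixes C :: "'h::complex_hilbert_space \<Rightarrow>\<^sub>L 'h"
  assumes e: "hilbert_basis e" and lin: "complex_linear C" "\<And>N. complex_linear (W N)"
    and norm: "\<And>x. norm (C x) \<le> norm x" "\<And>N x. norm (W N x) \<le> norm x"
    and agree: "\<And>N n. n < N \<Longrightarrow> W N (e n) = C (e n)"
  shows "(\<lambda>N. W N x) \<longlonglongrightarrow> C x"
proof -
  define p where "p N = (\<Sum>n<N. cinner x (e n) *\<^sub>C e n)" for N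
  have "p \<longlonglongrightarrow> x"
    using e by (simp add: hilbert_basis_def sums_def p_def[abs_def])
  then have lim: "(\<lambda>N. 2 * norm (x - p N)) \<longlonglongrightarrow> 2 * norm (x - x)"
    by (intro tendsto_mult_left tendsto_norm tendsto_diff tendsto_const)
  have bound: "norm (W N x - C x) \<le> 2 * norm (x - p N)" for N
  proof -
    have "W N (p N) = C (p N)"
      using lin agree by (simp add: p_def blinfun.sum_right complex_linear_def)
    then have "W N x - C x = W N (x - p N) - C (x - p N)"
      by (simp add: blinfun.diff_right)
    then show ?thesis
      using norm_triangle_ineq4[of "W N (x - p N)" "C (x - p N)"] norm(1)[of "x - p N"] norm(2)[of N "x - p N"]
      by simp
  qed
  have "(\<lambda>N. W N x - C x) \<longlonglongrightarrow> 0"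
    by (rule Lim_null_comparison[OF always_eventually[OF allI[OF bound]]]) (use lim in simp)
  then show ?thesis by (rule LIM_zero_cancel)
qed

lemma unitary_permutation:
  fixes e :: "nat \<Rightarrow> 'h::complex_hilbert_space"
  assumes e: "hilbert_basis e" and \<pi>: "bij \<pi>"
  obtains W W' :: "'h::complex_hilbert_space \<Rightarrow>\<^sub>L 'h"
  where "is_adjoint W W'" "W' o\<^sub>L W = id_blinfun" "W o\<^sub>L W' = id_blinfun"
    "\<And>x. norm (W x) = norm x" "\<And>n. W (e n) = e (\<pi> n)"
proof -
  have o: "orthonormal_seq (e \<circ> \<rho>)" if "inj \<rho>" for \<rho>
    using e that by (auto simp: hilbert_basis_def orthonormal_seq_def inj_eq)
  obtain W where W: "complex_linear W" "\<And>x. norm (W x) = norm x" "\<And>n. W (e n) = (e \<circ> \<pi>) n"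
    using isometry_on_basis[OF e o[OF bij_is_inj[OF \<pi>]]] by metis
  obtain W' where W': "complex_linear W'" "\<And>x. norm (W' x) = norm x" "\<And>n. W' (e n) = (e \<circ> inv_into UNIV \<pi>) n"
    using isometry_on_basis[OF e o[OF bij_is_inj[OF bij_imp_bij_inv[OF \<pi>]]]] by metis
  have WW': "W o\<^sub>L W' = id_blinfun"
    by (rule complex_linear_eqI[OF e complex_linear_compose[OF W(1) W'(1)]])
      (simp_all add: complex_linear_def W W' surj_f_inv_f[OF bij_is_surj[OF \<pi>]])
  show ?thesis
    using that[of W W'] unitary_if_isometric_inverse(1,2)[OF W(1,2) WW'] WW' W by simp
qed

section \<open>The unitary group\<close>

lemma unitary_norm: "unitary U \<Longrightarrow> norm (U x) = norm x"
proof -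
  assume "unitary U"
  then obtain V where V: "is_adjoint U V" "V o\<^sub>L U = id_blinfun" by (auto simp: unitary_def)
  have "V (U x) = x"
    using arg_cong[OF V(2), of "\<lambda>A. blinfun_apply A x"] by simp
  then have "cinner (U x) (U x) = cinner x x"
    using V(1) by (simp add: is_adjoint_def)
  then have "(norm (U x))\<^sup>2 = (norm x)\<^sup>2"
    unfolding cinner_self using of_real_eq_iff by blast
  then show ?thesis by simp
qed

lemma unitary_contraction: "unitary U \<Longrightarrow> contraction U"
proof -
  assume U: "unitary U"
  then have "norm U \<le> 1"
    by (intro norm_blinfun_bound) (simp_all add: unitary_norm)
  moreover obtain V where "is_adjoint U V"
    using U by (auto simp: unitary_def)
  ultimately show ?thesis
    by (simp add: contraction_def is_adjoint_scaleC)
qed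

lemma contraction_norm: "contraction A \<Longrightarrow> norm (A x) \<le> norm x"
  using norm_blinfun[of A x] mult_right_mono[of "norm A" 1 "norm x"] by (force simp: contraction_def)

lemma contraction_linear: "contraction A \<Longrightarrow> complex_linear A"
  by (simp add: contraction_def complex_linear_def)

lemma unitary_id: "unitary id_blinfun"
  unfolding unitary_def by (intro exI[of _ id_blinfun]) (auto simp: is_adjoint_id intro: blinfun_eqI)

lemma unitary_compose:
  assumes "unitary U" "unitary V" shows "unitary (U o\<^sub>L V)"
proof -
  obtain U' V' where U: "is_adjoint U U'" "U' o\<^sub>L U = id_blinfun" "U o\<^sub>L U' = id_blinfun"
    and V: "is_adjoint V V'" "V' o\<^sub>L V = id_blinfun" "V o\<^sub>L V' = id_blinfun"
    using assms by (auto simp: unitary_def)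
  note inverses = U(2,3)[THEN arg_cong[where f = blinfun_apply], THEN fun_cong]
    V(2,3)[THEN arg_cong[where f = blinfun_apply], THEN fun_cong]
  have "(V' o\<^sub>L U') o\<^sub>L (U o\<^sub>L V) = id_blinfun" "(U o\<^sub>L V) o\<^sub>L (V' o\<^sub>L U') = id_blinfun"
    using inverses by (auto intro!: blinfun_eqI)
  then show ?thesis
    using is_adjoint_compose[OF U(1) V(1)] by (auto simp: unitary_def)
qed

lemma unitary_group_unitary: "unitary_group U \<Longrightarrow> unitary (U t)"
  unfolding unitary_group_def unitary_def
  by (intro exI[of _ "U (- t)"]) (metis add.right_inverse add.left_inverse)

text \<open>\<open>A\<close> is isometric since \<open>B A\<close> is and neither factor enlarges norms; \<open>A\<close> is surjective since \<open>A B\<close> is.\<close>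

lemma unitary_factor:
  assumes "contraction A" "contraction B" "A o\<^sub>L B = U" "B o\<^sub>L A = U" "unitary U"
  shows "unitary A"
proof -
  obtain V where "U o\<^sub>L V = id_blinfun" using assms(5) by (auto simp: unitary_def)
  then have inverse: "A o\<^sub>L (B o\<^sub>L V) = id_blinfun"
    unfolding assms(3)[symmetric] by (metis blinfun_apply_blinfun_compose blinfun_eqI)
  have "norm (A x) = norm x" for x
  proof (rule antisym)
    have "norm x = norm (B (A x))"
      using unitary_norm[OF assms(5), of x] by (simp flip: assms(4))
    also have "\<dots> \<le> norm (A x)" using assms(2) by (rule contraction_norm)
    finally show "norm x \<le> norm (A x)" .
  qed (rule contraction_norm[OF assms(1)])
  then show ?thesis
    by (rule unitary_if_isometric_inverse(3)[OF contraction_linear[OF assms(1)] _ inverse])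
qed

definition unitary_operators :: "('h::complex_hilbert_space \<Rightarrow>\<^sub>L 'h) monoid" where
  "unitary_operators = \<lparr>carrier = {U. unitary U}, monoid.mult = (o\<^sub>L), one = id_blinfun\<rparr>"

definition unitary_topology :: "('h::complex_hilbert_space \<Rightarrow>\<^sub>L 'h) topology" where
  "unitary_topology = subtopology strong_operator_topology {U. unitary U}"

lemma unitary_operators_simps [simp]:
  "carrier unitary_operators = {U. unitary U}" "U \<otimes>\<^bsub>unitary_operators\<^esub> V = U o\<^sub>L V"
  "\<one>\<^bsub>unitary_operators\<^esub> = id_blinfun"
  by (simp_all add: unitary_operators_def)

lemma group_unitary_operators: "group (unitary_operators :: ('h::complex_hilbert_space \<Rightarrow>\<^sub>L 'h) monoid)"
proof (rule groupI)
  fix U :: "'h \<Rightarrow>\<^sub>L 'h" assume "U \<in> carrier unitary_operators"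
  then obtain V where V: "is_adjoint U V" "V o\<^sub>L U = id_blinfun" "U o\<^sub>L V = id_blinfun"
    by (auto simp: unitary_def)
  then have "unitary V"
    using is_adjoint_sym[OF V(1)] unfolding unitary_def by blast
  then show "\<exists>V\<in>carrier unitary_operators. V \<otimes>\<^bsub>unitary_operators\<^esub> U = \<one>\<^bsub>unitary_operators\<^esub>"
    using V by (intro bexI[of _ V]) simp_all
qed (auto simp: unitary_id unitary_compose intro: blinfun_eqI)

lemma topspace_unitary_topology [simp]: "topspace unitary_topology = {U. unitary U}"
  by (simp add: unitary_topology_def strong_operator_topology_topspace)

lemma continuous_map_unitary_topology:
  "continuous_map X unitary_topology f \<longleftrightarrow>
     (\<forall>p\<in>topspace X. unitary (f p)) \<and> (\<forall>x. continuous_map X euclidean (\<lambda>p. f p x))"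
  by (auto simp: unitary_topology_def continuous_map_in_subtopology
      continuous_on_strong_operator_topo_iff_coordinatewise)

lemma continuous_map_evaluation: "continuous_map unitary_topology euclidean (\<lambda>U. blinfun_apply U x)"
  unfolding unitary_topology_def
  by (rule continuous_map_from_subtopology[OF strong_operator_topology_continuous_evaluation])

lemma eventually_atin_topspace: "\<forall>\<^sub>F p in atin X a. p \<in> topspace X"
  by (metis eventually_atin DiffD1 openin_topspace)

text \<open>For the strong operator topology, multiplication is jointly continuous because
  \<open>\<parallel>U V x - U\<^sub>0 V\<^sub>0 x\<parallel> \<le> \<parallel>V x - V\<^sub>0 x\<parallel> + \<parallel>U y - U\<^sub>0 y\<parallel>\<close> with \<open>y = V\<^sub>0 x\<close>, and inversion is
  continuous because \<open>\<parallel>V\<^sup>-\<^sup>1 x - y\<parallel> = \<parallel>U y - V y\<parallel>\<close> with \<open>y = U\<^sup>-\<^sup>1 x\<close>.\<close>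

lemma topological_group_unitary_operators:
  "topological_group (unitary_operators :: ('h::complex_hilbert_space \<Rightarrow>\<^sub>L 'h) monoid) unitary_topology"
proof -
  let ?\<tau> = "unitary_topology :: ('h \<Rightarrow>\<^sub>L 'h) topology"
  interpret group "unitary_operators :: ('h \<Rightarrow>\<^sub>L 'h) monoid"
    by (rule group_unitary_operators)
  have "continuous_map (prod_topology ?\<tau> ?\<tau>) ?\<tau> (\<lambda>(U, V). U o\<^sub>L V)"
    unfolding continuous_map_unitary_topology
  proof (intro conjI ballI allI)
    fix x :: 'h
    let ?X = "prod_topology ?\<tau> ?\<tau>"
    have "continuous_map ?X euclidean (\<lambda>p. blinfun_apply (fst p) (blinfun_apply (snd p) x))"
      unfolding continuous_map_atin limitin_canonical_iff
    proof
      fix p assume p: "p \<in> topspace ?X"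
      define y where "y = blinfun_apply (snd p) x"
      have "continuous_map ?X euclidean (\<lambda>p. blinfun_apply (snd p) x)"
        "continuous_map ?X euclidean (\<lambda>p. blinfun_apply (fst p) y)"
        using continuous_map_compose[OF continuous_map_snd continuous_map_evaluation[of x], of ?\<tau>]
          continuous_map_compose[OF continuous_map_fst continuous_map_evaluation[of y], of ?\<tau>]
        by (simp_all add: o_def)
      then have lim: "((\<lambda>p. blinfun_apply (snd p) x) \<longlongrightarrow> y) (atin ?X p)"
        "((\<lambda>p. blinfun_apply (fst p) y) \<longlongrightarrow> blinfun_apply (fst p) y) (atin ?X p)"
        using p by (auto simp: continuous_map_atin y_def)
      let ?b = "\<lambda>q. norm (blinfun_apply (snd q) x - y)
        + norm (blinfun_apply (fst q) y - blinfun_apply (fst p) y)"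
      have "(?b \<longlongrightarrow> norm (y - y) + norm (blinfun_apply (fst p) y - blinfun_apply (fst p) y)) (atin ?X p)"
        by (intro tendsto_add tendsto_norm tendsto_diff tendsto_const lim)
      then have lim0: "(?b \<longlongrightarrow> 0) (atin ?X p)"
        by simp
      have "\<forall>\<^sub>F q in atin ?X p.
          norm (blinfun_apply (fst q) (blinfun_apply (snd q) x) - blinfun_apply (fst p) y) \<le> ?b q"
        using eventually_atin_topspace[of ?X p]
      proof eventually_elim
        case (elim q)
        then have "norm (blinfun_apply (fst q) (blinfun_apply (snd q) x - y)) = norm (blinfun_apply (snd q) x - y)"
          by (intro unitary_norm) (auto simp: topspace_prod_topology)
        then show ?case
          using norm_triangle_ineq[of "blinfun_apply (fst q) (blinfun_apply (snd q) x - y)"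
              "blinfun_apply (fst q) y - blinfun_apply (fst p) y"]
          by (simp add: blinfun.diff_right)
      qed
      then have "((\<lambda>q. blinfun_apply (fst q) (blinfun_apply (snd q) x) - blinfun_apply (fst p) y) \<longlongrightarrow> 0) (atin ?X p)"
        by (rule Lim_null_comparison[OF _ lim0])
      then show "((\<lambda>q. blinfun_apply (fst q) (blinfun_apply (snd q) x))
          \<longlongrightarrow> blinfun_apply (fst p) (blinfun_apply (snd p) x)) (atin ?X p)"
        unfolding y_def by (rule LIM_zero_cancel)
    qed
    then show "continuous_map ?X euclidean (\<lambda>p. (case p of (U, V) \<Rightarrow> U o\<^sub>L V) x)"
      by (simp add: case_prod_unfold)
  qed (auto simp: topspace_prod_topology unitary_compose)
  moreover have "continuous_map ?\<tau> ?\<tau> (\<lambda>U. inv\<^bsub>unitary_operators\<^esub> U)"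
    unfolding continuous_map_unitary_topology
  proof (intro conjI ballI allI)
    have inv: "unitary (inv\<^bsub>unitary_operators\<^esub> U)" if "unitary U" for U :: "'h \<Rightarrow>\<^sub>L 'h"
      using inv_closed[of U] that by simp
    then show "unitary (inv\<^bsub>unitary_operators\<^esub> U)" if "U \<in> topspace ?\<tau>" for U
      using that by simp
    fix x :: 'h
    show "continuous_map ?\<tau> euclidean (\<lambda>U. (inv\<^bsub>unitary_operators\<^esub> U) x)"
      unfolding continuous_map_atin limitin_canonical_iff
    proof
      fix U assume U: "U \<in> topspace ?\<tau>"
      define y where "y = (inv\<^bsub>unitary_operators\<^esub> U) x"
      have inv1: "V ((inv\<^bsub>unitary_operators\<^esub> V) x) = x" and inv2: "(inv\<^bsub>unitary_operators\<^esub> V) (V y) = y"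
        if "unitary V" for V
        using r_inv[of V] l_inv[of V] that
        by (simp_all, metis blinfun_apply_blinfun_compose blinfun_apply_id_blinfun id_apply,
            metis blinfun_apply_blinfun_compose blinfun_apply_id_blinfun id_apply)
      have "((\<lambda>V. blinfun_apply V y) \<longlongrightarrow> blinfun_apply U y) (atin ?\<tau> U)"
        using continuous_map_evaluation[of y] U by (auto simp: continuous_map_atin)
      then have "((\<lambda>V. norm (blinfun_apply U y - blinfun_apply V y)) \<longlongrightarrow> norm (blinfun_apply U y - blinfun_apply U y)) (atin ?\<tau> U)"
        by (intro tendsto_norm tendsto_diff tendsto_const)
      then have lim0: "((\<lambda>V. norm (blinfun_apply U y - blinfun_apply V y)) \<longlongrightarrow> 0) (atin ?\<tau> U)"
        by simp
      have "\<forall>\<^sub>F V in atin ?\<tau> U. norm ((inv\<^bsub>unitary_operators\<^esub> V) x - y) \<le> norm (blinfun_apply U y - blinfun_apply V y)"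
        using eventually_atin_topspace[of ?\<tau> U]
      proof eventually_elim
        case (elim V)
        then have V: "unitary V" by simp
        have "(inv\<^bsub>unitary_operators\<^esub> V) x - y = (inv\<^bsub>unitary_operators\<^esub> V) (U y - V y)"
          using inv1[of U] U inv2[OF V] by (simp add: blinfun.diff_right y_def)
        then show ?case
          using unitary_norm[OF inv[OF V], of "U y - V y"] by simp
      qed
      then have "((\<lambda>V. (inv\<^bsub>unitary_operators\<^esub> V) x - y) \<longlongrightarrow> 0) (atin ?\<tau> U)"
        by (rule Lim_null_comparison[OF _ lim0])
      then show "((\<lambda>V. (inv\<^bsub>unitary_operators\<^esub> V) x) \<longlongrightarrow> (inv\<^bsub>unitary_operators\<^esub> U) x) (atin ?\<tau> U)"
        unfolding y_def by (rule LIM_zero_cancel)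
    qed
  qed
  ultimately show ?thesis
    by (simp add: topological_group_def group_unitary_operators)
qed

section \<open>Semigroups over the free product\<close>

locale free_product_semigroup =
  fixes I :: "'i set" and G :: "'g monoid" and \<tau> :: "'g topology" and \<iota> :: "'i \<Rightarrow> real \<Rightarrow> 'g"
    and M :: "'g monoid" and \<sigma> :: "'g topology"
  assumes free: "free_topological_product I G \<tau> \<iota>"
    and M: "M = nonneg_submonoid I G \<iota>" and \<sigma>: "\<sigma> = subtopology \<tau> (carrier M)"
begin

sublocale group G
  using free by (simp add: free_topological_product_def topological_group_def)

lemma
  assumes i: "i \<in> I"
  shows \<iota>_closed: "\<iota> i t \<in> carrier G" and \<iota>_add: "\<iota> i (s + t) = \<iota> i s \<otimes>\<^bsub>G\<^esub> \<iota> i t"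
    and \<iota>_0: "\<iota> i 0 = \<one>\<^bsub>G\<^esub>" and \<iota>_cont: "continuous_map euclideanreal \<tau> (\<iota> i)"
proof -
  have h: "\<iota> i \<in> hom real_group G" and "continuous_map euclideanreal \<tau> (\<iota> i)"
    using free i by (auto simp: free_topological_product_def continuous_one_param_def)
  then show "\<iota> i t \<in> carrier G" "\<iota> i (s + t) = \<iota> i s \<otimes>\<^bsub>G\<^esub> \<iota> i t" "continuous_map euclideanreal \<tau> (\<iota> i)"
    by (auto simp: hom_def)
  show "\<iota> i 0 = \<one>\<^bsub>G\<^esub>"
    using hom_one[OF h group_real_group is_group] by simp
qed

lemma word_prod_closed: "set w \<subseteq> I \<times> UNIV \<Longrightarrow> word_prod G \<iota> w \<in> carrier G"
  by (induction w) (auto simp: word_prod_def \<iota>_closed)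

lemma word_prod_Cons: "word_prod G \<iota> ((i, t) # w) = \<iota> i t \<otimes>\<^bsub>G\<^esub> word_prod G \<iota> w"
  by (simp add: word_prod_def)

lemma M_simps [simp]: "x \<otimes>\<^bsub>M\<^esub> y = x \<otimes>\<^bsub>G\<^esub> y" "\<one>\<^bsub>M\<^esub> = \<one>\<^bsub>G\<^esub>"
  by (simp_all add: M nonneg_submonoid_def)

lemma carrier_M: "carrier M = {word_prod G \<iota> w | w. set w \<subseteq> I \<times> {0..}}"
  by (simp add: M nonneg_submonoid_def)

lemma word_in_M: "set w \<subseteq> I \<times> {0..} \<Longrightarrow> word_prod G \<iota> w \<in> carrier M"
  by (auto simp: carrier_M)

lemma carrier_M_subset: "carrier M \<subseteq> carrier G"
  unfolding carrier_M using word_prod_closed by fastforce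

lemma topspace_\<sigma>: "topspace \<sigma> = carrier M"
proof -
  have "topspace \<tau> = carrier G"
    using free by (simp add: free_topological_product_def topological_group_def)
  then show ?thesis using carrier_M_subset by (auto simp: \<sigma>)
qed

lemma one_in_M: "\<one>\<^bsub>G\<^esub> \<in> carrier M"
  using word_in_M[of "[]"] by (simp add: word_prod_def)

lemma word_prod_append:
  assumes v: "set v \<subseteq> I \<times> UNIV" and w: "set w \<subseteq> I \<times> UNIV"
  shows "word_prod G \<iota> (v @ w) = word_prod G \<iota> v \<otimes>\<^bsub>G\<^esub> word_prod G \<iota> w"
  using v
proof (induction v)
  case Nil
  then show ?case
    using word_prod_closed[OF w] by (simp add: word_prod_def)
next
  case (Cons p v)
  then obtain i t where "p = (i, t)" "i \<in> I" "set v \<subseteq> I \<times> UNIV"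
    by (cases p) auto
  then show ?case
    using Cons.IH \<iota>_closed word_prod_closed w by (simp add: word_prod_Cons m_assoc)
qed

lemma M_closed:
  assumes "x \<in> carrier M" "y \<in> carrier M" shows "x \<otimes>\<^bsub>G\<^esub> y \<in> carrier M"
proof -
  obtain v w where v: "x = word_prod G \<iota> v" "set v \<subseteq> I \<times> {0..}"
    and w: "y = word_prod G \<iota> w" "set w \<subseteq> I \<times> {0..}"
    using assms by (auto simp: carrier_M)
  then have "set v \<subseteq> I \<times> UNIV" "set w \<subseteq> I \<times> UNIV" by auto
  then have "x \<otimes>\<^bsub>G\<^esub> y = word_prod G \<iota> (v @ w)"
    by (simp add: v(1) w(1) word_prod_append)
  then show ?thesis
    using v(2) w(2) word_in_M[of "v @ w"] by simp
qed

lemma \<iota>_in_M: "i \<in> I \<Longrightarrow> t \<ge> 0 \<Longrightarrow> \<iota> i t \<in> carrier M"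
  using word_in_M[of "[(i, t)]"] by (simp add: word_prod_def \<iota>_closed)

context
  fixes T :: "'g \<Rightarrow> 'h::complex_hilbert_space \<Rightarrow>\<^sub>L 'h"
  assumes T: "T \<in> contractive_semigroups M \<sigma>"
begin

lemma T_contraction: "x \<in> carrier M \<Longrightarrow> contraction (T x)"
  and T_one: "T \<one>\<^bsub>G\<^esub> = id_blinfun"
  and T_mult: "x \<in> carrier M \<Longrightarrow> y \<in> carrier M \<Longrightarrow> T (x \<otimes>\<^bsub>G\<^esub> y) = T x o\<^sub>L T y"
  and T_cont: "continuous_map \<sigma> strong_operator_topology T"
  using T by (auto simp: contractive_semigroups_def)

lemma T_word: "set w \<subseteq> I \<times> {0..} \<Longrightarrow> T (word_prod G \<iota> w) = word_op (\<lambda>i t. T (\<iota> i t)) w"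
proof (induction w)
  case Nil
  then show ?case by (simp add: word_prod_def word_op_def T_one)
next
  case (Cons p w)
  then obtain i t where "p = (i, t)" "i \<in> I" "t \<ge> 0" "set w \<subseteq> I \<times> {0..}"
    by (cases p) auto
  then show ?case
    using Cons.IH T_mult[OF \<iota>_in_M word_in_M, of i t w] by (simp add: word_prod_Cons word_op_def)
qed

lemma contraction_semigroup_component:
  assumes i: "i \<in> I" shows "contraction_semigroup (\<lambda>t. T (\<iota> i t))"
  unfolding contraction_semigroup_def
proof (intro conjI allI impI)
  show "T (\<iota> i 0) = id_blinfun" by (simp add: \<iota>_0[OF i] T_one)
  show "contraction (T (\<iota> i t))" if "t \<ge> 0" for t
    using i that by (intro T_contraction \<iota>_in_M)
  show "T (\<iota> i (s + t)) = T (\<iota> i s) o\<^sub>L T (\<iota> i t)" if "s \<ge> 0" "t \<ge> 0" for s t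
    unfolding \<iota>_add[OF i] using i that by (intro T_mult \<iota>_in_M)
  have "continuous_map (top_of_set {0..}) \<sigma> (\<iota> i)"
    unfolding \<sigma> using i \<iota>_in_M
    by (intro continuous_map_into_subtopology continuous_map_from_subtopology[OF \<iota>_cont]) auto
  then have "continuous_map (top_of_set {0..}) strong_operator_topology (T \<circ> \<iota> i)"
    using T_cont by (rule continuous_map_compose)
  then show "continuous_on {0..} (\<lambda>t. T (\<iota> i t) x)" for x
    by (simp add: continuous_on_strong_operator_topo_iff_coordinatewise)
qed

text \<open>Unitarity at time \<open>1\<close> gives unitarity at all integers \<open>n\<close>, then at all \<open>t \<le> n\<close> by factoring
  \<open>n = t + (n - t)\<close>, and then on all words.\<close>

lemma unitary_iff_at_one:
  "(\<forall>x\<in>carrier M. unitary (T x)) \<longleftrightarrow> (\<forall>i\<in>I. unitary (T (\<iota> i 1)))"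
proof
  assume *: "\<forall>i\<in>I. unitary (T (\<iota> i 1))"
  have 1: "unitary (T (\<iota> i t))" if i: "i \<in> I" and t: "t \<ge> 0" for i t
  proof -
    note S = contraction_semigroup_component[OF i, unfolded contraction_semigroup_def]
    have n: "unitary (T (\<iota> i (real n)))" for n
    proof (induction n)
      case 0
      then show ?case by (simp add: \<iota>_0[OF i] T_one unitary_id)
    next
      case (Suc n)
      have "T (\<iota> i (1 + real n)) = T (\<iota> i 1) o\<^sub>L T (\<iota> i (real n))"
        using S by simp
      then show ?case
        using unitary_compose[OF *[rule_format, OF i] Suc] by simp
    qed
    obtain m where "t \<le> real m" using real_arch_simple by blast
    then have s: "0 \<le> real m - t" by simp
    have "T (\<iota> i (t + (real m - t))) = T (\<iota> i t) o\<^sub>L T (\<iota> i (real m - t))"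
      "T (\<iota> i ((real m - t) + t)) = T (\<iota> i (real m - t)) o\<^sub>L T (\<iota> i t)"
      using S t s by blast+
    then have "T (\<iota> i t) o\<^sub>L T (\<iota> i (real m - t)) = T (\<iota> i (real m))"
      "T (\<iota> i (real m - t)) o\<^sub>L T (\<iota> i t) = T (\<iota> i (real m))"
      by simp_all
    then show ?thesis
      using S t s by (intro unitary_factor[OF _ _ _ _ n[of m]]) auto
  qed
  have "unitary (word_op (\<lambda>i t. T (\<iota> i t)) w)" if "set w \<subseteq> I \<times> {0..}" for w
    using that by (induction w) (auto simp: word_op_def unitary_id intro!: unitary_compose 1)
  then show "\<forall>x\<in>carrier M. unitary (T x)"
    using T_word by (auto simp: carrier_M)
qed (use \<iota>_in_M in auto)

end

end

section \<open>Unitary semigroups form a G-delta set\<close>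

lemma cinner_sgn: "cinner x (sgn x) = complex_of_real (norm (x :: 'h::complex_hilbert_space))"
  by (cases "x = 0")
    (simp_all add: sgn_div_norm cinner.scaleR_right cinner_self power2_eq_square scaleR_conv_of_real)

text \<open>The slack \<open>1 / Suc m\<close> turns the bound \<open>\<parallel>A (d n)\<parallel> \<ge> \<parallel>d n\<parallel>\<close> into countably many strict
  inequalities, each of which is an open condition on \<open>A\<close>.\<close>

lemma isometric_if_on_dense:
  fixes A :: "'h::complex_hilbert_space \<Rightarrow>\<^sub>L 'h"
  assumes d: "\<And>x \<epsilon>. \<epsilon> > 0 \<Longrightarrow> \<exists>n. dist x (d n) < \<epsilon>"
    and A: "\<And>x. norm (A x) \<le> norm x"
    and ge: "\<And>n m. norm (A (d n)) > norm (d n) - 1 / real (Suc m)"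
  shows "norm (A x) = norm x"
proof (rule antisym[OF A field_le_epsilon])
  fix \<epsilon> :: real assume \<epsilon>: "\<epsilon> > 0"
  obtain n where n: "norm (x - d n) < \<epsilon> / 3"
    using d[of "\<epsilon> / 3" x] \<epsilon> by (auto simp: dist_norm)
  obtain m where m: "1 / real (Suc m) < \<epsilon> / 3"
    using nat_approx_posE[of "\<epsilon> / 3"] \<epsilon> by auto
  have "norm x \<le> norm (d n) + norm (x - d n)"
    using norm_triangle_ineq[of "d n" "x - d n"] by simp
  moreover have "norm (A (d n)) \<le> norm (A x) + norm (A (x - d n))"
    using norm_triangle_ineq4[of "A x" "A (x - d n)"] by (simp add: blinfun.diff_right)
  ultimately show "norm x \<le> norm (A x) + \<epsilon>"
    using A[of "x - d n"] ge[where n = n and m = m] n m by linarith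
qed

text \<open>The two conditions say that \<open>A\<close> and its adjoint are isometric, with norms written as suprema of
  matrix coefficients so that each condition is open in \<open>A\<close>. The suprema are attained at
  normalised vectors.\<close>

lemma unitary_iff_open_conditions:
  fixes A :: "'h::complex_hilbert_space \<Rightarrow>\<^sub>L 'h"
  assumes e: "hilbert_basis (e :: nat \<Rightarrow> 'h)" and A: "contraction A"
    and d: "\<And>x \<epsilon>. \<epsilon> > 0 \<Longrightarrow> \<exists>n. dist x (d n :: 'h) < \<epsilon>"
  shows "unitary A \<longleftrightarrow> (\<forall>n m.
      (\<exists>y. norm y \<le> 1 \<and> norm (d n) - 1 / real (Suc m) < cmod (cinner (A (d n)) y)) \<and>
      (\<exists>y. norm y \<le> 1 \<and> norm (d n) - 1 / real (Suc m) < cmod (cinner (A y) (d n))))"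
    (is "_ \<longleftrightarrow> (\<forall>n m. ?L n m \<and> ?R n m)")
proof
  assume U: "unitary A"
  then obtain V where V: "is_adjoint A V" "A o\<^sub>L V = id_blinfun" by (auto simp: unitary_def)
  have AV: "A (V x) = x" for x
    using arg_cong[OF V(2), of "\<lambda>B. blinfun_apply B x"] by simp
  have n1: "norm (sgn x) \<le> 1" for x :: 'h by (simp add: norm_sgn)
  show "\<forall>n m. ?L n m \<and> ?R n m"
  proof (intro allI conjI)
    fix n m
    show "?L n m"
      by (rule exI[of _ "sgn (A (d n))"]) (simp add: n1 cinner_sgn unitary_norm[OF U])
    have "norm (V (sgn (d n))) \<le> 1"
      using n1[of "d n"] unitary_norm[OF U, of "V (sgn (d n))"] by (simp add: AV)
    moreover have "cmod (cinner (sgn (d n)) (d n)) = norm (d n)"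
      using cinner_sgn[of "d n"] cinner_commute[of "sgn (d n)" "d n"] by simp
    ultimately show "?R n m"
      by (intro exI[of _ "V (sgn (d n))"]) (simp add: AV)
  qed
next
  assume *: "\<forall>n m. ?L n m \<and> ?R n m"
  obtain B where B: "is_adjoint A B" "\<And>x. norm (B x) \<le> norm x"
    using adjoint_exists[OF e contraction_linear[OF A] contraction_norm[OF A]] by blast
  have le: "cmod (cinner x y) \<le> norm x" if "norm y \<le> 1" for x y :: 'h
    using norm_cinner_le[of x y] mult_left_mono[OF that, of "norm x"] by simp
  have nA: "norm (A x) = norm x" for x
  proof (rule isometric_if_on_dense[OF d contraction_norm[OF A]])
    fix n m
    obtain y where y: "norm y \<le> 1" "norm (d n) - 1 / real (Suc m) < cmod (cinner (A (d n)) y)"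
      using * by blast
    then show "norm (d n) - 1 / real (Suc m) < norm (A (d n))"
      using le[OF y(1), of "A (d n)"] by linarith
  qed
  have nB: "norm (B x) = norm x" for x
  proof (rule isometric_if_on_dense[OF d B(2)])
    fix n m
    obtain y where y: "norm y \<le> 1" "norm (d n) - 1 / real (Suc m) < cmod (cinner (A y) (d n))"
      using * by blast
    have "cmod (cinner (A y) (d n)) = cmod (cinner (B (d n)) y)"
      using B(1) cinner_commute[of y "B (d n)"] by (simp add: is_adjoint_def)
    also have "\<dots> \<le> norm (B (d n))" by (rule le[OF y(1)])
    finally show "norm (d n) - 1 / real (Suc m) < norm (B (d n))" using y(2) by linarith
  qed
  have lB: "complex_linear B"
    by (rule is_adjoint_complex_linear[OF is_adjoint_sym[OF B(1)]])
  have "A o\<^sub>L B = id_blinfun"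
  proof (rule blinfun_eqI, rule cinner_eqI)
    show "cinner ((A o\<^sub>L B) x) y = cinner (id_blinfun x) y" for x y
      using isometry_cinner[OF lB nB, of x y] B(1) by (simp add: is_adjoint_def)
  qed
  then show "unitary A"
    by (rule unitary_if_isometric_inverse(3)[OF contraction_linear[OF A] nA])
qed

lemma openin_k_WOT_evaluation:
  assumes "x \<in> topspace \<sigma>"
  shows "openin (k_WOT M \<sigma>) {T \<in> contractive_semigroups M \<sigma>. r < cmod (cinner (blinfun_apply (T x) \<xi>) \<eta>)}"
proof (subst openin_subopen, intro ballI)
  fix T assume T: "T \<in> {T \<in> contractive_semigroups M \<sigma>. r < cmod (cinner (blinfun_apply (T x) \<xi>) \<eta>)}"
  define \<epsilon> where "\<epsilon> = cmod (cinner (blinfun_apply (T x) \<xi>) \<eta>) - r"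
  let ?U = "{S \<in> contractive_semigroups M \<sigma>. weak_dist {x} \<xi> \<eta> S T < \<epsilon>}"
  have \<epsilon>: "\<epsilon> > 0" using T by (simp add: \<epsilon>_def)
  have "openin (k_WOT M \<sigma>) ?U"
    unfolding k_WOT_def
  proof (rule topology_generated_by_Basis, intro CollectI exI conjI)
    show "compactin \<sigma> {x}" using assms by simp
  qed (use T \<epsilon> in auto)
  moreover have "T \<in> ?U"
    using T \<epsilon> by (simp add: weak_dist_refl)
  moreover have "r < cmod (cinner (blinfun_apply (S x) \<xi>) \<eta>)" if "S \<in> ?U" for S
  proof -
    have "cmod (cinner (blinfun_apply (S x) \<xi>) \<eta> - cinner (blinfun_apply (T x) \<xi>) \<eta>) < \<epsilon>"
      using that by (simp add: weak_dist_def blinfun.diff_left cinner_diff_left)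
    then show ?thesis
      using norm_triangle_ineq2[of "cinner (blinfun_apply (T x) \<xi>) \<eta>" "cinner (blinfun_apply (S x) \<xi>) \<eta>"]
      by (simp add: \<epsilon>_def norm_minus_commute)
  qed
  ultimately show "\<exists>U. openin (k_WOT M \<sigma>) U \<and> T \<in> U \<and>
      U \<subseteq> {T \<in> contractive_semigroups M \<sigma>. r < cmod (cinner (blinfun_apply (T x) \<xi>) \<eta>)}"
    by (intro exI[of _ ?U]) auto
qed

lemma (in free_product_semigroup) gdelta_unitary_semigroups:
  fixes e :: "nat \<Rightarrow> 'h::complex_hilbert_space"
  assumes sep: "separable_space (euclidean :: 'h topology)" and e: "hilbert_basis e"
    and I: "I \<noteq> {}" "countable I"
  shows "gdelta_in (k_WOT M \<sigma>) (unitary_semigroups M \<sigma> :: ('g \<Rightarrow> 'h \<Rightarrow>\<^sub>L 'h) set)"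
proof -
  let ?X = "contractive_semigroups M \<sigma> :: ('g \<Rightarrow> 'h \<Rightarrow>\<^sub>L 'h) set"
  obtain d :: "nat \<Rightarrow> 'h" where d: "\<And>x \<epsilon>. \<epsilon> > 0 \<Longrightarrow> \<exists>n. dist x (d n) < \<epsilon>"
    using separable_dense_sequence[OF sep] by blast
  define c where "c n m = norm (d n) - 1 / real (Suc m)" for n m
  define P where "P i n m = (\<Union>y\<in>cball 0 1. {T \<in> ?X. c n m < cmod (cinner (T (\<iota> i 1) (d n)) y)})" for i n m
  define Q where "Q i n m = (\<Union>y\<in>cball 0 1. {T \<in> ?X. c n m < cmod (cinner (T (\<iota> i 1) y) (d n))})" for i n m
  have op: "openin (k_WOT M \<sigma>) (P i n m)" "openin (k_WOT M \<sigma>) (Q i n m)" if "i \<in> I" for i n m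
    unfolding P_def Q_def using \<iota>_in_M[OF that, of 1]
    by (auto intro!: openin_Union openin_k_WOT_evaluation simp: topspace_\<sigma>)
  let ?F = "(\<lambda>(i, n, m). P i n m \<inter> Q i n m) ` (I \<times> UNIV \<times> UNIV)"
  have "gdelta_in (k_WOT M \<sigma>) (\<Inter> ?F)"
  proof (rule gdelta_in_Inter)
    show "countable ?F" using I(2) by auto
    show "?F \<noteq> {}" using I(1) by auto
    show "gdelta_in (k_WOT M \<sigma>) U" if "U \<in> ?F" for U
      using that op by (auto intro!: open_imp_gdelta_in openin_Int)
  qed
  moreover have "\<Inter> ?F = unitary_semigroups M \<sigma>"
  proof -
    have mem: "T \<in> \<Inter> ?F \<longleftrightarrow> T \<in> ?X \<and> (\<forall>i\<in>I. unitary (T (\<iota> i 1)))" for T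
    proof (cases "T \<in> ?X")
      case True
      then have "unitary (T (\<iota> i 1)) \<longleftrightarrow> (\<forall>n m. T \<in> P i n m \<inter> Q i n m)" if "i \<in> I" for i
        using unitary_iff_open_conditions[OF e T_contraction[OF True \<iota>_in_M[OF that, of 1]] d]
        by (simp add: P_def Q_def c_def Bex_def)
      then show ?thesis using True by auto
    next
      case False
      then show ?thesis using I(1) by (auto simp: P_def)
    qed
    show ?thesis
    proof (rule Set.set_eqI)
      show "T \<in> \<Inter> ?F \<longleftrightarrow> T \<in> unitary_semigroups M \<sigma>" for T
        unfolding mem unitary_semigroups_def mem_Collect_eq using unitary_iff_at_one[of T] by blast
    qed
  qed
  ultimately show ?thesis by simp
qed

section \<open>Density\<close>

lemma (in free_product_semigroup) unitary_representation:
  assumes V: "\<And>i. i \<in> I \<Longrightarrow> unitary_group (V i)"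
  obtains h where "\<And>x. x \<in> carrier G \<Longrightarrow> unitary (h x)" "h \<one>\<^bsub>G\<^esub> = id_blinfun"
    "\<And>x y. x \<in> carrier G \<Longrightarrow> y \<in> carrier G \<Longrightarrow> h (x \<otimes>\<^bsub>G\<^esub> y) = h x o\<^sub>L h y"
    "continuous_map \<tau> strong_operator_topology h"
    "\<And>w. set w \<subseteq> I \<times> UNIV \<Longrightarrow> h (word_prod G \<iota> w) = word_op V w"
proof -
  have "continuous_one_param unitary_operators unitary_topology (V i)" if i: "i \<in> I" for i
    using V[OF i] unitary_group_unitary[OF V[OF i]]
    by (auto simp: continuous_one_param_def hom_def continuous_map_unitary_topology unitary_group_def)
  then obtain h where h: "h \<in> hom G unitary_operators" "continuous_map \<tau> unitary_topology h"
    "\<And>i t. i \<in> I \<Longrightarrow> h (\<iota> i t) = V i t"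
    using free_topological_product_universal[OF free topological_group_unitary_operators, of V] by blast
  have one: "h \<one>\<^bsub>G\<^esub> = id_blinfun"
    using hom_one[OF h(1) is_group group_unitary_operators] by simp
  have mult: "h (x \<otimes>\<^bsub>G\<^esub> y) = h x o\<^sub>L h y" if "x \<in> carrier G" "y \<in> carrier G" for x y
    using hom_mult[OF h(1) that] by simp
  have "h (word_prod G \<iota> w) = word_op V w" if "set w \<subseteq> I \<times> UNIV" for w
    using that
  proof (induction w)
    case Nil
    then show ?case by (simp add: word_prod_def word_op_def one)
  next
    case (Cons p w)
    then obtain i t where "p = (i, t)" "i \<in> I" "set w \<subseteq> I \<times> UNIV"
      by (cases p) auto
    then show ?case
      using Cons.IH mult[OF \<iota>_closed word_prod_closed, of i w t] h(3) by (simp add: word_prod_Cons word_op_def)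
  qed
  moreover have "continuous_map \<tau> strong_operator_topology h"
    using h(2) by (simp add: unitary_topology_def continuous_map_in_subtopology)
  moreover have "unitary (h x)" if "x \<in> carrier G" for x
    using hom_in_carrier[OF h(1) that] by simp
  ultimately show ?thesis using that one mult by blast
qed

text \<open>The semigroup \<open>R N\<close> is the representation of \<open>G\<close> from the joint dilation, conjugated by a unitary
  \<open>W N\<close> that agrees with the embedding \<open>C\<close> on the first \<open>N\<close> basis vectors.\<close>

lemma (in free_product_semigroup) approximation_by_unitary_semigroups:
  fixes e :: "nat \<Rightarrow> 'h::complex_hilbert_space" and T :: "'g \<Rightarrow> 'h \<Rightarrow>\<^sub>L 'h"
  assumes sep: "separable_space (euclidean :: 'h topology)" and e: "hilbert_basis e"
    and I: "countable I" and T: "T \<in> contractive_semigroups M \<sigma>"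
  obtains R where "\<And>N :: nat. R N \<in> unitary_semigroups M \<sigma>" "limitin (k_WOT M \<sigma>) R T sequentially"
proof -
  obtain V :: "'i \<Rightarrow> real \<Rightarrow> 'h \<Rightarrow>\<^sub>L 'h" and C C' \<phi>
    where V: "\<And>i. i \<in> I \<Longrightarrow> unitary_group (V i)" and C: "is_adjoint C C'" "\<And>x. norm (C x) = norm x"
      and \<phi>: "inj \<phi>" "\<And>n. C (e n) = e (\<phi> n)"
      and dil: "\<And>w x. set w \<subseteq> I \<times> {0..} \<Longrightarrow> C' (word_op V w (C x)) = word_op (\<lambda>i t. T (\<iota> i t)) w x"
    using joint_dilation[where S = "\<lambda>i t. T (\<iota> i t)", OF sep e I contraction_semigroup_component[OF T]] by blast
  obtain h where h: "\<And>x. x \<in> carrier G \<Longrightarrow> unitary (h x)" "h \<one>\<^bsub>G\<^esub> = id_blinfun"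
    "\<And>x y. x \<in> carrier G \<Longrightarrow> y \<in> carrier G \<Longrightarrow> h (x \<otimes>\<^bsub>G\<^esub> y) = h x o\<^sub>L h y"
    "continuous_map \<tau> strong_operator_topology h"
    "\<And>w. set w \<subseteq> I \<times> UNIV \<Longrightarrow> h (word_prod G \<iota> w) = word_op V w"
    using unitary_representation[where V = V, OF V] by blast
  have compress: "C' (h x (C \<xi>)) = T x \<xi>" if x: "x \<in> carrier M" for x \<xi>
  proof -
    obtain w where w: "x = word_prod G \<iota> w" "set w \<subseteq> I \<times> {0..}"
      using x by (auto simp: carrier_M)
    then have "set w \<subseteq> I \<times> UNIV" by auto
    then show ?thesis
      using dil[OF w(2)] T_word[OF T w(2)] h(5) by (simp add: w(1))
  qed
  have "\<exists>W W'. is_adjoint W W' \<and> W' o\<^sub>L W = id_blinfun \<and> W o\<^sub>L W' = id_blinfun \<and>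
      (\<forall>x. norm (W x) = norm x) \<and> (\<forall>n<N. W (e n) = C (e n))" for N
  proof -
    obtain \<pi> where \<pi>: "bij \<pi>" "\<forall>n<N. \<pi> n = \<phi> n"
      using injection_agrees_with_bijection[OF \<phi>(1)] by blast
    obtain W W' where "is_adjoint W W'" "W' o\<^sub>L W = id_blinfun" "W o\<^sub>L W' = id_blinfun"
      "\<And>x. norm (W x) = norm x" "\<And>n. W (e n) = e (\<pi> n)"
      by (rule unitary_permutation[OF e \<pi>(1)]) blast
    then show ?thesis
      using \<pi>(2) \<phi>(2) by (intro exI[of _ W] exI[of _ W']) auto
  qed
  then obtain W W' where W: "\<And>N. is_adjoint (W N) (W' N)" "\<And>N. W' N o\<^sub>L W N = id_blinfun"
    "\<And>N. W N o\<^sub>L W' N = id_blinfun" "\<And>N x. norm (W N x) = norm x"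
    "\<And>N n. n < N \<Longrightarrow> W N (e n) = C (e n)"
    by metis
  have WW': "W N (W' N x) = x" "W' N (W N x) = x" for N x
    using arg_cong[OF W(3), of "\<lambda>A. blinfun_apply A x" N] arg_cong[OF W(2), of "\<lambda>A. blinfun_apply A x" N]
    by simp_all
  have W_lim: "(\<lambda>N. W N x) \<longlonglongrightarrow> C x" for x
    by (rule isometry_approximation[OF e is_adjoint_complex_linear[OF C(1)] is_adjoint_complex_linear[OF W(1)]])
      (simp_all add: C W)
  define R where "R N x = (if x \<in> carrier M then W' N o\<^sub>L h x o\<^sub>L W N else undefined)" for N x
  have hM: "unitary (h x)" if "x \<in> carrier M" for x
    using that h(1) carrier_M_subset by blast
  have uW: "unitary (W N)" "unitary (W' N)" for N
    using W(1-3)[of N] is_adjoint_sym[OF W(1)[of N]] unfolding unitary_def by blast+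
  have uR: "unitary (R N x)" if "x \<in> carrier M" for N x
    using hM[OF that] uW that by (simp add: R_def unitary_compose)
  have R: "R N \<in> unitary_semigroups M \<sigma>" for N
    unfolding unitary_semigroups_def contractive_semigroups_def
  proof (intro CollectI conjI ballI)
    show "R N \<in> extensional (carrier M)" by (simp add: R_def extensional_def)
    show "R N \<one>\<^bsub>M\<^esub> = id_blinfun"
      using one_in_M by (auto intro!: blinfun_eqI simp: R_def h(2) WW')
    show "R N (x \<otimes>\<^bsub>M\<^esub> y) = R N x o\<^sub>L R N y" if xy: "x \<in> carrier M" "y \<in> carrier M" for x y
    proof -
      have "x \<otimes>\<^bsub>G\<^esub> y \<in> carrier M"
        using xy by (rule M_closed)
      then show ?thesis
        using xy h(3)[of x y] carrier_M_subset
        by (auto intro!: blinfun_eqI simp: R_def WW' subset_iff)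
    qed
    show "contraction (R N x)" "unitary (R N x)" if "x \<in> carrier M" for x
      using uR[OF that] by (auto intro: unitary_contraction)
    have cont: "continuous_map \<sigma> euclidean (\<lambda>x. W' N (h x (W N \<xi>)))" for \<xi>
    proof -
      have "continuous_map \<sigma> euclidean (\<lambda>x. h x (W N \<xi>))"
        unfolding \<sigma> using h(4)
        by (simp add: continuous_on_strong_operator_topo_iff_coordinatewise continuous_map_from_subtopology)
      moreover have "continuous_map euclidean euclidean (blinfun_apply (W' N))"
        by (simp add: blinfun.continuous_on continuous_on_id)
      ultimately have "continuous_map \<sigma> euclidean (blinfun_apply (W' N) \<circ> (\<lambda>x. h x (W N \<xi>)))"
        by (rule continuous_map_compose)
      then show ?thesis by (simp add: o_def)
    qed
    show "continuous_map \<sigma> strong_operator_topology (R N)"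
      unfolding continuous_on_strong_operator_topo_iff_coordinatewise
    proof
      show "continuous_map \<sigma> euclidean (\<lambda>x. R N x \<xi>)" for \<xi>
        by (rule continuous_map_eq[OF cont[of \<xi>]]) (simp add: R_def topspace_\<sigma>)
    qed
  qed
  then have RX: "R N \<in> contractive_semigroups M \<sigma>" for N
    by (simp add: unitary_semigroups_def)
  have close: "cmod (cinner ((R N x - T x) \<xi>) \<eta>)
      \<le> norm (W N \<xi> - C \<xi>) * norm \<eta> + norm \<xi> * norm (W N \<eta> - C \<eta>)" if x: "x \<in> carrier M" for N x \<xi> \<eta>
  proof -
    have "cinner (R N x \<xi>) \<eta> = cinner (h x (W N \<xi>)) (W N \<eta>)"
      using is_adjoint_sym[OF W(1)[of N]] x by (simp add: R_def is_adjoint_def)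
    moreover have "cinner (T x \<xi>) \<eta> = cinner (h x (C \<xi>)) (C \<eta>)"
      using is_adjoint_sym[OF C(1)] compress[OF x, of \<xi>, symmetric] by (simp add: is_adjoint_def)
    ultimately have "cinner ((R N x - T x) \<xi>) \<eta>
        = cinner (h x (W N \<xi> - C \<xi>)) (W N \<eta>) + cinner (h x (C \<xi>)) (W N \<eta> - C \<eta>)"
      by (simp add: blinfun.diff_left blinfun.diff_right cinner.diff_left cinner.diff_right)
    also have "cmod \<dots> \<le> cmod (cinner (h x (W N \<xi> - C \<xi>)) (W N \<eta>)) + cmod (cinner (h x (C \<xi>)) (W N \<eta> - C \<eta>))"
      by (rule norm_triangle_ineq)
    also have "\<dots> \<le> norm (h x (W N \<xi> - C \<xi>)) * norm (W N \<eta>) + norm (h x (C \<xi>)) * norm (W N \<eta> - C \<eta>)"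
      by (intro add_mono norm_cinner_le)
    finally show ?thesis
      by (simp add: unitary_norm[OF hM[OF x]] W(4) C(2))
  qed
  have ne: "carrier M \<noteq> {}" using one_in_M by blast
  have "limitin (k_WOT M \<sigma>) R T sequentially"
    unfolding limitin_k_WOT[where \<T> = R, OF topspace_\<sigma> ne T RX]
  proof (intro allI impI)
    fix K :: "'g set" and \<xi> \<eta> :: 'h
    assume K: "compactin \<sigma> K" "K \<noteq> {}"
    have KM: "K \<subseteq> carrier M"
      using compactin_subset_topspace[OF K(1)] by (simp add: topspace_\<sigma>)
    let ?b = "\<lambda>N. norm (W N \<xi> - C \<xi>) * norm \<eta> + norm \<xi> * norm (W N \<eta> - C \<eta>)"
    have "?b \<longlonglongrightarrow> norm (C \<xi> - C \<xi>) * norm \<eta> + norm \<xi> * norm (C \<eta> - C \<eta>)"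
      by (intro tendsto_add tendsto_mult tendsto_const tendsto_norm tendsto_diff W_lim)
    then have lim: "?b \<longlonglongrightarrow> 0" by simp
    have upper: "weak_dist K \<xi> \<eta> (R N) T \<le> ?b N" for N
      unfolding weak_dist_def using K(2) KM close by (intro cSUP_least) auto
    have lower: "0 \<le> weak_dist K \<xi> \<eta> (R N) T" for N
    proof -
      obtain x where "x \<in> K" using K(2) by blast
      then show ?thesis
        unfolding weak_dist_def by (rule cSUP_upper2[OF weak_dist_bdd[OF RX T KM]]) simp
    qed
    show "(\<lambda>N. weak_dist K \<xi> \<eta> (R N) T) \<longlonglongrightarrow> 0"
      by (rule tendsto_sandwich[OF _ _ tendsto_const lim]) (use upper lower in auto)
  qed
  with R show ?thesis by (rule that)
qed

theorem corollary6p2: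
  fixes I :: "'i set"
    and G :: "'g monoid" and \<tau> :: "'g topology" and \<iota> :: "'i \<Rightarrow> real \<Rightarrow> 'g"
    and X X\<^sub>u :: "('g \<Rightarrow> ('h::complex_hilbert_space \<Rightarrow>\<^sub>L 'h)) set"
    and M :: "'g monoid" and \<sigma> :: "'g topology"
  assumes "separable_space (euclidean :: 'h topology)"
    and "\<not> (\<exists>B :: 'h set. finite B \<and> complex_vector.span B = UNIV)"
    and "I \<noteq> {}" and "countable I"
    and "free_topological_product I G \<tau> \<iota>"
    and "M = nonneg_submonoid I G \<iota>" and "\<sigma> = subtopology \<tau> (carrier M)"
    and "X = contractive_semigroups M \<sigma>" and "X\<^sub>u = unitary_semigroups M \<sigma>"
  shows "X\<^sub>u \<subseteq> X \<and> gdelta_in (k_WOT M \<sigma>) X\<^sub>u \<and> (k_WOT M \<sigma>) closure_of X\<^sub>u = X"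
proof -
  interpret free_product_semigroup I G \<tau> \<iota> M \<sigma>
    using assms(5-7) by unfold_locales
  obtain e :: "nat \<Rightarrow> 'h" where e: "hilbert_basis e"
    using hilbert_basis_exists[OF assms(1,2)] by blast
  have top: "topspace (k_WOT M \<sigma>) = X"
    unfolding assms(8) by (rule topspace_k_WOT) (use one_in_M topspace_\<sigma> in auto)
  have "X \<subseteq> (k_WOT M \<sigma>) closure_of X\<^sub>u"
  proof
    fix T assume T: "T \<in> X"
    obtain R where R: "\<And>N :: nat. R N \<in> X\<^sub>u" "limitin (k_WOT M \<sigma>) R T sequentially"
      using approximation_by_unitary_semigroups[OF assms(1) e assms(4) T[unfolded assms(8)]]
      unfolding assms(9) by blast
    have "\<exists>S\<in>X\<^sub>u. S \<in> U" if "T \<in> U" "openin (k_WOT M \<sigma>) U" for U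
    proof -
      have "\<forall>\<^sub>F N in sequentially. R N \<in> U"
        using R(2) that by (simp add: limitin_def)
      then obtain N where "R N \<in> U"
        using eventually_happens'[OF sequentially_bot] by blast
      then show ?thesis using R(1) by blast
    qed
    then show "T \<in> (k_WOT M \<sigma>) closure_of X\<^sub>u"
      using T top by (auto simp: in_closure_of)
  qed
  moreover have "(k_WOT M \<sigma>) closure_of X\<^sub>u \<subseteq> X"
    unfolding top[symmetric] by (rule closure_of_subset_topspace)
  moreover have "X\<^sub>u \<subseteq> X"
    unfolding assms(8,9) by (auto simp: unitary_semigroups_def)
  moreover have "gdelta_in (k_WOT M \<sigma>) X\<^sub>u"
    unfolding assms(9) by (rule gdelta_unitary_semigroups[OF assms(1) e assms(3,4)])
  ultimately show ?thesis by blast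
qed

end
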